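(* (1) Let $\alpha,\beta\in\mathbb{P}^1(\mathbb{R})$, $\alpha\neq\beta$, let $\varpi=\varpi_{\beta\to\alpha}$, and let $B_0^{-1}\varpi=\llbracket i_1,i_2,i_3,\dots\rrbracket_{\Delta(2,3,7)}$ be its geodesic continued fraction expansion. For $k\ge1$ set $A_k=g_7^{i_k}g_2$, $B_k=B_0A_1\cdots A_k$, and $\varpi_k=B_k^{-1}\varpi$ ($k\ge0$). Then the following are equivalent: (i) there exist $z,w\in L$ with $D_{z,w}:=(z-\bar z)^2+4\eta w\bar w>0$ such that $\alpha=\frac{1}{2w}(z-\bar z\pm\sqrt{D_{z,w}})$ and $\beta=\frac{1}{2w}(z-\bar z\mp\sqrt{D_{z,w}})$ (if $w=0$, read as $(\alpha,\beta)=(0,\infty)$ or $(\infty,0)$); (ii) there exists $l_0\ge1$ with $\varpi_{l_0}=\varpi_0$ (in particular $i_{k+l_0}=i_k$ for all $k\ge1$). (2) Suppose these conditions hold for $z,w\in L$ and $l_0\ge1$, with $l_0$ minimal such that (ii) holds. Put $\gamma_0=B_{l_0}B_0^{-1}=B_0A_1\cdots A_{l_0}B_0^{-1}$. Then $\gamma_0\in\Gamma_\varpi=\mathcal O^1_{z,w}$ and $\gamma_0$ is a fundamental unit of $\mathcal O^1_{z,w}$, i.e. $\mathcal O^1_{z,w}=\{\pm\gamma_0^k:k\in\mathbb Z\}$; equivalently $\rho_\alpha(\gamma_0)\in F(\sqrt{D_{z,w}})$ is a fundamental unit of $U_{\mathcal O,z,w/F}$.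
   Context: Let $\eta=2\cos(2\pi/7)$, $F=\mathbb{Q}(\eta)\subset\mathbb{R}$, $L=F(\sqrt\eta)\subset\mathbb{R}$, and $\overline{x+y\sqrt\eta}=x-y\sqrt\eta$ for $x,y\in F$. $A=F+Fi+Fj+Fk$ ($i^2=j^2=\eta$, $ij=-ji=k$) is identified with $\left\{\begin{pmatrix}z&\eta\bar w\\ w&\bar z\end{pmatrix}:z,w\in L\right\}\subset M_2(\mathbb{R})$ via $i\mapsto\begin{pmatrix}0&\eta\\1&0\end{pmatrix}$, $j\mapsto\begin{pmatrix}\sqrt\eta&0\\0&-\sqrt\eta\end{pmatrix}$; $\mathcal O=\mathbb Z[\eta][i,j,\frac12(1+\eta i+(1+\eta+\eta^2)j)]$, $\Delta(2,3,7)=\mathcal O^1=\{x\in\mathcal O^\times:\det x=1\}$, acting on $\mathfrak h$ and $\mathbb{P}^1(\mathbb{R})$ by linear fractional transformations. $g_2=\begin{pmatrix}0&-\sqrt\eta\\1/\sqrt\eta&0\end{pmatrix}$, $g_3=\frac12\begin{pmatrix}1+(\eta^2-2)\sqrt\eta&-(\eta^2+\eta-1)\sqrt\eta\\(3-\eta^2)\sqrt\eta&1-(\eta^2-2)\sqrt\eta\end{pmatrix}$, $g_7=\frac12\begin{pmatrix}\eta^2+\eta-1&\eta^2-1-\sqrt\eta\\2-\eta^2+(\eta^2+\eta-2)\sqrt\eta&\eta^2+\eta-1\end{pmatrix}$; $\tau_3,\tau_7$ fixed points in $\mathfrak h$ of $g_3,g_7$, $\tau_3'=g_2\tau_3$.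 $\mathcal F$ = closed geodesic triangle with vertices $\tau_3,\tau_3',\tau_7$; $\mathcal D=\bigcup_{i=0}^6g_7^i\mathcal F$; $\mathbf e_0=[\tau_3,\tau_3')$, $\mathbf e_0'=(\tau_3,\tau_3']$ (half-open geodesic segments), $\mathbf e_i=g_7^i\mathbf e_0$, $\mathbf e_i'=g_7^i\mathbf e_0'$. $\varpi_{\beta\to\alpha}$ = geodesic oriented from $\beta$ to $\alpha$; $\Gamma_\varpi=\{\gamma\in\Delta(2,3,7):\gamma\alpha=\alpha,\gamma\beta=\beta\}$. $\varpi\cap\mathcal D$ (if nonempty) is an oriented segment from $P$ to $Q$; $\varpi$ enters from $\mathbf e_i$ if $P\in\mathbf e_i$, leaves from $\mathbf e_i'$ if $Q\in\mathbf e_i'$; $\varpi_{\beta\to\alpha}$ is reduced if it enters from $\mathbf e_0$ and $|\alpha|<\sqrt\eta$. Geodesic continued fraction expansion: choose $B_0\in\Delta(2,3,7)$ with $\varpi_0=B_0^{-1}\varpi$ reduced; given reduced $\varpi_k$, $i_{k+1}\in\mathbb Z/7\mathbb Z\setminus\{0\}$ is the unique index with $\varpi_k$ leaving $\mathcal D$ from $\mathbf e'_{i_{k+1}}$, and $\varpi_{k+1}=(g_7^{i_{k+1}}g_2)^{-1}\varpi_k$. For $z,w$ as in (i): $\theta_{z,w}=\begin{pmatrix}z&\eta\bar w\\ w&\bar z\end{pmatrix}$, $K_{z,w}=F[\theta_{z,w}]\subset A$ (a quadratic field), $\mathcal O_{z,w}=K_{z,w}\cap\mathcal O$, $\mathcal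 O^1_{z,w}=\mathcal O_{z,w}^\times\cap\mathcal O^1$; $\rho_\alpha:K_{z,w}\to F(\sqrt{D_{z,w}})\subset\mathbb{R}$, $\begin{pmatrix}q&r\\ s&t\end{pmatrix}\mapsto s\alpha+t$ (a field isomorphism), and $U_{\mathcal O,z,w/F}=\rho_\alpha(\mathcal O^1_{z,w})$. A fundamental unit of a group of the form $\{\pm\varepsilon^k\}$ means a generator modulo $\pm1$. *)

theory Defs
  imports "HOL-Analysis.Analysis"
begin

section \<open>The fields and the quaternion order\<close>

definition real_subring :: "real set \<Rightarrow> bool" where
  "real_subring S \<longleftrightarrow> 0 \<in> S \<and> 1 \<in> S \<and>
     (\<forall>x\<in>S. \<forall>y\<in>S. x + y \<in> S \<and> x - y \<in> S \<and> x * y \<in> S)"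

definition real_subfield :: "real set \<Rightarrow> bool" where
  "real_subfield S \<longleftrightarrow> real_subring S \<and> (\<forall>x\<in>S. inverse x \<in> S)"

definition field_adjoin :: "real set \<Rightarrow> real \<Rightarrow> real set" where
  "field_adjoin K x = real_subfield hull (insert x K)"

definition eta :: real where
  "eta = 2 * cos (2 * pi / 7)"

definition F_field :: "real set" where
  "F_field = field_adjoin \<rat> eta"

definition L_field :: "real set" where
  "L_field = field_adjoin F_field (sqrt eta)"

definition Z_eta :: "real set" where
  "Z_eta = real_subring hull (insert eta \<int>)"

text \<open>The nontrivial automorphism of L over F; the description determines a value exactly
  for the elements of L, because \<open>sqrt eta\<close> does not lie in F.\<close>
definition conjL :: "real \<Rightarrow> real" where
  "conjL u = (THE v. \<exists>x\<in>F_field. \<exists>y\<in>F_field. u = x + y * sqrt eta \<and> v = x - y * sqrt eta)"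

text \<open>Matrix multiplication is \<open>**\<close>; the operation \<open>*\<close> on this type is componentwise.\<close>
type_synonym mat2 = "real^2^2"

definition mat22 :: "real \<Rightarrow> real \<Rightarrow> real \<Rightarrow> real \<Rightarrow> mat2" where
  "mat22 a b c d = vector [vector [a, b], vector [c, d]]"

primrec mat_pow :: "mat2 \<Rightarrow> nat \<Rightarrow> mat2" where
  "mat_pow M 0 = mat 1"
| "mat_pow M (Suc n) = M ** mat_pow M n"

definition mat_powi :: "mat2 \<Rightarrow> int \<Rightarrow> mat2" where
  "mat_powi M k = (if 0 \<le> k then mat_pow M (nat k) else mat_pow (matrix_inv M) (nat (- k)))"

definition mat_subring :: "mat2 set \<Rightarrow> bool" where
  "mat_subring S \<longleftrightarrow> mat 0 \<in> S \<and> mat 1 \<in> S \<and>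
     (\<forall>M\<in>S. \<forall>N\<in>S. M + N \<in> S \<and> M - N \<in> S \<and> M ** N \<in> S)"

text \<open>\<open>mat_adjoin R X\<close> is \<open>R[X]\<close>, where R is a ring of scalar matrices.\<close>
definition mat_adjoin :: "real set \<Rightarrow> mat2 set \<Rightarrow> mat2 set" where
  "mat_adjoin R X = mat_subring hull (mat ` R \<union> X)"

definition mat_units :: "mat2 set \<Rightarrow> mat2 set" where
  "mat_units S = {M \<in> S. \<exists>N\<in>S. M ** N = mat 1 \<and> N ** M = mat 1}"

definition quat_i :: mat2 where
  "quat_i = mat22 0 eta 1 0"

definition quat_j :: mat2 where
  "quat_j = mat22 (sqrt eta) 0 0 (- sqrt eta)"

definition order_O :: "mat2 set" where
  "order_O = mat_adjoin Z_eta
     {quat_i, quat_j, (1/2) *\<^sub>R (mat 1 + eta *\<^sub>R quat_i + (1 + eta + eta\<^sup>2) *\<^sub>R quat_j)}"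

definition Delta237 :: "mat2 set" where
  "Delta237 = {M \<in> mat_units order_O. det M = 1}"


section \<open>Geodesics of the upper half plane\<close>

datatype rp1 = PReal real | PInf

fun rp1_act :: "mat2 \<Rightarrow> rp1 \<Rightarrow> rp1" where
  "rp1_act M (PReal x) =
     (if M$2$1 * x + M$2$2 = 0 then PInf
      else PReal ((M$1$1 * x + M$1$2) / (M$2$1 * x + M$2$2)))"
| "rp1_act M PInf = (if M$2$1 = 0 then PInf else PReal (M$1$1 / M$2$1))"

definition moebius :: "mat2 \<Rightarrow> complex \<Rightarrow> complex" where
  "moebius M \<tau> = (of_real (M$1$1) * \<tau> + of_real (M$1$2)) / (of_real (M$2$1) * \<tau> + of_real (M$2$2))"

text \<open>The oriented geodesic from \<open>\<beta>\<close> to \<open>\<alpha>\<close> is represented by the pair \<open>(\<beta>, \<alpha>)\<close>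
  of distinct endpoints, in this order.\<close>
type_synonym geodesic = "rp1 \<times> rp1"

definition geo_act :: "mat2 \<Rightarrow> geodesic \<Rightarrow> geodesic" where
  "geo_act M \<omega> = (rp1_act M (fst \<omega>), rp1_act M (snd \<omega>))"

text \<open>A parametrization, compatible with the orientation, of the points of a geodesic in the
  upper half plane by \<open>0 < t\<close>: the first endpoint is the limit for \<open>t \<rightarrow> 0\<close>, the second one the
  limit for \<open>t \<rightarrow> \<infinity>\<close>. With real endpoints this runs through the half circle with centre
  \<open>(b + a) / 2\<close> and radius \<open>\<bar>a - b\<bar> / 2\<close>. The last clause is a dummy value.\<close>
fun geo_point :: "geodesic \<Rightarrow> real \<Rightarrow> complex" where
  "geo_point (PReal b, PReal a) t = Complex ((b + a * t\<^sup>2) / (1 + t\<^sup>2)) (\<bar>a - b\<bar> * t / (1 + t\<^sup>2))"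
| "geo_point (PReal b, PInf) t = Complex b t"
| "geo_point (PInf, PReal a) t = Complex a (1 / t)"
| "geo_point (PInf, PInf) t = \<i>"

definition geo_segment :: "complex \<Rightarrow> complex \<Rightarrow> complex set" where
  "geo_segment P Q = {X. \<exists>\<beta> \<alpha> s t u. \<beta> \<noteq> \<alpha> \<and> 0 < s \<and> s \<le> t \<and> t \<le> u \<and>
     P = geo_point (\<beta>, \<alpha>) s \<and> X = geo_point (\<beta>, \<alpha>) t \<and> Q = geo_point (\<beta>, \<alpha>) u}"

definition geo_convex :: "complex set \<Rightarrow> bool" where
  "geo_convex S \<longleftrightarrow> (\<forall>P\<in>S. \<forall>Q\<in>S. geo_segment P Q \<subseteq> S)"

definition geo_triangle :: "complex \<Rightarrow> complex \<Rightarrow> complex \<Rightarrow> complex set" where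
  "geo_triangle P Q R = geo_convex hull {P, Q, R}"


section \<open>The fundamental heptagon\<close>

definition g2 :: mat2 where
  "g2 = mat22 0 (- sqrt eta) (1 / sqrt eta) 0"

definition g3 :: mat2 where
  "g3 = (1/2) *\<^sub>R mat22
     (1 + (eta\<^sup>2 - 2) * sqrt eta)  (- (eta\<^sup>2 + eta - 1) * sqrt eta)
     ((3 - eta\<^sup>2) * sqrt eta)       (1 - (eta\<^sup>2 - 2) * sqrt eta)"

definition g7 :: mat2 where
  "g7 = (1/2) *\<^sub>R mat22
     (eta\<^sup>2 + eta - 1)                                (eta\<^sup>2 - 1 - sqrt eta)
     (2 - eta\<^sup>2 + (eta\<^sup>2 + eta - 2) * sqrt eta)  (eta\<^sup>2 + eta - 1)"

definition fixed_point :: "mat2 \<Rightarrow> complex" where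
  "fixed_point M = (THE \<tau>. 0 < Im \<tau> \<and> moebius M \<tau> = \<tau>)"

definition tau3 :: complex where "tau3 = fixed_point g3"

definition tau7 :: complex where "tau7 = fixed_point g7"

definition tau3' :: complex where "tau3' = moebius g2 tau3"

definition heptagon :: "complex set" where
  "heptagon = (\<Union>i<7. moebius (mat_pow g7 i) ` geo_triangle tau3 tau3' tau7)"

text \<open>The indices in \<open>\<int>/7\<int>\<close> are represented by \<open>0,\<dots>,6\<close>.\<close>
definition edge :: "nat \<Rightarrow> complex set" where
  "edge i = moebius (mat_pow g7 i) ` (geo_segment tau3 tau3' - {tau3'})"

definition edge' :: "nat \<Rightarrow> complex set" where
  "edge' i = moebius (mat_pow g7 i) ` (geo_segment tau3 tau3' - {tau3})"

text \<open>The geodesic meets the heptagon in the oriented segment from P to Q (possibly \<open>P = Q\<close>).\<close>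
definition meets_heptagon :: "geodesic \<Rightarrow> complex \<Rightarrow> complex \<Rightarrow> bool" where
  "meets_heptagon \<omega> P Q \<longleftrightarrow> (\<exists>s u. 0 < s \<and> s \<le> u \<and>
     {t. 0 < t \<and> geo_point \<omega> t \<in> heptagon} = {s..u} \<and> P = geo_point \<omega> s \<and> Q = geo_point \<omega> u)"

definition enters_from :: "geodesic \<Rightarrow> nat \<Rightarrow> bool" where
  "enters_from \<omega> i \<longleftrightarrow> (\<exists>P Q. meets_heptagon \<omega> P Q \<and> P \<in> edge i)"

definition leaves_from :: "geodesic \<Rightarrow> nat \<Rightarrow> bool" where
  "leaves_from \<omega> i \<longleftrightarrow> (\<exists>P Q. meets_heptagon \<omega> P Q \<and> Q \<in> edge' i)"

definition reduced :: "geodesic \<Rightarrow> bool" where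
  "reduced \<omega> \<longleftrightarrow> enters_from \<omega> 0 \<and> (\<exists>a. snd \<omega> = PReal a \<and> \<bar>a\<bar> < sqrt eta)"


section \<open>Geodesic continued fractions\<close>

text \<open>Index sequences \<open>i\<close> are used from \<open>i 1\<close> on; the value \<open>i 0\<close> is irrelevant.\<close>

definition gcf_A :: "(nat \<Rightarrow> nat) \<Rightarrow> nat \<Rightarrow> mat2" where
  "gcf_A i k = mat_pow g7 (i k) ** g2"

primrec gcf_step :: "geodesic \<Rightarrow> (nat \<Rightarrow> nat) \<Rightarrow> nat \<Rightarrow> geodesic" where
  "gcf_step \<omega> i 0 = \<omega>"
| "gcf_step \<omega> i (Suc k) = geo_act (matrix_inv (gcf_A i (Suc k))) (gcf_step \<omega> i k)"

definition is_gcf :: "geodesic \<Rightarrow> (nat \<Rightarrow> nat) \<Rightarrow> bool" where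
  "is_gcf \<omega> i \<longleftrightarrow> reduced \<omega> \<and>
     (\<forall>k. i (Suc k) \<in> {1..6} \<and> leaves_from (gcf_step \<omega> i k) (i (Suc k)))"

primrec gcf_B :: "mat2 \<Rightarrow> (nat \<Rightarrow> nat) \<Rightarrow> nat \<Rightarrow> mat2" where
  "gcf_B B0 i 0 = B0"
| "gcf_B B0 i (Suc k) = gcf_B B0 i k ** gcf_A i (Suc k)"

definition gcf_geodesic :: "mat2 \<Rightarrow> (nat \<Rightarrow> nat) \<Rightarrow> geodesic \<Rightarrow> nat \<Rightarrow> geodesic" where
  "gcf_geodesic B0 i \<omega> k = geo_act (matrix_inv (gcf_B B0 i k)) \<omega>"


section \<open>Quadratic subfields and their unit groups\<close>

definition discr :: "real \<Rightarrow> real \<Rightarrow> real" where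
  "discr z w = (z - conjL z)\<^sup>2 + 4 * eta * w * conjL w"

definition quadratic_ends :: "real \<Rightarrow> real \<Rightarrow> rp1 \<Rightarrow> rp1 \<Rightarrow> bool" where
  "quadratic_ends z w \<alpha> \<beta> \<longleftrightarrow> z \<in> L_field \<and> w \<in> L_field \<and> discr z w > 0 \<and>
     (if w = 0 then (\<alpha> = PReal 0 \<and> \<beta> = PInf) \<or> (\<alpha> = PInf \<and> \<beta> = PReal 0)
      else \<exists>\<sigma>\<in>{1, -1}.
        \<alpha> = PReal ((z - conjL z + \<sigma> * sqrt (discr z w)) / (2 * w)) \<and>
        \<beta> = PReal ((z - conjL z - \<sigma> * sqrt (discr z w)) / (2 * w)))"

definition theta :: "real \<Rightarrow> real \<Rightarrow> mat2" where
  "theta z w = mat22 z (eta * conjL w) w (conjL z)"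

definition K_field :: "real \<Rightarrow> real \<Rightarrow> mat2 set" where
  "K_field z w = mat_adjoin F_field {theta z w}"

definition K_order :: "real \<Rightarrow> real \<Rightarrow> mat2 set" where
  "K_order z w = K_field z w \<inter> order_O"

definition K_order1 :: "real \<Rightarrow> real \<Rightarrow> mat2 set" where
  "K_order1 z w = mat_units (K_order z w) \<inter> Delta237"

text \<open>For a matrix M fixing \<open>\<alpha>\<close>, this is the eigenvalue of M on the line \<open>\<alpha>\<close>: for
  real \<open>\<alpha>\<close> it is the factor \<open>s * \<alpha> + t\<close> with \<open>(s, t)\<close> the second row of M, and for \<open>\<alpha> = \<infinity>\<close>
  it is the upper left entry q. If M also fixes \<open>\<beta>\<close>, then \<open>s * \<alpha> + t = q - s * \<beta>\<close>, which gives
  the meaning of the left-hand side at \<open>\<alpha> = \<infinity>\<close>, where \<open>s = 0\<close>.\<close>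
fun rho :: "rp1 \<Rightarrow> mat2 \<Rightarrow> real" where
  "rho (PReal a) M = M$2$1 * a + M$2$2"
| "rho PInf M = M$1$1"

definition U_group :: "rp1 \<Rightarrow> real \<Rightarrow> real \<Rightarrow> real set" where
  "U_group \<alpha> z w = rho \<alpha> ` K_order1 z w"

definition stabilizer :: "geodesic \<Rightarrow> mat2 set" where
  "stabilizer \<omega> = {M \<in> Delta237. rp1_act M (fst \<omega>) = fst \<omega> \<and> rp1_act M (snd \<omega>) = snd \<omega>}"

definition mat_fundamental_unit :: "mat2 \<Rightarrow> mat2 set \<Rightarrow> bool" where
  "mat_fundamental_unit \<epsilon> G \<longleftrightarrow>
     \<epsilon> \<in> G \<and> G = {M. \<exists>k::int. M = mat_powi \<epsilon> k \<or> M = - mat_powi \<epsilon> k}"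

definition real_fundamental_unit :: "real \<Rightarrow> real set \<Rightarrow> bool" where
  "real_fundamental_unit \<epsilon> G \<longleftrightarrow>
     \<epsilon> \<in> G \<and> G = {x. \<exists>k::int. x = \<epsilon> powi k \<or> x = - (\<epsilon> powi k)}"

end

theory Submission
  imports Defs
begin

text \<open>
  Let \<open>M\<close> be a matrix that moves a geodesic to the upward imaginary axis. The heptagon is the cell
  around \<open>tau7\<close> of the orbit of \<open>tau7\<close>: an element of \<open>Delta237\<close> has a trace in \<open>\<int>[eta]\<close> whose two other
  conjugates lie in \<open>[-2, 2]\<close>, because the quaternion algebra is definite at the other two places, and
  since a nonzero element has norm at least 1 in absolute value, traces stay away from 0 and from -1
  unless they are equal to them. So no tile centre is closer to a vertex of the heptagon than \<open>tau7\<close>.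
  Along the imaginary axis, \<open>2 y\<close> times the hyperbolic cosine of the distance to a point is an affine
  function of \<open>y\<^sup>2\<close>, and the tile centres met by the geodesic are those that lie on the lower envelope
  of these functions. Hence the imaginary parts of the moved centres increase along the
  continued fraction, and every tile at which a reduced translate of the geodesic starts occurs in it.

  A matrix stabilizing the geodesic multiplies these heights by a constant. By a power of the period
  matrix one gets into the first period, where only the trivial element is left; this gives the
  fundamental unit. Conversely, if the geodesic is fixed by the traceless part of \<open>theta z w\<close>, a multiple
  of it lies in the order, its conjugates along the continued fraction stay bounded at the real place
  (a reduced geodesic meets a compact segment) and at the definite places, so they are finitely many
  and some geodesic repeats. As each step can also be reversed, the expansion is purely periodic.
\<close>

section \<open>Conjugates and norms of cyclotomic integers\<close>

text \<open>Nowhere is it shown that the translates of the heptagon tile the half plane. Two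
  consequences of the trace gaps replace this: the lower bound for the distance between any centre
  and any vertex, and the fact that the stabilizer of \<open>tau7\<close> consists of the powers of
  \<open>g7\<close> up to sign. The obstacle is the boundary: edges are half open, and a geodesic
  may pass through vertices or run along an edge. Hence entering and leaving are translated once and
  for all into the sign conditions \<open>red\<close> and \<open>leav\<close>, where one weak and
  one strict inequality reproduce the half-open edges. Where the envelope argument needs strict
  signs, a small translation in the frame, invisible to \<open>EE\<close>, provides them. The only
  configuration in which the signs do not at once decide the exit edge is entry at
  \<open>tau3\<close> with apparent exit through the last edge; there alone points of the hull that
  defines the heptagon must be exhibited.\<close>

definition is_root :: "real \<Rightarrow> bool" where
  "is_root x \<longleftrightarrow> x^3 + x\<^sup>2 - 2 * x - 1 = 0"

text \<open>The roots of the cubic are \<open>2 * cos (2 * pi * k / 7)\<close> for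
  \<open>k = 1, 2, 3\<close>; \<open>eta2\<close> belongs to \<open>k = 2\<close> by angle doubling,
  and \<open>eta3\<close> completes the sum of the roots to -1.\<close>

definition eta2 :: real where "eta2 = eta\<^sup>2 - 2"
definition eta3 :: real where "eta3 = 1 - eta - eta\<^sup>2"

text \<open>For x = 2 pi / 7 the angles 4 x and 3 x add up to 2 pi, so their cosines agree; as
  polynomials in cos x their difference has the factor cos x - 1 beside the cubic.\<close>

lemma root_eta: "is_root eta"
proof -
  define c where "c = cos (2 * pi / 7)"
  have c1: "c < 1"
    unfolding c_def using cos_monotone_0_pi[of 0 "2*pi/7"] by simp
  have 4: "cos (4 * (2 * pi / 7)) = 2 * (2 * c\<^sup>2 - 1)\<^sup>2 - 1"
    using cos_double_cos[of "2 * (2 * pi / 7)"] cos_double_cos[of "2 * pi / 7"] by (simp add: c_def)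
  have 3: "cos (3 * (2 * pi / 7)) = 4 * c^3 - 3 * c"
    using cos_treble_cos[of "2 * pi / 7"] by (simp add: c_def)
  have "cos (4 * (2 * pi / 7)) = cos (2 * pi - 3 * (2 * pi / 7))"
    by (rule arg_cong[where f=cos]) simp
  also have "\<dots> = cos (3 * (2 * pi / 7))" by (simp only: cos_diff) simp
  finally have "2 * (2 * c\<^sup>2 - 1)\<^sup>2 - 1 = 4 * c^3 - 3 * c" using 3 4 by simp
  then have "(c - 1) * (8 * c^3 + 4 * c\<^sup>2 - 4 * c - 1) = 0" by algebra
  then have "8 * c^3 + 4 * c\<^sup>2 - 4 * c - 1 = 0" using c1 by simp
  then show ?thesis
    unfolding is_root_def eta_def c_def[symmetric] by (simp add: power_mult_distrib)
qed

lemma eta_cube: "eta^3 = 1 + 2 * eta - eta\<^sup>2"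
  using root_eta unfolding is_root_def by simp

text \<open>The cubic can be written \<open>eta * (eta^2 + eta - 2) = 1\<close>, whose left side
  increases for arguments at least 1; evaluation at the two decimals decides.\<close>

lemma eta_bounds: "eta > 1.2469" "eta < 1.2470"
proof -
  have "cos (2 * pi / 7) > cos (pi / 3)"
    by (rule cos_monotone_0_pi) auto
  then have e1: "eta > 1" unfolding eta_def by (simp add: cos_60)
  have r: "eta * (eta\<^sup>2 + eta - 2) = 1" using root_eta unfolding is_root_def by algebra
  show "eta > 1.2469"
  proof (rule ccontr)
    assume "\<not> ?thesis"
    then have le: "eta \<le> 1.2469" by simp
    have "eta\<^sup>2 \<le> 1.2469\<^sup>2" using le e1 by (intro power_mono) auto
    moreover have "1 \<le> eta\<^sup>2" using e1 by (simp add: one_le_power)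
    ultimately have "eta\<^sup>2 + eta - 2 \<le> 1.2469\<^sup>2 + 1.2469 - 2" "0 \<le> eta\<^sup>2 + eta - 2"
      using le e1 by linarith+
    then have "eta * (eta\<^sup>2 + eta - 2) \<le> 1.2469 * (1.2469\<^sup>2 + 1.2469 - 2)"
      using le e1 by (intro mult_mono) auto
    then show False using r by (simp add: power2_eq_square)
  qed
  show "eta < 1.2470"
  proof (rule ccontr)
    assume "\<not> ?thesis"
    then have le: "eta \<ge> 1.2470" by simp
    have "1.2470\<^sup>2 \<le> eta\<^sup>2" using le by (intro power_mono) auto
    then have "1.2470 * (1.2470\<^sup>2 + 1.2470 - 2) \<le> eta * (eta\<^sup>2 + eta - 2)"
      using le e1 by (intro mult_mono) (auto simp: power2_eq_square)
    then show False using r by (simp add: power2_eq_square)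
  qed
qed

lemma eta_pos [simp]: "eta > 0" "eta \<noteq> 0" "eta \<ge> 0"
  using eta_bounds by auto

lemma eta_sq_bounds: "eta\<^sup>2 > 1.5547" "eta\<^sup>2 < 1.5551"
proof -
  have "1.2469\<^sup>2 < eta\<^sup>2" by (intro power_strict_mono) (use eta_bounds in auto)
  then show "eta\<^sup>2 > 1.5547" by (simp add: power2_eq_square)
  have "eta\<^sup>2 < 1.2470\<^sup>2" by (intro power_strict_mono) (use eta_bounds in auto)
  then show "eta\<^sup>2 < 1.5551" by (simp add: power2_eq_square)
qed

lemma sym_eta:
  "eta + eta2 + eta3 = -1" "eta * eta2 + eta2 * eta3 + eta3 * eta = -2" "eta * eta2 * eta3 = 1"
proof -
  have r: "eta^3 + eta\<^sup>2 - 2 * eta - 1 = 0" using root_eta by (simp add: is_root_def)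
  show "eta + eta2 + eta3 = -1" unfolding eta2_def eta3_def by simp
  show "eta * eta2 + eta2 * eta3 + eta3 * eta = -2"
    using r unfolding eta2_def eta3_def by algebra
  show "eta * eta2 * eta3 = 1" using r unfolding eta2_def eta3_def by algebra
qed

lemma root_eta23: "is_root eta2" "is_root eta3"
  using root_eta unfolding is_root_def eta2_def eta3_def by algebra+

lemma eta23_neg: "eta2 < 0" "eta3 < 0"
  unfolding eta2_def eta3_def using eta_sq_bounds eta_bounds by auto

text \<open>Elements of \<open>\<int>[eta]\<close> are handled as functions on the three roots of the cubic: the value at \<open>eta\<close>
  is the element, the values at \<open>eta2\<close> and \<open>eta3\<close> are its conjugates.\<close>
definition ip :: "(real \<Rightarrow> real) \<Rightarrow> bool" where
  "ip f \<longleftrightarrow> (\<exists>a b c::int. \<forall>x. is_root x \<longrightarrow> f x = of_int a + of_int b * x + of_int c * x\<^sup>2)"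

lemma ip_const [intro, simp]: "ip (\<lambda>x. of_int n)"
  unfolding ip_def by (rule exI[of _ n], rule exI[of _ 0], rule exI[of _ 0]) simp

lemma ip_0 [intro, simp]: "ip (\<lambda>x. 0)" using ip_const[of 0] by simp
lemma ip_1 [intro, simp]: "ip (\<lambda>x. 1)" using ip_const[of 1] by simp
lemma ip_numeral [intro, simp]: "ip (\<lambda>x. numeral n)" using ip_const[of "numeral n"] by simp

lemma ip_id [intro, simp]: "ip (\<lambda>x. x)"
  unfolding ip_def by (rule exI[of _ 0], rule exI[of _ 1], rule exI[of _ 0]) simp

lemma ip_add [intro]: assumes "ip f" "ip g" shows "ip (\<lambda>x. f x + g x)"
proof -
  from assms(1) obtain a b c :: int where f: "\<And>x. is_root x \<Longrightarrow> f x = of_int a + of_int b * x + of_int c * x\<^sup>2"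
    unfolding ip_def by blast
  from assms(2) obtain a' b' c' :: int where g: "\<And>x. is_root x \<Longrightarrow> g x = of_int a' + of_int b' * x + of_int c' * x\<^sup>2"
    unfolding ip_def by blast
  show ?thesis unfolding ip_def
    by (rule exI[of _ "a + a'"], rule exI[of _ "b + b'"], rule exI[of _ "c + c'"])
       (simp add: f g algebra_simps)
qed

lemma ip_mult [intro]: assumes "ip f" "ip g" shows "ip (\<lambda>x. f x * g x)"
proof -
  from assms(1) obtain a b c :: int where f: "\<And>x. is_root x \<Longrightarrow> f x = of_int a + of_int b * x + of_int c * x\<^sup>2"
    unfolding ip_def by blast
  from assms(2) obtain a' b' c' :: int where g: "\<And>x. is_root x \<Longrightarrow> g x = of_int a' + of_int b' * x + of_int c' * x\<^sup>2"
    unfolding ip_def by blast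
  \<comment> \<open>Reduction by \<open>x^3 = 1 + 2 * x - x^2\<close> and
    \<open>x^4 = -1 - x + 3 * x^2\<close>.\<close>
  have *: "(a + b * x + c * x\<^sup>2) * (a' + b' * x + c' * x\<^sup>2)
     = (a * a' + (b * c' + c * b') - c * c')
       + (a * b' + b * a' + 2 * (b * c' + c * b') - c * c') * x
       + (a * c' + b * b' + c * a' - (b * c' + c * b') + 3 * (c * c')) * x\<^sup>2"
    if "is_root x" for x a b c a' b' c' :: real
    using that unfolding is_root_def by algebra
  show ?thesis unfolding ip_def
    by (rule exI[of _ "a * a' + (b * c' + c * b') - c * c'"],
        rule exI[of _ "a * b' + b * a' + 2 * (b * c' + c * b') - c * c'"],
        rule exI[of _ "a * c' + b * b' + c * a' - (b * c' + c * b') + 3 * (c * c')"])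
       (simp add: f g *)
qed

lemma ip_minus [intro]: "ip f \<Longrightarrow> ip (\<lambda>x. - f x)"
  using ip_mult[OF ip_const[of "-1"]] by simp

lemma ip_diff [intro]: "ip f \<Longrightarrow> ip g \<Longrightarrow> ip (\<lambda>x. f x - g x)"
  using ip_add[OF _ ip_minus] by simp

lemma ip_power [intro]: "ip f \<Longrightarrow> ip (\<lambda>x. f x ^ n)"
  by (induction n) auto

text \<open>The norm of \<open>a + b * eta + c * eta^2\<close> down to the rationals, multiplied
  out; \<open>norm3_prod\<close> relates it to the conjugates.\<close>

definition norm3 :: "int \<Rightarrow> int \<Rightarrow> int \<Rightarrow> int" where
  "norm3 a b c = a^3 - a\<^sup>2 * b + 5 * a\<^sup>2 * c - 2 * a * b\<^sup>2 + 6 * a * c\<^sup>2 - a * b * c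
     + b^3 + c^3 - b\<^sup>2 * c - 2 * b * c\<^sup>2"

text \<open>The cubic is irreducible modulo 2, so a zero of the norm form can be halved indefinitely.\<close>
lemma norm3_zero: "norm3 a b c = 0 \<Longrightarrow> a = 0 \<and> b = 0 \<and> c = 0"
proof (induction "nat (\<bar>a\<bar> + \<bar>b\<bar> + \<bar>c\<bar>)" arbitrary: a b c rule: less_induct)
  case less
  have "even (norm3 a b c)" using less.prems by simp
  then have ev: "even a" "even b" "even c"
    unfolding norm3_def by (cases "even a"; cases "even b"; cases "even c"; simp)+
  then obtain a' b' c' where abc: "a = 2 * a'" "b = 2 * b'" "c = 2 * c'" by (auto elim!: evenE)
  have "norm3 a b c = 8 * norm3 a' b' c'"
    unfolding norm3_def abc by (simp add: power_mult_distrib algebra_simps)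
  then have n0: "norm3 a' b' c' = 0" using less.prems by simp
  show ?case
  proof (cases "a = 0 \<and> b = 0 \<and> c = 0")
    case False
    then have "nat (\<bar>a'\<bar> + \<bar>b'\<bar> + \<bar>c'\<bar>) < nat (\<bar>a\<bar> + \<bar>b\<bar> + \<bar>c\<bar>)" using abc by auto
    from less.hyps[OF this n0] show ?thesis using abc by simp
  qed simp
qed

lemma norm3_prod:
  fixes a b c x y z :: real
  assumes "x + y + z = -1" "x * y + y * z + z * x = -2" "x * y * z = 1"
  shows "(a + b * x + c * x\<^sup>2) * (a + b * y + c * y\<^sup>2) * (a + b * z + c * z\<^sup>2)
    = a^3 - a\<^sup>2 * b + 5 * a\<^sup>2 * c - 2 * a * b\<^sup>2 + 6 * a * c\<^sup>2 - a * b * c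
     + b^3 + c^3 - b\<^sup>2 * c - 2 * b * c\<^sup>2"
  using assms by algebra

lemma ip_norm:
  assumes "ip f"
  obtains a b c where "\<And>x. is_root x \<Longrightarrow> f x = of_int a + of_int b * x + of_int c * x\<^sup>2"
    "f eta * f eta2 * f eta3 = of_int (norm3 a b c)"
proof -
  from assms obtain a b c :: int where f: "\<And>x. is_root x \<Longrightarrow> f x = of_int a + of_int b * x + of_int c * x\<^sup>2"
    unfolding ip_def by blast
  have "f eta * f eta2 * f eta3 = of_int (norm3 a b c)"
    unfolding f[OF root_eta] f[OF root_eta23(1)] f[OF root_eta23(2)] norm3_prod[OF sym_eta]
    by (simp add: norm3_def)
  with f show ?thesis using that by blast
qed

text \<open>A vanishing product of conjugates is a vanishing norm, which kills all three
  coefficients; so one zero among the roots forces zeros at all of them.\<close>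

lemma ip_zero_all:
  assumes "ip f" "f eta * f eta2 * f eta3 = 0" "is_root x"
  shows "f x = 0"
proof -
  obtain a b c where f: "\<And>x. is_root x \<Longrightarrow> f x = of_int a + of_int b * x + of_int c * x\<^sup>2"
    and n: "f eta * f eta2 * f eta3 = of_int (norm3 a b c)" using ip_norm[OF assms(1)] by blast
  from n assms(2) have "norm3 a b c = 0" by simp
  from norm3_zero[OF this] f[OF assms(3)] show ?thesis by simp
qed

lemma ip_zero: "ip f \<Longrightarrow> f eta = 0 \<Longrightarrow> is_root x \<Longrightarrow> f x = 0"
  by (rule ip_zero_all) auto

lemma ip_small:
  assumes "ip f" "\<bar>f eta * f eta2 * f eta3\<bar> < 1"
  shows "f eta = 0"
proof -
  obtain a b c where n: "f eta * f eta2 * f eta3 = of_int (norm3 a b c)"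
    using ip_norm[OF assms(1)] by blast
  then have "norm3 a b c = 0" using assms(2) by auto
  then show ?thesis using ip_zero_all[OF assms(1) _ root_eta] n by simp
qed

text \<open>The triple of conjugates determines the integer coefficients by an invertible linear
  system, so bounded conjugates leave finitely many coefficients.\<close>

lemma finite_ip_bounded:
  "finite {v. \<exists>f. ip f \<and> v = f eta \<and> \<bar>f eta\<bar> \<le> B \<and> \<bar>f eta2\<bar> \<le> B \<and> \<bar>f eta3\<bar> \<le> B}"
proof -
  define N :: int where "N = \<lceil>100 * B\<rceil> + 1"
  have sub: "{v. \<exists>f. ip f \<and> v = f eta \<and> \<bar>f eta\<bar> \<le> B \<and> \<bar>f eta2\<bar> \<le> B \<and> \<bar>f eta3\<bar> \<le> B}
    \<subseteq> (\<lambda>(a, b, c). of_int a + of_int b * eta + of_int c * eta\<^sup>2) ` ({-N..N} \<times> {-N..N} \<times> {-N..N})"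
  proof
    fix v assume "v \<in> {v. \<exists>f. ip f \<and> v = f eta \<and> \<bar>f eta\<bar> \<le> B \<and> \<bar>f eta2\<bar> \<le> B \<and> \<bar>f eta3\<bar> \<le> B}"
    then obtain f where f: "ip f" "v = f eta" "\<bar>f eta\<bar> \<le> B" "\<bar>f eta2\<bar> \<le> B" "\<bar>f eta3\<bar> \<le> B" by blast
    from f(1) obtain a b c :: int where e: "\<And>x. is_root x \<Longrightarrow> f x = of_int a + of_int b * x + of_int c * x\<^sup>2"
      unfolding ip_def by blast
    note e1 = e[OF root_eta] and e2 = e[OF root_eta23(1)] and e3 = e[OF root_eta23(2)]
    have B0: "B \<ge> 0" using f(3) by linarith
    \<comment> \<open>30 exceeds every cofactor used below: the conjugates have size at most 2, so
      differences of products of up to three of them have size at most 16.\<close>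
    have B1: "\<bar>u1 * f eta + u2 * f eta2 + u3 * f eta3\<bar> \<le> 100 * B"
      if "\<bar>u1\<bar> \<le> 30" "\<bar>u2\<bar> \<le> 30" "\<bar>u3\<bar> \<le> 30" for u1 u2 u3 :: real
    proof -
      have "\<bar>u1 * f eta\<bar> \<le> 30 * B" "\<bar>u2 * f eta2\<bar> \<le> 30 * B" "\<bar>u3 * f eta3\<bar> \<le> 30 * B"
        unfolding abs_mult using that f by (auto intro!: mult_mono)
      then show ?thesis using B0 by linarith
    qed
    define x y z where xyz: "x = eta" "y = eta2" "z = eta3"
    have b: "\<bar>x\<bar> \<le> 2" "\<bar>y\<bar> \<le> 2" "\<bar>z\<bar> \<le> 2"
      unfolding xyz eta2_def eta3_def using eta_bounds eta_sq_bounds by auto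
    have bb: "\<bar>p * q\<bar> \<le> 4" if "\<bar>p\<bar> \<le> 2" "\<bar>q\<bar> \<le> 2" for p q :: real
      unfolding abs_mult using that mult_mono[of "\<bar>p\<bar>" 2 "\<bar>q\<bar>" 2] by simp
    have bbb: "\<bar>p * q * r\<bar> \<le> 8" if "\<bar>p\<bar> \<le> 2" "\<bar>q\<bar> \<le> 2" "\<bar>r\<bar> \<le> 2" for p q r :: real
      using mult_mono[of "\<bar>p * q\<bar>" 4 "\<bar>r\<bar>" 2] that bb[of p q] by (simp add: abs_mult)
    text \<open>Cramer's rule; the squared Vandermonde determinant is the discriminant 49.\<close>
    define V where "V = (x - y) * (y - z) * (z - x)"
    have vdm: "V = 7 \<or> V = -7"
    proof -
      have "V\<^sup>2 = 49"
        using sym_eta unfolding xyz V_def by algebra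
      then have "V\<^sup>2 = 7\<^sup>2" by simp
      then show ?thesis unfolding power2_eq_iff .
    qed
    have c: "c * V = - ((y - z) * f eta + (z - x) * f eta2 + (x - y) * f eta3)"
      unfolding e1 e2 e3 xyz V_def by algebra
    have bq: "b * V = (y*y - z*z) * f eta + (z*z - x*x) * f eta2 + (x*x - y*y) * f eta3"
      unfolding e1 e2 e3 xyz V_def by algebra
    have aq: "a * V = - ((y * y * z - y * z * z) * f eta + (z * z * x - z * x * x) * f eta2 + (x * x * y - x * y * y) * f eta3)"
      unfolding e1 e2 e3 xyz V_def by algebra
    have "\<bar>c * V\<bar> \<le> 100 * B"
      unfolding c abs_minus_cancel by (rule B1) (use b in linarith)+
    then have c1: "\<bar>c\<bar> * 7 \<le> 100 * B" using vdm by (auto simp: abs_mult)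
    have "\<bar>b * V\<bar> \<le> 100 * B"
      unfolding bq by (rule B1) (use bb[OF b(1) b(1)] bb[OF b(2) b(2)] bb[OF b(3) b(3)] in linarith)+
    then have b1: "\<bar>b\<bar> * 7 \<le> 100 * B" using vdm by (auto simp: abs_mult)
    have "\<bar>a * V\<bar> \<le> 100 * B"
      unfolding aq abs_minus_cancel
      by (rule B1)
         (use bbb[OF b(2) b(2) b(3)] bbb[OF b(2) b(3) b(3)] bbb[OF b(3) b(3) b(1)]
            bbb[OF b(3) b(1) b(1)] bbb[OF b(1) b(1) b(2)] bbb[OF b(1) b(2) b(2)] in linarith)+
    then have a1: "\<bar>a\<bar> * 7 \<le> 100 * B" using vdm by (auto simp: abs_mult)
    have "\<bar>real_of_int k\<bar> * 7 \<le> 100 * B \<Longrightarrow> k \<in> {-N..N}" for k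
    proof -
      assume k: "\<bar>real_of_int k\<bar> * 7 \<le> 100 * B"
      have N: "100 * B \<le> real_of_int N" unfolding N_def by linarith
      have "real_of_int k \<le> N" "- real_of_int k \<le> N" using k N by linarith+
      then show ?thesis by (simp add: of_int_le_iff[symmetric] del: of_int_le_iff)
    qed
    with a1 b1 c1 have "(a, b, c) \<in> {-N..N} \<times> {-N..N} \<times> {-N..N}" by simp
    then show "v \<in> (\<lambda>(a, b, c). of_int a + of_int b * eta + of_int c * eta\<^sup>2) ` ({-N..N} \<times> {-N..N} \<times> {-N..N})"
      by (rule image_eqI[rotated]) (simp add: f(2) e1)
  qed
  show ?thesis by (rule finite_subset[OF sub]) simp
qed

section \<open>The order and the traces of its units of norm one\<close>

lemma mat2_eq_iff: "(A::mat2) = B \<longleftrightarrow> A$1$1 = B$1$1 \<and> A$1$2 = B$1$2 \<and> A$2$1 = B$2$1 \<and> A$2$2 = B$2$2"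
  by (auto simp: vec_eq_iff forall_2)

lemma matrix_mult_nth2 [simp]: "((A::mat2) ** B)$i$j = A$i$1 * B$1$j + A$i$2 * B$2$j"
  by (simp add: matrix_matrix_mult_def sum_2)

lemma mat22_nth [simp]:
  "mat22 a b c d $1$1 = a" "mat22 a b c d $1$2 = b" "mat22 a b c d $2$1 = c" "mat22 a b c d $2$2 = d"
  by (simp_all add: mat22_def)

lemma mat_nth2 [simp]:
  "(mat k :: mat2)$1$1 = k" "(mat k :: mat2)$1$2 = 0" "(mat k :: mat2)$2$1 = 0" "(mat k :: mat2)$2$2 = k"
  by (simp_all add: mat_def)

lemma det_mat22 [simp]: "det (mat22 a b c d) = a * d - b * c"
  by (simp add: det_2)

definition adj2 :: "mat2 \<Rightarrow> mat2" where
  "adj2 M = mat22 (M$2$2) (- M$1$2) (- M$2$1) (M$1$1)"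

lemma adj2_nth [simp]:
  "adj2 M $1$1 = M$2$2" "adj2 M $1$2 = - M$1$2" "adj2 M $2$1 = - M$2$1" "adj2 M $2$2 = M$1$1"
  by (simp_all add: adj2_def)

lemma det_adj2 [simp]: "det (adj2 M) = det M"
  by (simp add: det_2)

lemma adj2_mult: "det M = 1 \<Longrightarrow> M ** adj2 M = mat 1" "det M = 1 \<Longrightarrow> adj2 M ** M = mat 1"
  by (simp_all add: mat2_eq_iff det_2 algebra_simps)

lemma matrix_inv_unique2:
  assumes "(M::mat2) ** N = mat 1" "N ** M = mat 1"
  shows "matrix_inv M = N"
proof -
  have "M ** matrix_inv M = mat 1 \<and> matrix_inv M ** M = mat 1"
    unfolding matrix_inv_def by (rule someI[of _ N]) (use assms in auto)
  then have "matrix_inv M = (matrix_inv M ** M) ** N"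
    using assms by (metis matrix_mul_assoc matrix_mul_rid)
  then show ?thesis
    using \<open>M ** matrix_inv M = mat 1 \<and> matrix_inv M ** M = mat 1\<close> by simp
qed

lemma matrix_inv_adj2: "det M = 1 \<Longrightarrow> matrix_inv M = adj2 M"
  by (rule matrix_inv_unique2) (auto simp: adj2_mult)

text \<open>The quaternion \<open>a + b i + c j + d k\<close> in the matrix model.\<close>

definition qmat :: "real \<Rightarrow> real \<Rightarrow> real \<Rightarrow> real \<Rightarrow> mat2" where
  "qmat a b c d = mat22 (a + c * sqrt eta) (eta * (b - d * sqrt eta)) (b + d * sqrt eta) (a - c * sqrt eta)"

lemma qmat_nth [simp]:
  "qmat a b c d $1$1 = a + c * sqrt eta" "qmat a b c d $1$2 = eta * (b - d * sqrt eta)"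
  "qmat a b c d $2$1 = b + d * sqrt eta" "qmat a b c d $2$2 = a - c * sqrt eta"
  by (simp_all add: qmat_def)

lemma sqrt_eta_sq [simp]: "sqrt eta * sqrt eta = eta" "sqrt eta * (sqrt eta * x) = eta * x"
  by (simp_all flip: mult.assoc)

lemma qmat_mult: "qmat a b c d ** qmat a' b' c' d' =
  qmat (a * a' + eta * b * b' + eta * c * c' - eta\<^sup>2 * d * d')
       (a * b' + b * a' - eta * c * d' + eta * d * c')
       (a * c' + c * a' + eta * b * d' - eta * d * b')
       (a * d' + d * a' + b * c' - c * b')"
  by (simp add: mat2_eq_iff algebra_simps power2_eq_square)

lemma det_qmat: "det (qmat a b c d) = a\<^sup>2 - eta * b\<^sup>2 - eta * c\<^sup>2 + eta\<^sup>2 * d\<^sup>2"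
  by (simp add: det_2 algebra_simps power2_eq_square)

lemma qmat_add: "qmat a b c d + qmat a' b' c' d' = qmat (a + a') (b + b') (c + c') (d + d')"
  by (simp add: mat2_eq_iff algebra_simps)

lemma qmat_diff: "qmat a b c d - qmat a' b' c' d' = qmat (a - a') (b - b') (c - c') (d - d')"
  by (simp add: mat2_eq_iff algebra_simps)

text \<open>\<open>oqA\<close>, \<open>oqB\<close> solve the congruences modulo 2 that describe, in \<open>(a + b i + c j + d k) / 2\<close>,
  the coordinates \<open>a\<close>, \<open>b\<close> of an element of the order in terms of \<open>c\<close>, \<open>d\<close>;
  the order is free over \<open>Z[eta]\<close> on \<open>1\<close>, \<open>i\<close> and the two elements with \<open>(c, d) = (1, 0), (0, 1)\<close>.\<close>
definition oqA :: "real \<Rightarrow> real \<Rightarrow> real \<Rightarrow> real \<Rightarrow> real" where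
  "oqA x a c d = (x\<^sup>2 + 1) * (c + x\<^sup>2 * d) + 2 * a"
definition oqB :: "real \<Rightarrow> real \<Rightarrow> real \<Rightarrow> real \<Rightarrow> real" where
  "oqB x b c d = (x\<^sup>2 + 1) * (x * c + d) + 2 * b"

definition oq :: "real \<Rightarrow> real \<Rightarrow> real \<Rightarrow> real \<Rightarrow> mat2" where
  "oq a b c d = qmat (oqA eta a c d / 2) (oqB eta b c d / 2) (c / 2) (d / 2)"

lemma oq_mult_coord:
  fixes x a b c d a' b' c' d' :: real
  assumes "is_root x"
  defines "A \<equiv> oqA x a c d" and "B \<equiv> oqB x b c d" and "A' \<equiv> oqA x a' c' d'" and "B' \<equiv> oqB x b' c' d'"
  defines "c'' \<equiv> (x\<^sup>2 + 1) * (c * c' + x\<^sup>2 * c * d') + a * c' + c * a' + x * (b * d' - d * b')"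
  defines "d'' \<equiv> (x\<^sup>2 + 1) * (x\<^sup>2 * d * d' + d * c') + a * d' + d * a' + b * c' - c * b'"
  defines "a'' \<equiv> a * a' + x * b * b' + x * (x\<^sup>2 + 1) * (x * c + d) * b'
     + (4 + 7 * x - 7 * x\<^sup>2) * c * c' + (7 + 10 * x - 14 * x\<^sup>2) * d * d'"
  defines "b'' \<equiv> a * b' + b * a' + (x\<^sup>2 + 1) * (c + x\<^sup>2 * d) * b'
     + (4 + 7 * x - 7 * x\<^sup>2) * (d * c' - c * d')"
  shows "A * A' + x * B * B' + x * c * c' - x\<^sup>2 * d * d' = 2 * oqA x a'' c'' d''"
    "A * B' + B * A' - x * c * d' + x * d * c' = 2 * oqB x b'' c'' d''"
    "A * c' + c * A' + x * B * d' - x * d * B' = 2 * c''"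
    "A * d' + d * A' + B * c' - c * B' = 2 * d''"
proof -
  define p where "p = x\<^sup>2 + 1"
  have r: "x^3 + x\<^sup>2 - 2 * x - 1 = 0" using assms(1) by (simp add: is_root_def)
  \<comment> \<open>The cubic enters only here. These coefficients of the product must be divisible
    by 4 for the order to be closed under multiplication; the quotients are the constants in
    \<open>a''\<close> and \<open>b''\<close>.\<close>
  have p1: "(x^3 - 1) * p\<^sup>2 + x = 4 * (4 + 7 * x - 7 * x\<^sup>2)"
    using r unfolding p_def by algebra
  have p2: "(x - x^4) * p\<^sup>2 - x\<^sup>2 = 4 * (7 + 10 * x - 14 * x\<^sup>2)"
    using r unfolding p_def by algebra
  have "A * A' + x * B * B' + x * c * c' - x\<^sup>2 * d * d' - 2 * oqA x a'' c'' d''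
     = c * c' * ((x^3 - 1) * p\<^sup>2 + x - 4 * (4 + 7 * x - 7 * x\<^sup>2))
     + d * d' * ((x - x^4) * p\<^sup>2 - x\<^sup>2 - 4 * (7 + 10 * x - 14 * x\<^sup>2))"
    unfolding A_def B_def A'_def B'_def oqA_def oqB_def c''_def d''_def a''_def p_def by algebra
  then show "A * A' + x * B * B' + x * c * c' - x\<^sup>2 * d * d' = 2 * oqA x a'' c'' d''"
    using p1 p2 by simp
  have "A * B' + B * A' - x * c * d' + x * d * c' - 2 * oqB x b'' c'' d''
     = (d * c' - c * d') * ((x^3 - 1) * p\<^sup>2 + x - 4 * (4 + 7 * x - 7 * x\<^sup>2))"
    unfolding A_def B_def A'_def B'_def oqA_def oqB_def c''_def d''_def b''_def p_def by algebra
  then show "A * B' + B * A' - x * c * d' + x * d * c' = 2 * oqB x b'' c'' d''"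
    using p1 by simp
  show "A * c' + c * A' + x * B * d' - x * d * B' = 2 * c''"
    unfolding A_def B_def A'_def B'_def oqA_def oqB_def c''_def by algebra
  show "A * d' + d * A' + B * c' - c * B' = 2 * d''"
    unfolding A_def B_def A'_def B'_def oqA_def oqB_def d''_def by algebra
qed

lemma oq_mult: "oq a b c d ** oq a' b' c' d' =
  oq (a * a' + eta * b * b' + eta * (eta\<^sup>2 + 1) * (eta * c + d) * b'
       + (4 + 7 * eta - 7 * eta\<^sup>2) * c * c' + (7 + 10 * eta - 14 * eta\<^sup>2) * d * d')
     (a * b' + b * a' + (eta\<^sup>2 + 1) * (c + eta\<^sup>2 * d) * b'
       + (4 + 7 * eta - 7 * eta\<^sup>2) * (d * c' - c * d'))
     ((eta\<^sup>2 + 1) * (c * c' + eta\<^sup>2 * c * d') + a * c' + c * a' + eta * (b * d' - d * b'))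
     ((eta\<^sup>2 + 1) * (eta\<^sup>2 * d * d' + d * c') + a * d' + d * a' + b * c' - c * b')"
proof -
  note * = oq_mult_coord[OF root_eta, where a=a and b=b and c=c and d=d and a'=a' and b'=b' and c'=c' and d'=d']
  have cong: "qmat (A/2 * (A'/2) + eta * (B/2) * (B'/2) + eta * (C/2) * (C'/2) - eta\<^sup>2 * (D/2) * (D'/2))
       (A/2 * (B'/2) + B/2 * (A'/2) - eta * (C/2) * (D'/2) + eta * (D/2) * (C'/2))
       (A/2 * (C'/2) + C/2 * (A'/2) + eta * (B/2) * (D'/2) - eta * (D/2) * (B'/2))
       (A/2 * (D'/2) + D/2 * (A'/2) + B/2 * (C'/2) - C/2 * (B'/2)) = qmat (p/2) (q/2) (r/2) (t/2)"
    if "A * A' + eta * B * B' + eta * C * C' - eta\<^sup>2 * D * D' = 2 * p"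
      "A * B' + B * A' - eta * C * D' + eta * D * C' = 2 * q"
      "A * C' + C * A' + eta * B * D' - eta * D * B' = 2 * r"
      "A * D' + D * A' + B * C' - C * B' = 2 * t" for A B C D A' B' C' D' p q r t
  proof -
    have "A/2 * (A'/2) + eta * (B/2) * (B'/2) + eta * (C/2) * (C'/2) - eta\<^sup>2 * (D/2) * (D'/2) = p/2"
      "A/2 * (B'/2) + B/2 * (A'/2) - eta * (C/2) * (D'/2) + eta * (D/2) * (C'/2) = q/2"
      "A/2 * (C'/2) + C/2 * (A'/2) + eta * (B/2) * (D'/2) - eta * (D/2) * (B'/2) = r/2"
      "A/2 * (D'/2) + D/2 * (A'/2) + B/2 * (C'/2) - C/2 * (B'/2) = t/2"
      using that by (simp_all add: field_simps)
    then show ?thesis by (simp only:)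
  qed
  show ?thesis
    unfolding oq_def qmat_mult by (rule cong; rule *)
qed

lemma oq_add: "oq a b c d + oq a' b' c' d' = oq (a + a') (b + b') (c + c') (d + d')"
  unfolding oq_def qmat_add by (simp add: oqA_def oqB_def algebra_simps add_divide_distrib)

lemma oq_diff: "oq a b c d - oq a' b' c' d' = oq (a - a') (b - b') (c - c') (d - d')"
  unfolding oq_def qmat_diff by (simp add: oqA_def oqB_def algebra_simps add_divide_distrib diff_divide_distrib)

section \<open>The order as a free module over Z[eta]\<close>

definition Zr :: "real set" where "Zr = {f eta | f. ip f}"

lemma Zr_I: "ip f \<Longrightarrow> f eta \<in> Zr" by (auto simp: Zr_def)

lemma Zr_closed:
  "0 \<in> Zr" "1 \<in> Zr" "numeral n \<in> Zr" "eta \<in> Zr" "of_int k \<in> Zr"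
  "u \<in> Zr \<Longrightarrow> v \<in> Zr \<Longrightarrow> u + v \<in> Zr" "u \<in> Zr \<Longrightarrow> v \<in> Zr \<Longrightarrow> u - v \<in> Zr"
  "u \<in> Zr \<Longrightarrow> v \<in> Zr \<Longrightarrow> u * v \<in> Zr" "u \<in> Zr \<Longrightarrow> - u \<in> Zr" "u \<in> Zr \<Longrightarrow> u ^ m \<in> Zr"
proof -
  show "0 \<in> Zr" "1 \<in> Zr" "numeral n \<in> Zr" "eta \<in> Zr" "of_int k \<in> Zr"
    using Zr_I[OF ip_0] Zr_I[OF ip_1] Zr_I[OF ip_numeral] Zr_I[OF ip_id] Zr_I[OF ip_const] by auto
  show "u \<in> Zr \<Longrightarrow> v \<in> Zr \<Longrightarrow> u + v \<in> Zr" using Zr_I[OF ip_add] by (fastforce simp: Zr_def)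
  show "u \<in> Zr \<Longrightarrow> v \<in> Zr \<Longrightarrow> u - v \<in> Zr" using Zr_I[OF ip_diff] by (fastforce simp: Zr_def)
  show "u \<in> Zr \<Longrightarrow> v \<in> Zr \<Longrightarrow> u * v \<in> Zr" using Zr_I[OF ip_mult] by (fastforce simp: Zr_def)
  show "u \<in> Zr \<Longrightarrow> - u \<in> Zr" using Zr_I[OF ip_minus] by (fastforce simp: Zr_def)
  show "u \<in> Zr \<Longrightarrow> u ^ m \<in> Zr" using Zr_I[OF ip_power] by (fastforce simp: Zr_def)
qed

lemma real_subring_hull: "real_subring (real_subring hull S)"
  by (rule hull_in) (unfold real_subring_def, blast)

lemma mat_subring_hull: "mat_subring (mat_subring hull S)"
  by (rule hull_in) (unfold mat_subring_def, blast)

lemma Z_eta_eq: "Z_eta = Zr"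
proof
  have "real_subring Zr" unfolding real_subring_def by (auto intro: Zr_closed)
  then show "Z_eta \<subseteq> Zr" unfolding Z_eta_def
    by (intro hull_minimal) (auto simp: Ints_def intro: Zr_closed)
  have r: "real_subring Z_eta" unfolding Z_eta_def by (rule real_subring_hull)
  have e: "eta \<in> Z_eta" and i: "of_int k \<in> Z_eta" for k
    unfolding Z_eta_def by (rule hull_inc, simp)+
  have m: "u * v \<in> Z_eta" and a: "u + v \<in> Z_eta" if "u \<in> Z_eta" "v \<in> Z_eta" for u v
    using r that unfolding real_subring_def by blast+
  show "Zr \<subseteq> Z_eta"
  proof
    fix v assume "v \<in> Zr"
    then obtain f where "ip f" "v = f eta" unfolding Zr_def by blast
    then obtain a' b c :: int where "v = of_int a' + of_int b * eta + of_int c * eta\<^sup>2"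
      unfolding ip_def using root_eta by blast
    then show "v \<in> Z_eta" unfolding power2_eq_square by (simp add: m a e i)
  qed
qed

lemma quat_gen_half: "(1/2) *\<^sub>R (mat 1 + eta *\<^sub>R quat_i + (1 + eta + eta\<^sup>2) *\<^sub>R quat_j)
   = qmat (1/2) (eta/2) ((1 + eta + eta\<^sup>2)/2) 0"
  by (simp add: mat2_eq_iff quat_i_def quat_j_def algebra_simps)

lemma order_gens:
  "mat r = oq r 0 0 0"
  "quat_i = oq 0 1 0 0" "quat_j = oq (- (eta\<^sup>2 + 1)) (- ((eta\<^sup>2 + 1) * eta)) 2 0"
  "qmat (1/2) (eta/2) ((1 + eta + eta\<^sup>2)/2) 0 = oq (- eta - 2 * eta\<^sup>2) (- 2 - 4 * eta + eta\<^sup>2) (1 + eta + eta\<^sup>2) 0"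
proof -
  show "mat r = oq r 0 0 0" by (simp add: mat2_eq_iff oq_def oqA_def oqB_def)
  show "quat_i = oq 0 1 0 0" by (simp add: mat2_eq_iff oq_def oqA_def oqB_def quat_i_def)
  show "quat_j = oq (- (eta\<^sup>2 + 1)) (- ((eta\<^sup>2 + 1) * eta)) 2 0"
    by (simp add: mat2_eq_iff oq_def oqA_def oqB_def quat_j_def algebra_simps)
  have 1: "oqA eta (- eta - 2 * eta\<^sup>2) (1 + eta + eta\<^sup>2) 0 = 1"
    unfolding oqA_def using eta_cube by algebra
  have 2: "oqB eta (- 2 - 4 * eta + eta\<^sup>2) (1 + eta + eta\<^sup>2) 0 = eta"
    unfolding oqB_def using eta_cube by algebra
  show "qmat (1/2) (eta/2) ((1 + eta + eta\<^sup>2)/2) 0 = oq (- eta - 2 * eta\<^sup>2) (- 2 - 4 * eta + eta\<^sup>2) (1 + eta + eta\<^sup>2) 0"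
    unfolding oq_def 1 2 by simp
qed

text \<open>The coordinate set is a ring containing the generators. Conversely
  \<open>eta^2 + 1\<close> inverts \<open>1 + eta + eta^2\<close> modulo 2, so multiplying the
  half-integral generator by it and subtracting a multiple of j leaves the j-coordinate 1/2;
  multiplication by i does the same for k. This is the origin of the factor \<open>x^2 + 1\<close>
  in \<open>oqA\<close> and \<open>oqB\<close>.\<close>

lemma order_O_eq: "order_O = {oq a b c d | a b c d. a \<in> Zr \<and> b \<in> Zr \<and> c \<in> Zr \<and> d \<in> Zr}"
proof -
  define W where "W = {oq a b c d | a b c d. a \<in> Zr \<and> b \<in> Zr \<and> c \<in> Zr \<and> d \<in> Zr}"
  have WI: "oq a b c d \<in> W" if "a \<in> Zr" "b \<in> Zr" "c \<in> Zr" "d \<in> Zr" for a b c d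
    using that unfolding W_def by blast
  have WE: "\<exists>a b c d. X = oq a b c d \<and> a \<in> Zr \<and> b \<in> Zr \<and> c \<in> Zr \<and> d \<in> Zr" if "X \<in> W" for X
    using that unfolding W_def by blast
  have "mat 0 \<in> W" "mat 1 \<in> W" unfolding order_gens(1) by (intro WI Zr_closed)+
  moreover have "X + Y \<in> W \<and> X - Y \<in> W \<and> X ** Y \<in> W" if XY: "X \<in> W" "Y \<in> W" for X Y
  proof -
    from WE[OF XY(1)] WE[OF XY(2)] obtain a b c d a' b' c' d' where *: "X = oq a b c d" "Y = oq a' b' c' d'"
      "a \<in> Zr" "b \<in> Zr" "c \<in> Zr" "d \<in> Zr" "a' \<in> Zr" "b' \<in> Zr" "c' \<in> Zr" "d' \<in> Zr" by blast
    have "X + Y \<in> W" unfolding *(1,2) oq_add by (rule WI; intro Zr_closed *(3-))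
    moreover have "X - Y \<in> W" unfolding *(1,2) oq_diff by (rule WI; intro Zr_closed *(3-))
    moreover have "X ** Y \<in> W" unfolding *(1,2) oq_mult by (rule WI; intro Zr_closed *(3-))
    ultimately show ?thesis by blast
  qed
  ultimately have sr: "mat_subring W" unfolding mat_subring_def by blast
  have gens: "mat ` Z_eta \<union> {quat_i, quat_j, (1/2) *\<^sub>R (mat 1 + eta *\<^sub>R quat_i + (1 + eta + eta\<^sup>2) *\<^sub>R quat_j)} \<subseteq> W"
  proof -
    have "mat ` Z_eta \<subseteq> W" unfolding Z_eta_eq order_gens(1) by (intro image_subsetI WI Zr_closed)
    moreover have "quat_i \<in> W" unfolding order_gens(2) by (intro WI Zr_closed)
    moreover have "quat_j \<in> W" unfolding order_gens(3) by (intro WI Zr_closed)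
    moreover have "qmat (1/2) (eta/2) ((1 + eta + eta\<^sup>2)/2) 0 \<in> W"
      unfolding order_gens(4) by (intro WI Zr_closed)
    ultimately show ?thesis unfolding quat_gen_half by blast
  qed
  have sub: "order_O \<subseteq> W" unfolding order_O_def mat_adjoin_def
    by (rule hull_minimal[where S=mat_subring, OF gens sr])
  have r: "mat_subring order_O" unfolding order_O_def mat_adjoin_def by (rule mat_subring_hull)
  have g: "mat u \<in> order_O" if "u \<in> Zr" for u
    unfolding order_O_def mat_adjoin_def by (rule hull_inc) (use that in \<open>simp add: Z_eta_eq\<close>)
  have i: "quat_i \<in> order_O" "quat_j \<in> order_O" "qmat (1/2) (eta/2) ((1 + eta + eta\<^sup>2)/2) 0 \<in> order_O"
    unfolding order_O_def mat_adjoin_def quat_gen_half by (rule hull_inc, simp)+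
  have m: "u ** v \<in> order_O" and a: "u + v \<in> order_O" and d: "u - v \<in> order_O"
    if "u \<in> order_O" "v \<in> order_O" for u v
    using r that unfolding mat_subring_def by blast+
  have "W \<subseteq> order_O"
  proof
    fix X assume "X \<in> W"
    from WE[OF this] obtain a' b' c' d' where *: "X = oq a' b' c' d'" "a' \<in> Zr" "b' \<in> Zr" "c' \<in> Zr" "d' \<in> Zr" by blast
    define h where "h = qmat (1/2) (eta/2) ((1 + eta + eta\<^sup>2)/2) 0"
    define p where "p = eta\<^sup>2 + 1"
    define n where "n = eta + 2 * eta\<^sup>2"
    have pz: "p \<in> Zr" "n \<in> Zr" unfolding p_def n_def by (intro Zr_closed)+
    have pm: "p * (1 + eta + eta\<^sup>2) = 1 + 2 * n"
      unfolding p_def n_def using eta_cube by algebra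
    have pj: "mat p ** h - mat n ** quat_j = qmat (p/2) (p * eta/2) (1/2) 0"
    proof -
      have "mat p ** h = qmat (p/2) (p * eta/2) ((1 + 2 * n)/2) 0"
        unfolding pm[symmetric] by (simp add: mat2_eq_iff h_def) (simp add: algebra_simps add_divide_distrib diff_divide_distrib)
      then show ?thesis by (simp add: mat2_eq_iff quat_j_def algebra_simps add_divide_distrib)
    qed
    have pk: "mat p ** (quat_i ** h) - mat n ** (quat_i ** quat_j) = qmat (p * eta\<^sup>2/2) (p/2) 0 (1/2)"
    proof -
      have "mat p ** (quat_i ** h) = qmat (p * eta\<^sup>2/2) (p/2) 0 ((1 + 2 * n)/2)"
        unfolding pm[symmetric] by (simp add: mat2_eq_iff h_def quat_i_def algebra_simps power2_eq_square)
      then show ?thesis by (simp add: mat2_eq_iff quat_j_def quat_i_def algebra_simps add_divide_distrib)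
    qed
    have "X = mat a' + mat b' ** quat_i + mat c' ** (mat p ** h - mat n ** quat_j)
       + mat d' ** (mat p ** (quat_i ** h) - mat n ** (quat_i ** quat_j))"
      unfolding *(1) pj pk by (simp add: mat2_eq_iff oq_def oqA_def oqB_def p_def quat_i_def algebra_simps add_divide_distrib power2_eq_square)
    also have "\<dots> \<in> order_O"
      by (intro a m d) (intro g i[folded h_def] pz *(2-))+
    finally show "X \<in> order_O" .
  qed
  with sub have "order_O = W" by (rule equalityI)
  then show ?thesis unfolding W_def .
qed

lemma order_O_ring:
  assumes "X \<in> order_O" "Y \<in> order_O"
  shows "X + Y \<in> order_O" "X - Y \<in> order_O" "X ** Y \<in> order_O"
  using mat_subring_hull[of "mat ` Z_eta \<union> {quat_i, quat_j, (1/2) *\<^sub>R (mat 1 + eta *\<^sub>R quat_i + (1 + eta + eta\<^sup>2) *\<^sub>R quat_j)}"] assms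
  unfolding order_O_def mat_adjoin_def mat_subring_def by blast+

lemma order_O_mat: "u \<in> Zr \<Longrightarrow> mat u \<in> order_O"
  unfolding order_O_eq order_gens(1) using Zr_closed(1) by blast

lemma order_O_trace: assumes "X \<in> order_O" shows "X$1$1 + X$2$2 \<in> Zr"
proof -
  from assms obtain a b c d where *: "X = oq a b c d" "a \<in> Zr" "b \<in> Zr" "c \<in> Zr" "d \<in> Zr"
    unfolding order_O_eq by blast
  then have "X$1$1 + X$2$2 = (eta\<^sup>2 + 1) * (c + eta\<^sup>2 * d) + 2 * a" by (simp add: oq_def oqA_def)
  then show ?thesis by (simp only:) (intro Zr_closed *(2-))
qed

text \<open>The adjugate is the trace minus the matrix, and traces lie in Z[eta]. So inverses of
  elements of determinant 1 stay in the order, and \<open>Delta237_iff\<close> can drop the unit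
  condition.\<close>

lemma adj2_order_O: assumes "X \<in> order_O" shows "adj2 X \<in> order_O"
proof -
  have "adj2 X = mat (X$1$1 + X$2$2) - X" by (simp add: mat2_eq_iff)
  then show ?thesis using order_O_ring(2)[OF order_O_mat[OF order_O_trace[OF assms]] assms] by simp
qed

section \<open>The group of units of norm one and its generators\<close>

lemma Delta237_iff: "M \<in> Delta237 \<longleftrightarrow> M \<in> order_O \<and> det M = 1"
  unfolding Delta237_def mat_units_def using adj2_order_O adj2_mult by blast

lemma Delta237_det: "M \<in> Delta237 \<Longrightarrow> det M = 1" by (simp add: Delta237_iff)

lemma Delta237_mult: "M \<in> Delta237 \<Longrightarrow> N \<in> Delta237 \<Longrightarrow> M ** N \<in> Delta237"
  by (simp add: Delta237_iff order_O_ring det_mul)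

lemma Delta237_adj: "M \<in> Delta237 \<Longrightarrow> adj2 M \<in> Delta237"
  by (simp add: Delta237_iff adj2_order_O)

lemma Delta237_1: "mat 1 \<in> Delta237"
  by (simp add: Delta237_iff order_O_mat Zr_closed det_2)

lemma Delta237_minus: "M \<in> Delta237 \<Longrightarrow> - M \<in> Delta237"
proof -
  assume M: "M \<in> Delta237"
  have "- M = mat 0 - M" by (simp add: mat2_eq_iff)
  then have "- M \<in> order_O" using order_O_ring(2)[OF order_O_mat[OF Zr_closed(1)]] M by (simp add: Delta237_iff)
  then show ?thesis using M by (simp add: Delta237_iff det_2)
qed

lemma mat_pow_Delta237: "M \<in> Delta237 \<Longrightarrow> mat_pow M n \<in> Delta237"
  by (induction n) (auto simp: Delta237_1 Delta237_mult)

text \<open>\<open>eta\<close> is a unit of Z[eta]; this puts \<open>g2\<close>, whose k-coordinate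
  is \<open>1 / eta\<close>, into the order.\<close>

lemma eta_inverse: "1 / eta = eta\<^sup>2 + eta - 2"
proof -
  have "eta * (eta\<^sup>2 + eta - 2) = 1" using eta_cube by algebra
  then show ?thesis by (simp add: field_simps)
qed

lemma g2_oq: "g2 = oq (- ((eta\<^sup>2 + 1) * eta\<^sup>2 * (eta\<^sup>2 + eta - 2))) (- ((eta\<^sup>2 + 1) * (eta\<^sup>2 + eta - 2))) 0 (2 * (eta\<^sup>2 + eta - 2))"
proof -
  have "1 / sqrt eta = 1 / eta * sqrt eta" by (simp add: field_simps)
  then have "g2 = qmat 0 0 0 (1 / eta)"
    by (simp add: mat2_eq_iff g2_def)
  also have "\<dots> = oq (- ((eta\<^sup>2 + 1) * eta\<^sup>2 * (eta\<^sup>2 + eta - 2))) (- ((eta\<^sup>2 + 1) * (eta\<^sup>2 + eta - 2))) 0 (2 * (eta\<^sup>2 + eta - 2))"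
  proof -
    define h where "h = eta\<^sup>2 + eta - 2"
    show ?thesis unfolding eta_inverse h_def[symmetric] by (simp add: oq_def oqA_def oqB_def algebra_simps)
  qed
  finally show ?thesis .
qed

lemma g7_oq: "g7 = oq (eta\<^sup>2 - eta - 1) (2 - eta - eta\<^sup>2) 0 (eta\<^sup>2 + eta - 2)"
proof -
  have 1: "oqA eta (eta\<^sup>2 - eta - 1) 0 (eta\<^sup>2 + eta - 2) = eta\<^sup>2 + eta - 1"
    unfolding oqA_def using eta_cube by algebra
  have 2: "oqB eta (2 - eta - eta\<^sup>2) 0 (eta\<^sup>2 + eta - 2) = 2 - eta\<^sup>2"
    unfolding oqB_def using eta_cube by algebra
  have 3: "eta * (2 - eta\<^sup>2 - (eta\<^sup>2 + eta - 2) * sqrt eta) = eta\<^sup>2 - 1 - sqrt eta"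
    using eta_cube by algebra
  show ?thesis unfolding oq_def 1 2
    using 3 by (simp add: mat2_eq_iff g7_def field_simps)
qed

lemma det_g2: "det g2 = 1"
  by (simp add: g2_def det_2)

lemma det_g7: "det g7 = 1"
proof -
  have "(eta\<^sup>2 + eta - 1)\<^sup>2 - (eta\<^sup>2 - 1 - s) * (2 - eta\<^sup>2 + (eta\<^sup>2 + eta - 2) * s) = 4"
    if "s * s = eta" for s
  proof -
    have "(eta\<^sup>2 + eta - 1)\<^sup>2 - (eta\<^sup>2 - 1 - s) * (2 - eta\<^sup>2 + (eta\<^sup>2 + eta - 2) * s) - 4
      = (eta\<^sup>2 + eta - 2) * (s * s - eta) + (2 * eta + 1 - s * eta) * (eta^3 + eta\<^sup>2 - 2 * eta - 1)"
      by algebra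
    then show ?thesis using that eta_cube by simp
  qed
  from this[OF sqrt_eta_sq(1)] show ?thesis
    by (simp add: g7_def det_2 power2_eq_square)
qed

lemma g2_Delta: "g2 \<in> Delta237"
  unfolding Delta237_iff order_O_eq
  by (rule conjI[OF _ det_g2], subst g2_oq, rule CollectI, intro exI conjI, rule refl)
     (intro Zr_closed)+

lemma g7_Delta: "g7 \<in> Delta237"
  unfolding Delta237_iff order_O_eq
  by (rule conjI[OF _ det_g7], subst g7_oq, rule CollectI, intro exI conjI, rule refl)
     (intro Zr_closed)+

text \<open>This triangle group relation puts \<open>g3\<close> into \<open>Delta237\<close>, makes
  \<open>g3 ** g7\<close> conjugate to \<open>g2\<close>, and shows that \<open>g7\<close> takes
  \<open>tau3\<close> to \<open>tau3'\<close>.\<close>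

lemma g3_eq: "g3 = adj2 g7 ** g2"
proof -
  have s: "1 / sqrt eta = (eta\<^sup>2 + eta - 2) * sqrt eta"
    unfolding eta_inverse[symmetric] by (simp add: field_simps)
  define c where "c = eta^3 + eta\<^sup>2 - 2 * eta - 1"
  have c0: "c = 0" unfolding c_def using eta_cube by simp
  define r where "r = sqrt eta"
  have r: "r * r = eta" by (simp add: r_def)
  have "- ((eta\<^sup>2 - 1 - r) * ((eta\<^sup>2 + eta - 2) * r)) - (1 + (eta\<^sup>2 - 2) * r)
      = (eta\<^sup>2 + eta - 2) * (r * r - eta) + c - r * eta * c"
    unfolding c_def by algebra
  then have 1: "- ((eta\<^sup>2 - 1 - r) * ((eta\<^sup>2 + eta - 2) * r)) = 1 + (eta\<^sup>2 - 2) * r"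
    using c0 r by simp
  have "(eta\<^sup>2 + eta - 1) * ((eta\<^sup>2 + eta - 2) * r) - (3 - eta\<^sup>2) * r = r * (eta + 1) * c"
    unfolding c_def by algebra
  then have 2: "(eta\<^sup>2 + eta - 1) * ((eta\<^sup>2 + eta - 2) * r) = (3 - eta\<^sup>2) * r"
    using c0 by simp
  have "(2 - eta\<^sup>2 + (eta\<^sup>2 + eta - 2) * r) * r - (1 - (eta\<^sup>2 - 2) * r)
      = (eta\<^sup>2 + eta - 2) * (r * r - eta) + c"
    unfolding c_def by algebra
  then have 3: "(2 - eta\<^sup>2 + (eta\<^sup>2 + eta - 2) * r) * r = 1 - (eta\<^sup>2 - 2) * r"
    using c0 r by simp
  note * = 1[unfolded r_def] 2[unfolded r_def] 3[unfolded r_def]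
  show ?thesis
    using * by (simp add: mat2_eq_iff g3_def g2_def s g7_def) (simp add: algebra_simps)
qed

lemma g3_Delta: "g3 \<in> Delta237"
  unfolding g3_eq by (intro Delta237_mult Delta237_adj g7_Delta g2_Delta)

section \<open>The norm form at the conjugate places and the gaps between traces\<close>

lemma oq_norm_conj:
  assumes ip: "ip a" "ip b" "ip c" "ip d" and x: "is_root x"
    and n: "\<And>x. n x = (oqA x (a x) (c x) (d x))\<^sup>2 - x * (oqB x (b x) (c x) (d x))\<^sup>2 - x * (c x)\<^sup>2 + x\<^sup>2 * (d x)\<^sup>2"
  shows "4 * det (oq (a eta) (b eta) (c eta) (d eta)) = n eta" "ip n"
proof -
  show "4 * det (oq (a eta) (b eta) (c eta) (d eta)) = n eta"
    unfolding oq_def det_qmat n by (simp add: power_divide field_simps)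
  have "n = (\<lambda>x. (oqA x (a x) (c x) (d x))\<^sup>2 - x * (oqB x (b x) (c x) (d x))\<^sup>2 - x * (c x)\<^sup>2 + x\<^sup>2 * (d x)\<^sup>2)"
    using n by blast
  then show "ip n" unfolding oqA_def oqB_def using ip by (simp add: ip_add ip_mult ip_diff ip_power)
qed

text \<open>The norm equals 1 at every root because it does at \<open>eta\<close>. At a negative
  root every term of the norm form is nonnegative, so the square of the trace is at most 4
  there.\<close>

lemma Delta237_trace:
  assumes "X \<in> Delta237"
  obtains f where "ip f" "X$1$1 + X$2$2 = f eta" "\<bar>f eta2\<bar> \<le> 2" "\<bar>f eta3\<bar> \<le> 2"
proof -
  from assms obtain a b c d where *: "X = oq (a eta) (b eta) (c eta) (d eta)" "ip a" "ip b" "ip c" "ip d"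
    unfolding Delta237_iff order_O_eq Zr_def by blast
  define n where "n = (\<lambda>x. (oqA x (a x) (c x) (d x))\<^sup>2 - x * (oqB x (b x) (c x) (d x))\<^sup>2 - x * (c x)\<^sup>2 + x\<^sup>2 * (d x)\<^sup>2)"
  define f where "f = (\<lambda>x. oqA x (a x) (c x) (d x))"
  have f: "ip f" unfolding f_def oqA_def using *(2-) by (simp add: ip_add ip_mult ip_power)
  have nn: "4 * det (oq (a eta) (b eta) (c eta) (d eta)) = n eta" "ip n"
    using oq_norm_conj[OF *(2-5) root_eta, of n] by (simp_all add: n_def)
  then have "n eta = 4" using assms *(1) by (simp add: Delta237_iff)
  then have n4: "n x = 4" if "is_root x" for x
    using ip_zero[OF ip_diff[OF nn(2) ip_numeral[of "num.Bit0 (num.Bit0 num.One)"]] _ that] by simp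
  have "\<bar>f x\<bar> \<le> 2" if "is_root x" "x < 0" for x
  proof -
    have "x * (oqB x (b x) (c x) (d x))\<^sup>2 \<le> 0" "x * (c x)\<^sup>2 \<le> 0" "x\<^sup>2 * (d x)\<^sup>2 \<ge> 0"
      using that by (auto simp: mult_nonpos_nonneg)
    moreover have "n x = (f x)\<^sup>2 - x * (oqB x (b x) (c x) (d x))\<^sup>2 - x * (c x)\<^sup>2 + x\<^sup>2 * (d x)\<^sup>2"
      unfolding n_def f_def ..
    ultimately have "(f x)\<^sup>2 \<le> 4" using n4[OF that(1)] by linarith
    then show ?thesis using abs_le_square_iff[of "f x" 2] by simp
  qed
  then have "\<bar>f eta2\<bar> \<le> 2" "\<bar>f eta3\<bar> \<le> 2" using root_eta23 eta23_neg by blast+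
  moreover have "X$1$1 + X$2$2 = f eta" using *(1) by (simp add: oq_def f_def)
  ultimately show ?thesis using f that by blast
qed

text \<open>The two other conjugates of the trace contribute at most 2 * 2 to the norm, hence the
  radius 1/4. Shifted by 1 they contribute at most 3 * 3, hence 1/9 in the next lemma.\<close>

lemma Delta237_trace_gap0:
  assumes "X \<in> Delta237" "\<bar>X$1$1 + X$2$2\<bar> < 1/4" shows "X$1$1 + X$2$2 = 0"
proof -
  obtain f where f: "ip f" "X$1$1 + X$2$2 = f eta" "\<bar>f eta2\<bar> \<le> 2" "\<bar>f eta3\<bar> \<le> 2"
    using Delta237_trace[OF assms(1)] by blast
  have "\<bar>f eta2\<bar> * \<bar>f eta3\<bar> \<le> 2 * 2" using f by (intro mult_mono) auto
  moreover have "\<bar>f eta\<bar> * (\<bar>f eta2\<bar> * \<bar>f eta3\<bar>) \<le> \<bar>f eta\<bar> * (2 * 2)"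
    using calculation by (intro mult_left_mono) auto
  ultimately have "\<bar>f eta * f eta2 * f eta3\<bar> < 1"
    using assms(2) f(2) by (simp add: abs_mult mult.assoc)
  from ip_small[OF f(1) this] f(2) show ?thesis by simp
qed

lemma Delta237_trace_gap1:
  assumes "X \<in> Delta237" "\<bar>X$1$1 + X$2$2 + 1\<bar> < 1/9" shows "X$1$1 + X$2$2 = -1"
proof -
  obtain f where f: "ip f" "X$1$1 + X$2$2 = f eta" "\<bar>f eta2\<bar> \<le> 2" "\<bar>f eta3\<bar> \<le> 2"
    using Delta237_trace[OF assms(1)] by blast
  have "\<bar>f eta2 + 1\<bar> * \<bar>f eta3 + 1\<bar> \<le> 3 * 3" using f by (intro mult_mono) auto
  moreover have "\<bar>f eta + 1\<bar> * (\<bar>f eta2 + 1\<bar> * \<bar>f eta3 + 1\<bar>) \<le> \<bar>f eta + 1\<bar> * (3 * 3)"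
    using calculation by (intro mult_left_mono) auto
  ultimately have "\<bar>(f eta + 1) * (f eta2 + 1) * (f eta3 + 1)\<bar> < 1"
    using assms(2) f(2) by (simp add: abs_mult mult.assoc)
  from ip_small[OF ip_add[OF f(1) ip_1] this] f(2) show ?thesis by simp
qed

section \<open>Hyperbolic distances\<close>

text \<open>In the coordinates \<open>(s1, s2, s3)\<close> Moebius transformations are linear (hyperboloid model).\<close>
definition s1 :: "complex \<Rightarrow> real" where "s1 \<tau> = ((Re \<tau>)\<^sup>2 + (Im \<tau>)\<^sup>2) / Im \<tau>"
definition s2 :: "complex \<Rightarrow> real" where "s2 \<tau> = Re \<tau> / Im \<tau>"
definition s3 :: "complex \<Rightarrow> real" where "s3 \<tau> = 1 / Im \<tau>"

text \<open>\<open>FF\<close>, \<open>RR\<close>, \<open>EE\<close> are \<open>det M\<close> times the coordinates \<open>s1\<close>, \<open>s2\<close>, \<open>s3\<close> of \<open>moebius M \<tau>\<close>.\<close>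
definition FF :: "mat2 \<Rightarrow> complex \<Rightarrow> real" where
  "FF M \<tau> = (M$1$1)\<^sup>2 * s1 \<tau> + 2 * M$1$1 * M$1$2 * s2 \<tau> + (M$1$2)\<^sup>2 * s3 \<tau>"
definition RR :: "mat2 \<Rightarrow> complex \<Rightarrow> real" where
  "RR M \<tau> = M$1$1 * M$2$1 * s1 \<tau> + (M$1$1 * M$2$2 + M$1$2 * M$2$1) * s2 \<tau> + M$1$2 * M$2$2 * s3 \<tau>"
definition EE :: "mat2 \<Rightarrow> complex \<Rightarrow> real" where
  "EE M \<tau> = (M$2$1)\<^sup>2 * s1 \<tau> + 2 * M$2$1 * M$2$2 * s2 \<tau> + (M$2$2)\<^sup>2 * s3 \<tau>"

lemma s_norm: "Im \<tau> > 0 \<Longrightarrow> s1 \<tau> * s3 \<tau> - (s2 \<tau>)\<^sup>2 = 1"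
  by (simp add: s1_def s2_def s3_def field_simps power2_eq_square)

lemma s3_pos: "Im \<tau> > 0 \<Longrightarrow> s3 \<tau> > 0" by (simp add: s3_def)

lemma s1_pos: "Im \<tau> > 0 \<Longrightarrow> s1 \<tau> > 0"
  by (simp add: s1_def add_nonneg_pos)

lemma s_eqI: "s2 p = s2 q \<Longrightarrow> s3 p = s3 q \<Longrightarrow> Im p > 0 \<Longrightarrow> Im q > 0 \<Longrightarrow> p = q"
  by (simp add: s2_def s3_def complex_eq_iff field_simps)

lemma EE_Im: "Im \<tau> > 0 \<Longrightarrow> EE M \<tau> * Im \<tau> = (M$2$1 * Re \<tau> + M$2$2)\<^sup>2 + (M$2$1 * Im \<tau>)\<^sup>2"
  by (simp add: EE_def s1_def s2_def s3_def field_simps power2_eq_square)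

lemma EE_pos: assumes "Im \<tau> > 0" "det M \<noteq> 0" shows "EE M \<tau> > 0"
proof -
  have "(M$2$1 * Re \<tau> + M$2$2)\<^sup>2 + (M$2$1 * Im \<tau>)\<^sup>2 > 0"
  proof (cases "M$2$1 = 0")
    case True
    then have "M$2$2 \<noteq> 0" using assms(2) by (auto simp: det_2)
    then show ?thesis using True by simp
  next
    case False
    then have "(M$2$1 * Im \<tau>)\<^sup>2 > 0" using assms(1) by simp
    then show ?thesis by (simp add: add_nonneg_pos)
  qed
  then have "EE M \<tau> * Im \<tau> > 0" using EE_Im[OF assms(1)] by simp
  then show ?thesis using assms(1) by (simp add: zero_less_mult_iff)
qed

lemma moebius_Re_Im:
  assumes "Im \<tau> > 0" "det M \<noteq> 0"
  shows "Re (moebius M \<tau>) = RR M \<tau> / EE M \<tau>" "Im (moebius M \<tau>) = det M / EE M \<tau>"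
proof -
  define y where "y = Im \<tau>"
  have y: "y > 0" using assms by (simp add: y_def)
  have E: "(M$2$1 * Re \<tau> + M$2$2)\<^sup>2 + (M$2$1 * y)\<^sup>2 = EE M \<tau> * y"
    using EE_Im[OF assms(1), of M] by (simp add: y_def)
  have Ep: "EE M \<tau> > 0" by (rule EE_pos[OF assms])
  have "Re (moebius M \<tau>) = ((M$1$1 * Re \<tau> + M$1$2) * (M$2$1 * Re \<tau> + M$2$2) + M$1$1 * y * (M$2$1 * y)) / (EE M \<tau> * y)"
    unfolding moebius_def Re_divide E[symmetric] by (simp add: y_def)
  also have "(M$1$1 * Re \<tau> + M$1$2) * (M$2$1 * Re \<tau> + M$2$2) + M$1$1 * y * (M$2$1 * y) = RR M \<tau> * y"
    using y by (simp add: RR_def s1_def s2_def s3_def y_def[symmetric] field_simps power2_eq_square)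
  finally show "Re (moebius M \<tau>) = RR M \<tau> / EE M \<tau>" using y by simp
  have "Im (moebius M \<tau>) = (M$1$1 * y * (M$2$1 * Re \<tau> + M$2$2) - (M$1$1 * Re \<tau> + M$1$2) * (M$2$1 * y)) / (EE M \<tau> * y)"
    unfolding moebius_def Im_divide E[symmetric] by (simp add: y_def)
  also have "M$1$1 * y * (M$2$1 * Re \<tau> + M$2$2) - (M$1$1 * Re \<tau> + M$1$2) * (M$2$1 * y) = det M * y"
    by (simp add: det_2 algebra_simps)
  finally show "Im (moebius M \<tau>) = det M / EE M \<tau>" using y by simp
qed

lemma moebius_Im_pos: "Im \<tau> > 0 \<Longrightarrow> det M > 0 \<Longrightarrow> Im (moebius M \<tau>) > 0"
  by (simp add: moebius_Re_Im EE_pos)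

lemma FF_EE_RR: "Im \<tau> > 0 \<Longrightarrow> FF M \<tau> * EE M \<tau> - (RR M \<tau>)\<^sup>2 = (det M)\<^sup>2"
proof -
  assume "Im \<tau> > 0"
  note n = s_norm[OF this]
  have "FF M \<tau> * EE M \<tau> - (RR M \<tau>)\<^sup>2 = (det M)\<^sup>2 * (s1 \<tau> * s3 \<tau> - (s2 \<tau>)\<^sup>2)"
    unfolding FF_def EE_def RR_def det_2 by algebra
  then show ?thesis using n by simp
qed

lemma moebius_s:
  assumes "Im \<tau> > 0" "det M > 0"
  shows "s1 (moebius M \<tau>) = FF M \<tau> / det M" "s2 (moebius M \<tau>) = RR M \<tau> / det M"
    "s3 (moebius M \<tau>) = EE M \<tau> / det M"
proof -
  have Ep: "EE M \<tau> > 0" using EE_pos assms by simp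
  have d: "det M \<noteq> 0" using assms by simp
  note m = moebius_Re_Im[OF assms(1) d]
  show "s3 (moebius M \<tau>) = EE M \<tau> / det M" "s2 (moebius M \<tau>) = RR M \<tau> / det M"
    unfolding s3_def s2_def m using Ep assms by simp_all
  have "s1 (moebius M \<tau>) = ((RR M \<tau>)\<^sup>2 + (det M)\<^sup>2) / (EE M \<tau> * det M)"
    unfolding s1_def m using Ep assms by (simp add: field_simps power2_eq_square)
  also have "(RR M \<tau>)\<^sup>2 + (det M)\<^sup>2 = FF M \<tau> * EE M \<tau>"
    using FF_EE_RR[OF assms(1), of M] by simp
  finally show "s1 (moebius M \<tau>) = FF M \<tau> / det M" using Ep by simp
qed

text \<open>Lets a group element be moved from the point into the matrix, so that all translates of
  a point can be compared through the same three functions.\<close>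

lemma FRE_mult:
  assumes "Im \<tau> > 0" "det g > 0"
  shows "FF (M ** g) \<tau> = det g * FF M (moebius g \<tau>)" "RR (M ** g) \<tau> = det g * RR M (moebius g \<tau>)"
    "EE (M ** g) \<tau> = det g * EE M (moebius g \<tau>)"
proof -
  have 1: "s1 (moebius g \<tau>) * det g = FF g \<tau>" "s2 (moebius g \<tau>) * det g = RR g \<tau>"
    "s3 (moebius g \<tau>) * det g = EE g \<tau>"
    using moebius_s[OF assms] assms by simp_all
  have "det g * FF M (moebius g \<tau>) = (M$1$1)\<^sup>2 * FF g \<tau> + 2 * M$1$1 * M$1$2 * RR g \<tau> + (M$1$2)\<^sup>2 * EE g \<tau>"
    unfolding FF_def[of M] 1[symmetric] by algebra
  also have "\<dots> = FF (M ** g) \<tau>"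
    unfolding FF_def RR_def EE_def matrix_mult_nth2 by algebra
  finally show "FF (M ** g) \<tau> = det g * FF M (moebius g \<tau>)" by simp
  have "det g * RR M (moebius g \<tau>) = M$1$1 * M$2$1 * FF g \<tau> + (M$1$1 * M$2$2 + M$1$2 * M$2$1) * RR g \<tau> + M$1$2 * M$2$2 * EE g \<tau>"
    unfolding RR_def[of M] 1[symmetric] by algebra
  also have "\<dots> = RR (M ** g) \<tau>"
    unfolding FF_def RR_def EE_def matrix_mult_nth2 by algebra
  finally show "RR (M ** g) \<tau> = det g * RR M (moebius g \<tau>)" by simp
  have "det g * EE M (moebius g \<tau>) = (M$2$1)\<^sup>2 * FF g \<tau> + 2 * M$2$1 * M$2$2 * RR g \<tau> + (M$2$2)\<^sup>2 * EE g \<tau>"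
    unfolding EE_def[of M] 1[symmetric] by algebra
  also have "\<dots> = EE (M ** g) \<tau>"
    unfolding FF_def RR_def EE_def matrix_mult_nth2 by algebra
  finally show "EE (M ** g) \<tau> = det g * EE M (moebius g \<tau>)" by simp
qed

lemma FRE_mult1:
  assumes "Im \<tau> > 0" "det g = 1"
  shows "FF (M ** g) \<tau> = FF M (moebius g \<tau>)" "RR (M ** g) \<tau> = RR M (moebius g \<tau>)"
    "EE (M ** g) \<tau> = EE M (moebius g \<tau>)"
  using FRE_mult[of \<tau> g M] assms by simp_all

lemma moebius_mult:
  assumes "Im \<tau> > 0" "det A > 0" "det B > 0"
  shows "moebius (A ** B) \<tau> = moebius A (moebius B \<tau>)"
proof (rule s_eqI)
  have d: "det (A ** B) > 0" using assms by (simp add: det_mul)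
  have i: "Im (moebius B \<tau>) > 0" by (rule moebius_Im_pos[OF assms(1,3)])
  show "Im (moebius (A ** B) \<tau>) > 0" "Im (moebius A (moebius B \<tau>)) > 0"
    by (intro moebius_Im_pos assms d i)+
  show "s2 (moebius (A ** B) \<tau>) = s2 (moebius A (moebius B \<tau>))"
    unfolding moebius_s[OF assms(1) d] moebius_s[OF i assms(2)] FRE_mult[OF assms(1,3)] det_mul
    using assms by simp
  show "s3 (moebius (A ** B) \<tau>) = s3 (moebius A (moebius B \<tau>))"
    unfolding moebius_s[OF assms(1) d] moebius_s[OF i assms(2)] FRE_mult[OF assms(1,3)] det_mul
    using assms by simp
qed

lemma moebius_1 [simp]: "moebius (mat 1) \<tau> = \<tau>"
  by (simp add: moebius_def)

lemma moebius_minus: "moebius (- M) \<tau> = moebius M \<tau>"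
proof -
  have "moebius (- M) \<tau> = (- (of_real (M$1$1) * \<tau> + of_real (M$1$2))) / (- (of_real (M$2$1) * \<tau> + of_real (M$2$2)))"
    unfolding moebius_def by simp
  then show ?thesis unfolding minus_divide_divide moebius_def .
qed

text \<open>The hyperbolic cosine of the hyperbolic distance.\<close>
definition CC :: "complex \<Rightarrow> complex \<Rightarrow> real" where
  "CC p q = (s1 p * s3 q + s3 p * s1 q - 2 * s2 p * s2 q) / 2"

lemma CC_moebius:
  assumes "Im p > 0" "Im q > 0" "det g = 1"
  shows "CC (moebius g p) (moebius g q) = CC p q"
proof -
  have d: "det g > 0" using assms by simp
  have "FF g p * EE g q + EE g p * FF g q - 2 * RR g p * RR g q = (det g)\<^sup>2 * (s1 p * s3 q + s3 p * s1 q - 2 * s2 p * s2 q)"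
    unfolding FF_def EE_def RR_def det_2 by algebra
  then show ?thesis
    unfolding CC_def moebius_s[OF assms(1) d] moebius_s[OF assms(2) d] using assms(3) by simp
qed

lemma CC_ge_1: assumes "Im p > 0" "Im q > 0" shows "CC p q \<ge> 1"
proof -
  have "CC p q - 1 = ((Re p - Re q)\<^sup>2 + (Im p - Im q)\<^sup>2) / (2 * Im p * Im q)"
    using assms by (simp add: CC_def s1_def s2_def s3_def field_simps power2_eq_square)
  also have "\<dots> \<ge> 0" using assms by simp
  finally show ?thesis by simp
qed

text \<open>The trace-free matrix of square -1 that fixes the point \<tau> of the upper half plane;
  it is carried along by conjugation (\<open>JJ_moebius\<close>).\<close>

definition JJ :: "complex \<Rightarrow> mat2" where
  "JJ \<tau> = mat22 (s2 \<tau>) (- s1 \<tau>) (s3 \<tau>) (- s2 \<tau>)"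

lemma JJ_moebius:
  assumes "Im \<tau> > 0" "det g = 1"
  shows "g ** JJ \<tau> ** adj2 g = JJ (moebius g \<tau>)"
proof -
  have d: "det g > 0" using assms by simp
  show ?thesis
    using moebius_s[OF assms(1) d] assms(2)
    by (simp add: mat2_eq_iff JJ_def FF_def RR_def EE_def algebra_simps power2_eq_square)
qed

text \<open>An elliptic matrix is half its trace plus \<open>t / 2\<close> times \<open>JJ\<close>
  of its fixed point, so the coordinates of that point can be read off the entries; the positive
  lower left entry fixes the sign.\<close>

lemma fixed_point_elliptic:
  assumes "det M = 1" "M$2$1 > 0" "(M$1$1 + M$2$2)\<^sup>2 < 4"
  defines "t \<equiv> sqrt (4 - (M$1$1 + M$2$2)\<^sup>2)"
  shows "Im (fixed_point M) > 0" "moebius M (fixed_point M) = fixed_point M"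
    "s1 (fixed_point M) = - 2 * M$1$2 / t" "s2 (fixed_point M) = (M$1$1 - M$2$2) / t"
    "s3 (fixed_point M) = 2 * M$2$1 / t"
proof -
  define a b c d where abcd: "a = M$1$1" "b = M$1$2" "c = M$2$1" "d = M$2$2"
  have t: "t > 0" "t\<^sup>2 = 4 - (a + d)\<^sup>2" unfolding t_def abcd using assms by simp_all
  have det: "a * d - b * c = 1" using assms(1) by (simp add: det_2 abcd)
  have c: "c > 0" using assms by (simp add: abcd)
  define p where "p = Complex ((a - d) / (2 * c)) (t / (2 * c))"
  have pI: "Im p > 0" using t c by (simp add: p_def)
  have s: "s2 p = (a - d) / t" "s3 p = 2 * c / t"
    using t c by (simp_all add: p_def s2_def s3_def)
  have s1: "s1 p = - 2 * b / t"
  proof -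
    have "s1 p = ((a - d)\<^sup>2 + t\<^sup>2) / (2 * c * t)"
      using t c by (simp add: p_def s1_def field_simps power2_eq_square)
    also have "(a - d)\<^sup>2 + t\<^sup>2 = - 4 * b * c" unfolding t(2) using det by algebra
    finally show ?thesis using c t by (simp add: field_simps)
  qed
  have fx: "moebius M p = p"
  proof (rule s_eqI)
    have dp: "det M > 0" using assms by simp
    note ms = moebius_s[OF pI dp]
    have lin: "x * (u / t) + y * (v / t) + z * (w / t) = (x * u + y * v + z * w) / t" for x y z u v w
      by (simp add: add_divide_distrib)
    have "RR M p = (a * c * (- 2 * b) + (a * d + b * c) * (a - d) + b * d * (2 * c)) / t"
      unfolding RR_def s s1 abcd[symmetric] lin ..
    also have "a * c * (- 2 * b) + (a * d + b * c) * (a - d) + b * d * (2 * c) = a - d" using det by algebra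
    finally show "s2 (moebius M p) = s2 p" unfolding ms s assms(1) by simp
    have "EE M p = (c\<^sup>2 * (- 2 * b) + 2 * c * d * (a - d) + d\<^sup>2 * (2 * c)) / t"
      unfolding EE_def s s1 abcd[symmetric] lin ..
    also have "c\<^sup>2 * (- 2 * b) + 2 * c * d * (a - d) + d\<^sup>2 * (2 * c) = 2 * c" using det by algebra
    finally show "s3 (moebius M p) = s3 p" unfolding ms s assms(1) by simp
    show "Im (moebius M p) > 0" by (rule moebius_Im_pos[OF pI dp])
    show "Im p > 0" by (rule pI)
  qed
  have uniq: "q = p" if q: "Im q > 0" "moebius M q = q" for q
  proof -
    define z where "z = of_real c * q + of_real d"
    have "Im z > 0" using q c by (simp add: z_def)
    then have z: "z \<noteq> 0" by auto
    have "of_real a * q + of_real b = q * z"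
      using q(2) unfolding moebius_def abcd[symmetric] z_def[symmetric] nonzero_divide_eq_eq[OF z] .
    then have e: "of_real a * q + of_real b = q * (of_real c * q + of_real d)" by (simp add: z_def)
    define x y where xy: "x = Re q" "y = Im q"
    have y: "y > 0" using q xy by simp
    from arg_cong[OF e, of Im] have "a * y = x * (c * y) + y * (c * x + d)" by (simp add: xy)
    then have "y * (a - d - 2 * c * x) = 0" by (simp add: algebra_simps)
    then have x: "2 * c * x = a - d" using y by simp
    from arg_cong[OF e, of Re] have "a * x + b = x * (c * x + d) - y * (c * y)" by (simp add: xy)
    then have "(2 * c * y)\<^sup>2 = (2 * c * x)\<^sup>2 - 2 * (a - d) * (2 * c * x) - 4 * b * c" by algebra
    also have "\<dots> = t\<^sup>2" unfolding x t(2) using det by algebra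
    finally have "(2 * c * y)\<^sup>2 = t\<^sup>2" .
    then have "2 * c * y = t" by (rule power2_eq_imp_eq) (use y c t in simp_all)
    then show "q = p" using x c xy by (simp add: p_def complex_eq_iff field_simps)
  qed
  have "fixed_point M = p" unfolding fixed_point_def
  proof (rule the_equality)
    show "0 < Im p \<and> moebius M p = p" using pI fx by (rule conjI)
    show "q = p" if "0 < Im q \<and> moebius M q = q" for q
      by (rule uniq) (use that in blast)+
  qed
  then show "Im (fixed_point M) > 0" "moebius M (fixed_point M) = fixed_point M"
    "s1 (fixed_point M) = - 2 * M$1$2 / t" "s2 (fixed_point M) = (M$1$1 - M$2$2) / t"
    "s3 (fixed_point M) = 2 * M$2$1 / t"
    using pI fx s s1 by (simp_all add: abcd)
qed

section \<open>Distances between elliptic fixed points as traces\<close>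

lemma conj_affine:
  assumes "det X = 1" "N = mat h + k *\<^sub>R J"
  shows "X ** N ** adj2 X = mat h + k *\<^sub>R (X ** J ** adj2 X)"
proof -
  have "X ** N ** adj2 X = mat (h * det X) + k *\<^sub>R (X ** J ** adj2 X)"
    unfolding assms(2) by (simp add: mat2_eq_iff det_2 algebra_simps)
  then show ?thesis using assms(1) by simp
qed

text \<open>Both factors are a scalar plus a multiple of \<open>JJ\<close>, and the trace of
  \<open>JJ p ** JJ q\<close> is -2 times the hyperbolic cosine of the distance. Thus a bound on a
  distance becomes a bound on the trace of a group element, to which the gaps apply.\<close>

lemma elliptic_trace:
  assumes "det M = 1" "M$2$1 > 0" "(M$1$1 + M$2$2)\<^sup>2 < 4"
    and "det N = 1" "N$2$1 > 0" "(N$1$1 + N$2$2)\<^sup>2 < 4" and "det X = 1"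
  defines "t \<equiv> M$1$1 + M$2$2" and "u \<equiv> N$1$1 + N$2$2"
  defines "T \<equiv> M ** (X ** N ** adj2 X)"
  shows "T$1$1 + T$2$2 = t * u / 2 - sqrt (4 - t\<^sup>2) * sqrt (4 - u\<^sup>2) / 2 * CC (fixed_point M) (moebius X (fixed_point N))"
proof -
  define p q where pq: "p = fixed_point M" "q = fixed_point N"
  define m n where mn: "m = sqrt (4 - t\<^sup>2)" "n = sqrt (4 - u\<^sup>2)"
  have mp: "m > 0" "n > 0" unfolding mn t_def u_def using assms by simp_all
  note M = fixed_point_elliptic[OF assms(1-3), folded pq t_def mn] and N = fixed_point_elliptic[OF assms(4-6), folded pq u_def mn]
  have M': "M$1$1 = t/2 + m/2 * JJ p$1$1" "M$1$2 = m/2 * JJ p$1$2" "M$2$1 = m/2 * JJ p$2$1" "M$2$2 = t/2 + m/2 * JJ p$2$2"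
    using M mp unfolding JJ_def by (simp_all add: t_def field_simps)
  have N': "N = mat (u/2) + (n/2) *\<^sub>R JJ q"
    using N mp unfolding JJ_def by (simp add: mat2_eq_iff u_def field_simps)
  define K where "K = JJ (moebius X q)"
  define Y where "Y = X ** N ** adj2 X"
  have "Y = mat (u/2) + (n/2) *\<^sub>R K"
    unfolding Y_def conj_affine[OF assms(7) N'] JJ_moebius[OF N(1) assms(7)] K_def ..
  then have Y: "Y$1$1 = u/2 + n/2 * K$1$1" "Y$1$2 = n/2 * K$1$2" "Y$2$1 = n/2 * K$2$1" "Y$2$2 = u/2 + n/2 * K$2$2"
    by simp_all
  have "T$1$1 + T$2$2 = t * u / 2 + m * n / 4 * (JJ p$1$1 * K$1$1 + JJ p$1$2 * K$2$1 + JJ p$2$1 * K$1$2 + JJ p$2$2 * K$2$2)"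
    unfolding T_def Y_def[symmetric] matrix_mult_nth2 Y M'
    by (simp add: JJ_def K_def algebra_simps add_divide_distrib)
  also have "JJ p$1$1 * K$1$1 + JJ p$1$2 * K$2$1 + JJ p$2$1 * K$1$2 + JJ p$2$2 * K$2$2 = - 2 * CC p (moebius X q)"
    by (simp add: JJ_def K_def CC_def algebra_simps)
  finally show ?thesis unfolding pq mn by simp
qed

text \<open>This is 2 cos (pi / 7), the trace of \<open>g7\<close>.\<close>

definition lam :: real where "lam = eta\<^sup>2 + eta - 1"

lemma lam_sq: "lam\<^sup>2 = 2 + eta"
  unfolding lam_def using eta_cube by algebra

lemma lam_pos: "lam > 0" unfolding lam_def using eta_sq_bounds eta_bounds by simp

lemma g7_trace: "g7$1$1 + g7$2$2 = lam" "g7$2$2 = g7$1$1"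
  by (simp_all add: g7_def lam_def)

lemma g3_trace: "g3$1$1 + g3$2$2 = 1"
  by (simp add: g3_def field_simps)

lemma det_g3: "det g3 = 1"
  using g3_Delta Delta237_det by blast

lemma sqrt_eta_bounds: "sqrt eta > 1.1" "sqrt eta < 1.12"
proof -
  show "sqrt eta > 1.1" by (rule real_less_rsqrt) (use eta_bounds in \<open>simp add: power2_eq_square\<close>)
  show "sqrt eta < 1.12" by (rule real_less_lsqrt) (use eta_bounds in \<open>simp_all add: power2_eq_square\<close>)
qed

lemma g7_elliptic: "g7$2$1 > 0" "(g7$1$1 + g7$2$2)\<^sup>2 < 4"
proof -
  have "(eta\<^sup>2 + eta - 2) * sqrt eta > 0.8 * 1.1"
    using sqrt_eta_bounds eta_bounds eta_sq_bounds by (intro mult_strict_mono) auto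
  then show "g7$2$1 > 0" using eta_sq_bounds by (simp add: g7_def)
  show "(g7$1$1 + g7$2$2)\<^sup>2 < 4" unfolding g7_trace(1) lam_sq using eta_bounds by simp
qed

lemma g3_elliptic: "g3$2$1 > 0" "(g3$1$1 + g3$2$2)\<^sup>2 < 4"
  unfolding g3_trace using eta_sq_bounds by (simp_all add: g3_def)

lemmas tau7_props = fixed_point_elliptic[OF det_g7 g7_elliptic, folded tau7_def]
lemmas tau3_props = fixed_point_elliptic[OF det_g3 g3_elliptic, folded tau3_def]

lemma tau_Im [simp]: "Im tau3 > 0" "Im tau7 > 0"
  using tau3_props tau7_props by simp_all

definition C0 :: real where "C0 = CC tau3 tau7"

text \<open>\<open>g3 ** g7\<close> is conjugate to \<open>g2\<close> and so has trace 0; the trace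
  formula turns this into the distance from the centre to a vertex.\<close>

lemma C0_eq: "lam / 2 = sqrt 3 * sqrt (2 - eta) / 2 * C0" and C0_sq: "C0\<^sup>2 = (2 + eta) / (3 * (2 - eta))"
proof -
  have "g3$1$1 * g7$1$1 + g3$1$2 * g7$2$1 + g3$2$1 * g7$1$2 + g3$2$2 * g7$2$2 = 0"
  proof -
    have "g3$1$1 * g7$1$1 + g3$1$2 * g7$2$1 + g3$2$1 * g7$1$2 + g3$2$2 * g7$2$2 = (g2$1$1 + g2$2$2) * det g7"
      unfolding g3_eq matrix_mult_nth2 adj2_nth det_2 by algebra
    then show ?thesis by (simp add: g2_def)
  qed
  then have "0 = 1 * lam / 2 - sqrt (4 - 1) * sqrt (4 - lam\<^sup>2) / 2 * C0"
    using elliptic_trace[OF det_g3 g3_elliptic det_g7 g7_elliptic, of "mat 1"]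
    by (simp add: g3_trace g7_trace(1) tau3_def[symmetric] tau7_def[symmetric] C0_def)
  then show 1: "lam / 2 = sqrt 3 * sqrt (2 - eta) / 2 * C0" by (simp add: lam_sq)
  have "lam\<^sup>2 = 3 * (2 - eta) * C0\<^sup>2"
  proof -
    have "lam = sqrt 3 * sqrt (2 - eta) * C0" using 1 by simp
    then have "lam\<^sup>2 = (sqrt 3 * sqrt (2 - eta) * C0)\<^sup>2" by (rule arg_cong)
    also have "\<dots> = (sqrt 3)\<^sup>2 * (sqrt (2 - eta))\<^sup>2 * C0\<^sup>2" by (simp only: power_mult_distrib)
    finally have "lam\<^sup>2 = (sqrt 3)\<^sup>2 * (sqrt (2 - eta))\<^sup>2 * C0\<^sup>2" .
    then show ?thesis using eta_bounds by simp
  qed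
  then show "C0\<^sup>2 = (2 + eta) / (3 * (2 - eta))" using eta_bounds unfolding lam_sq by (simp add: field_simps)
qed

text \<open>No centre of a tile is closer to the vertex \<open>tau3\<close> than \<open>tau7\<close>: a closer one would give an
  element of the group whose trace lies in \<open>(0, 1/4)\<close>.\<close>
lemma centre_vertex:
  assumes "X \<in> Delta237" shows "CC tau3 (moebius X tau7) \<ge> C0"
proof (rule ccontr)
  assume "\<not> ?thesis"
  then have lt: "CC tau3 (moebius X tau7) < C0" by simp
  define T where "T = g3 ** (X ** g7 ** adj2 X)"
  have d: "det X = 1" by (rule Delta237_det[OF assms])
  define k where "k = sqrt 3 * sqrt (2 - eta)"
  have kp: "k > 0" using eta_bounds by (simp add: k_def)
  have T: "T$1$1 + T$2$2 = lam / 2 - k / 2 * CC tau3 (moebius X tau7)"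
    using elliptic_trace[OF det_g3 g3_elliptic det_g7 g7_elliptic d]
    by (simp add: g3_trace g7_trace(1) tau3_def[symmetric] tau7_def[symmetric] T_def lam_sq k_def)
  have "k / 2 * CC tau3 (moebius X tau7) < k / 2 * C0" using lt kp by simp
  then have pos: "T$1$1 + T$2$2 > 0" unfolding T using C0_eq[folded k_def] by simp
  \<comment> \<open>The trivial bound for the hyperbolic cosine caps the trace at
    \<open>(lam - k) / 2\<close>, which is below 0.2.\<close>
  have "CC tau3 (moebius X tau7) \<ge> 1" by (intro CC_ge_1 moebius_Im_pos) (simp_all add: d)
  then have "k / 2 * CC tau3 (moebius X tau7) \<ge> k / 2" using kp by simp
  then have le: "T$1$1 + T$2$2 \<le> lam / 2 - k / 2" unfolding T by simp
  have "k = sqrt (3 * (2 - eta))" unfolding k_def by (rule real_sqrt_mult[symmetric])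
  also have "\<dots> > 1.5" by (rule real_less_rsqrt) (use eta_bounds in \<open>simp add: power2_eq_square\<close>)
  finally have "k > 1.5" .
  moreover have "lam < 1.9" unfolding lam_def using eta_bounds eta_sq_bounds by simp
  ultimately have "\<bar>T$1$1 + T$2$2\<bar> < 1/4" using pos le by simp
  moreover have "T \<in> Delta237" unfolding T_def
    by (intro Delta237_mult Delta237_adj g3_Delta g7_Delta assms)
  ultimately show False using Delta237_trace_gap0[of T] pos by simp
qed

section \<open>Crossing the sides of the heptagon\<close>

text \<open>\<open>s1 = eta * s3\<close> says that the point lies on the circle |z|^2 = eta, which
  therefore carries the edge from \<open>tau3\<close> to \<open>tau3'\<close>. In
  \<open>tau7_s\<close> the strict inequality puts the centre inside this circle.\<close>

lemma tau3_s: "s1 tau3 = eta * s3 tau3" "s2 tau3 < 0" "s3 tau3 > 0"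
proof -
  have t: "sqrt (4 - (g3$1$1 + g3$2$2)\<^sup>2) = sqrt 3" by (simp add: g3_trace)
  note p = tau3_props(3-5)[unfolded t]
  have "eta\<^sup>2 + eta - 1 = eta * (3 - eta\<^sup>2)" using eta_cube by algebra
  then show "s1 tau3 = eta * s3 tau3" unfolding p by (simp add: g3_def)
  have "(eta\<^sup>2 - 2) * sqrt eta < 0" using eta_sq_bounds by (simp add: mult_neg_pos)
  moreover have "g3$1$1 - g3$2$2 = (eta\<^sup>2 - 2) * sqrt eta" by (simp add: g3_def field_simps)
  ultimately show "s2 tau3 < 0" unfolding p by (simp add: divide_neg_pos)
  show "s3 tau3 > 0" by (rule s3_pos) simp
qed

lemma tau7_s: "s2 tau7 = 0" "s1 tau7 < eta * s3 tau7" "s1 tau7 * s3 tau7 = 1" "s3 tau7 > 0" "s1 tau7 > 0"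
proof -
  define t where "t = sqrt (4 - (g7$1$1 + g7$2$2)\<^sup>2)"
  have tp: "t > 0" unfolding t_def using g7_elliptic by simp
  note p = tau7_props(3-5)[folded t_def]
  show s2: "s2 tau7 = 0" unfolding p by (simp add: g7_trace)
  show "s1 tau7 * s3 tau7 = 1" using s_norm[of tau7] s2 by simp
  show "s3 tau7 > 0" "s1 tau7 > 0" by (simp_all add: s3_pos s1_pos)
  have "eta * (2 * g7$2$1) = eta\<^sup>2 - 1 + sqrt eta"
  proof -
    have "eta * (2 * g7$2$1) = eta * (2 - eta\<^sup>2) + eta * (eta\<^sup>2 + eta - 2) * sqrt eta"
      by (simp add: g7_def algebra_simps)
    also have "eta * (eta\<^sup>2 + eta - 2) = 1" using eta_cube by algebra
    also have "eta * (2 - eta\<^sup>2) = eta\<^sup>2 - 1" using eta_cube by algebra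
    finally show ?thesis by simp
  qed
  then have "- 2 * g7$1$2 < eta * (2 * g7$2$1)" using eta_sq_bounds by (simp add: g7_def)
  then have "- 2 * g7$1$2 / t < eta * (2 * g7$2$1) / t" using tp by (rule divide_strict_right_mono)
  then show "s1 tau7 < eta * s3 tau7" unfolding p by simp
qed

lemma FRE_g2:
  "FF g2 \<tau> = eta * s3 \<tau>" "RR g2 \<tau> = - s2 \<tau>" "EE g2 \<tau> = s1 \<tau> / eta"
  by (simp_all add: FF_def RR_def EE_def g2_def power_divide)

lemma g2_s:
  assumes "Im \<tau> > 0"
  shows "s1 (moebius g2 \<tau>) = eta * s3 \<tau>" "s2 (moebius g2 \<tau>) = - s2 \<tau>" "s3 (moebius g2 \<tau>) = s1 \<tau> / eta"
  using moebius_s[OF assms, of g2] by (simp_all add: det_g2 FRE_g2)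

lemma tau3'_s: "Im tau3' > 0" "s1 tau3' = s1 tau3" "s2 tau3' = - s2 tau3" "s3 tau3' = s3 tau3"
  unfolding tau3'_def using g2_s[of tau3] tau3_s moebius_Im_pos[of tau3 g2] by (simp_all add: det_g2)

lemma g2_g2: "moebius g2 (moebius g2 \<tau>) = \<tau>" if "Im \<tau> > 0"
proof (rule s_eqI)
  have i: "Im (moebius g2 \<tau>) > 0" using that by (simp add: moebius_Im_pos det_g2)
  show "Im (moebius g2 (moebius g2 \<tau>)) > 0" using i by (simp add: moebius_Im_pos det_g2)
  show "s2 (moebius g2 (moebius g2 \<tau>)) = s2 \<tau>" "s3 (moebius g2 (moebius g2 \<tau>)) = s3 \<tau>"
    unfolding g2_s[OF i] g2_s[OF that] by simp_all
qed fact

lemma tau3'_g7: "tau3' = moebius g7 tau3"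
proof -
  have "g7 ** g3 = g2"
    unfolding g3_eq matrix_mul_assoc adj2_mult(1)[OF det_g7] by simp
  moreover have "moebius (g7 ** g3) tau3 = moebius g7 (moebius g3 tau3)"
    by (rule moebius_mult) (simp_all add: det_g7 det_g3)
  ultimately show ?thesis unfolding tau3'_def tau3_props(2) by simp
qed

section \<open>Signs at the seven vertices\<close>

lemma det_mat_pow: "det M = 1 \<Longrightarrow> det (mat_pow M n) = 1"
  by (induction n) (simp_all add: det_mul)

lemma mat_pow_Suc_right: "mat_pow M (Suc n) = mat_pow M n ** M"
  by (induction n) (simp_all add: matrix_mul_assoc)

lemma mat_pow_add: "mat_pow M (m + n) = mat_pow M m ** mat_pow M n"
  by (induction m) (simp_all add: matrix_mul_assoc)

lemma g7_pow_tau7 [simp]: "moebius (mat_pow g7 n) tau7 = tau7"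
proof (induction n)
  case (Suc n)
  have "moebius (g7 ** mat_pow g7 n) tau7 = moebius g7 (moebius (mat_pow g7 n) tau7)"
    by (rule moebius_mult) (simp_all add: det_g7 det_mat_pow)
  then show ?case using Suc tau7_props(2) by simp
qed simp

lemma RR_g7_Suc: "RR (M ** mat_pow g7 (Suc n)) tau3 = RR (M ** mat_pow g7 n) tau3'"
  unfolding mat_pow_Suc_right matrix_mul_assoc tau3'_g7 by (rule FRE_mult1) (simp_all add: det_g7)

text \<open>On the hyperboloid coordinates \<open>g7\<close> has the eigenvalues 1 and exp (2 pi i /
  7) with its conjugate; the coefficients are those of the characteristic polynomial
  \<open>(X - 1) * (X^2 - eta * X + 1)\<close>. All eigenvalues are seventh roots of unity, whence
  the period 7 in the next lemma.\<close>

lemma RR_recurrence: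
  "RR (M ** mat_pow g7 (n + 3)) \<tau> = (1 + eta) * (RR (M ** mat_pow g7 (n + 2)) \<tau> - RR (M ** mat_pow g7 (n + 1)) \<tau>)
     + RR (M ** mat_pow g7 n) \<tau>"
proof -
  define A B C D where ABCD: "A = M ** mat_pow g7 n" "B = M ** mat_pow g7 (n + 1)"
    "C = M ** mat_pow g7 (n + 2)" "D = M ** mat_pow g7 (n + 3)"
  have ch: "(X ** g7) ** g7 = lam *\<^sub>R (X ** g7) - X" for X :: mat2
  proof -
    have d: "g7$1$1 * g7$2$2 - g7$1$2 * g7$2$1 = 1" using det_g7 by (simp add: det_2)
    have "(X ** g7) ** g7 = (g7$1$1 + g7$2$2) *\<^sub>R (X ** g7) - (g7$1$1 * g7$2$2 - g7$1$2 * g7$2$1) *\<^sub>R X"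
      unfolding mat2_eq_iff by (simp add: algebra_simps)
    then show ?thesis by (simp only: d g7_trace(1)) simp
  qed
  have BA: "B = A ** g7" unfolding ABCD by (simp add: mat_pow_Suc_right matrix_mul_assoc del: mat_pow.simps)
  have CB: "C = B ** g7" unfolding ABCD by (simp add: mat_pow_Suc_right matrix_mul_assoc numeral_2_eq_2 del: mat_pow.simps)
  have DC: "D = C ** g7" unfolding ABCD by (simp add: mat_pow_Suc_right matrix_mul_assoc numeral_3_eq_3 numeral_2_eq_2 del: mat_pow.simps)
  have C: "C = lam *\<^sub>R B - A" unfolding CB BA by (rule ch)
  have D: "D = lam *\<^sub>R C - B" unfolding DC CB by (rule ch)
  have Cn: "C$i$j = lam * B$i$j - A$i$j" for i j unfolding C by simp
  have Dn: "D$i$j = lam * (lam * B$i$j - A$i$j) - B$i$j" for i j unfolding D C by simp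
  have "RR D \<tau> - RR A \<tau> = (lam\<^sup>2 - 1) * (RR C \<tau> - RR B \<tau>)"
    unfolding RR_def Cn Dn by algebra
  moreover have "lam\<^sup>2 - 1 = 1 + eta" unfolding lam_sq by simp
  ultimately show ?thesis unfolding ABCD[symmetric] by simp
qed

lemma recurrence_period:
  fixes r :: "nat \<Rightarrow> real"
  assumes "\<And>n. r (n + 3) = (1 + eta) * (r (n + 2) - r (n + 1)) + r n"
  shows "r (n + 7) = r n"
proof -
  have "r (n + 3) = (1 + eta) * (r (n + 2) - r (n + 1)) + r n"
    "r (n + 4) = (1 + eta) * (r (n + 3) - r (n + 2)) + r (n + 1)"
    "r (n + 5) = (1 + eta) * (r (n + 4) - r (n + 3)) + r (n + 2)"
    "r (n + 6) = (1 + eta) * (r (n + 5) - r (n + 4)) + r (n + 3)"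
    "r (n + 7) = (1 + eta) * (r (n + 6) - r (n + 5)) + r (n + 4)"
    using assms[of n] assms[of "n + 1"] assms[of "n + 2"] assms[of "n + 3"] assms[of "n + 4"]
    by (simp_all add: eval_nat_numeral)
  then show ?thesis using eta_cube by algebra
qed

text \<open>A line crosses the boundary of the convex heptagon at most twice.\<close>
lemma unique_descent:
  fixes r :: "nat \<Rightarrow> real"
  assumes rec: "\<And>n. r (n + 3) = (1 + eta) * (r (n + 2) - r (n + 1)) + r n"
    and 0: "r 0 \<ge> 0" "r 1 < 0" and m: "m \<in> {1..5}" "r m \<ge> 0" "r (m + 1) \<le> 0"
  shows False
proof -
  have 7: "r 7 \<ge> 0" "r 8 < 0" using recurrence_period[of r, OF rec, of 0] recurrence_period[of r, OF rec, of 1] 0 by simp_all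
  \<comment> \<open>Two instances of the recurrence with \<open>r (n + 2)\<close> eliminated; the
    remaining coefficients have signs that settle the cases 3 and 4.\<close>
  have r4: "r (n + 4) = eta * r (n + 3) + r n - eta * r (n + 1)" for n
    using rec[of n] rec[of "n + 1"] by (simp add: eval_nat_numeral algebra_simps)
  from m(1) have "m = 1 \<or> m = 2 \<or> m = 3 \<or> m = 4 \<or> m = 5" by auto
  then show False
  proof (elim disjE)
    assume "m = 1" then show False using 0 m by simp
  next
    assume e: "m = 2"
    have "(1 + eta) * (r 2 - r 1) > 0" using 0 m e by (intro mult_pos_pos add_pos_pos) auto
    moreover have "r 3 = (1 + eta) * (r 2 - r 1) + r 0" using rec[of 0] by (simp add: eval_nat_numeral)
    ultimately show False using 0 m e by simp
  next
    assume e: "m = 3"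
    have "eta * r 3 \<ge> 0" "eta * r 1 < 0" using 0 m e by (simp_all add: mult_pos_neg)
    then show False using r4[of 0] 0 m e by simp
  next
    assume e: "m = 4"
    have "eta * r 7 \<ge> 0" "eta * r 5 \<le> 0" using 7 m e by (simp_all add: mult_nonneg_nonpos)
    moreover have "r 8 = eta * r 7 + r 4 - eta * r 5" using r4[of 4] by simp
    moreover have "r 4 \<ge> 0" using m e by simp
    ultimately show False using 7 by linarith
  next
    assume e: "m = 5"
    have "(1 + eta) * (r 7 - r 6) \<ge> 0" using 7 m e by simp
    then show False using rec[of 5] 7 m e by simp
  qed
qed

text \<open>For a matrix \<open>M\<close> moving a geodesic to the upward imaginary axis, the sign of \<open>RR M \<tau>\<close> tells on
  which side of the geodesic the point \<open>\<tau>\<close> lies. Both \<open>red\<close> and \<open>leav\<close> are sign conditions of this kind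
  for the properties of being reduced and of leaving through a given side.\<close>
definition red :: "mat2 \<Rightarrow> bool" where
  "red M \<longleftrightarrow> det M > 0 \<and> RR M tau3 \<ge> 0 \<and> RR M tau3' < 0"

lemma red_g7_pow:
  assumes "red M" "red (M ** mat_pow g7 m)" "m \<le> 6" shows "m = 0"
proof (rule ccontr)
  assume "m \<noteq> 0"
  define r where "r n = RR (M ** mat_pow g7 n) tau3" for n
  have rec: "r (n + 3) = (1 + eta) * (r (n + 2) - r (n + 1)) + r n" for n
    unfolding r_def by (rule RR_recurrence)
  have 0: "r 0 \<ge> 0" "r 1 < 0" using assms(1) RR_g7_Suc[of M 0] by (simp_all add: r_def red_def)
  have m: "r m \<ge> 0" "r (m + 1) < 0" using assms(2) RR_g7_Suc[of M m] by (simp_all add: r_def red_def)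
  \<comment> \<open>The value 6 escapes \<open>unique_descent\<close>, as its descent would end at
    \<open>r 7\<close>; it is refuted by \<open>r 7 = r 0\<close>.\<close>
  have "m = 6"
  proof (rule ccontr)
    assume "m \<noteq> 6"
    then have "m \<in> {1..5}" using \<open>m \<noteq> 0\<close> assms(3) by auto
    then show False using unique_descent[of r, OF rec 0 _ m(1)] m by simp
  qed
  then show False using m 0 recurrence_period[of r, OF rec, of 0] by simp
qed

text \<open>With \<open>M\<close> carrying the endpoints of a geodesic to \<open>0\<close> and \<open>\<infinity>\<close>, this says that the
  second endpoint lies inside and the first one outside the circle through \<open>tau3\<close> and \<open>tau3'\<close>.\<close>
lemma red_ends:
  assumes "red M"
  shows "(M$2$2)\<^sup>2 < eta * (M$2$1)\<^sup>2" "eta * (M$1$1)\<^sup>2 < (M$1$2)\<^sup>2"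
proof -
  define a b c d where abcd: "a = M$1$1" "b = M$1$2" "c = M$2$1" "d = M$2$2"
  define r where "r = sqrt eta"
  have r: "r * r = eta" "r > 0" by (simp_all add: r_def)
  define z w where zw: "z = s3 tau3" "w = - s2 tau3"
  have zp: "z > 0" "w > 0" using tau3_s zw by simp_all
  have "eta * z * z - w * w = 1" using s_norm[of tau3] tau3_s(1) by (simp add: zw power2_eq_square)
  moreover have "(r * z)\<^sup>2 = eta * z * z" unfolding r(1)[symmetric] by algebra
  ultimately have "w\<^sup>2 < (r * z)\<^sup>2" by (simp add: power2_eq_square[of w])
  then have wz: "w < r * z" using zp r by (simp add: power2_less_imp_less)
  define A B where AB: "A = a * c * eta + b * d" "B = a * d + b * c"
  have 1: "A * z - B * w \<ge> 0" using assms unfolding red_def RR_def tau3_s(1)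
    by (simp add: abcd AB zw algebra_simps)
  have 2: "A * z + B * w < 0" using assms unfolding red_def RR_def tau3'_s tau3_s(1)
    by (simp add: abcd AB zw algebra_simps)
  have Bn: "B < 0"
  proof (rule ccontr)
    assume "\<not> B < 0" then have "B * w \<ge> 0" using zp by simp
    then show False using 1 2 by simp
  qed
  \<comment> \<open>Replacing \<open>w\<close> by the larger \<open>r * z\<close> passes from the
    ends of the edge to the ideal points \<open>- sqrt eta\<close> and \<open>sqrt eta\<close> of
    its circle; the signs persist because \<open>B\<close> is negative.\<close>
  have "B * (r * z) < B * w" using Bn wz by simp
  then have "(A + B * r) * z < 0" "(A - B * r) * z > 0" using 1 2 by (simp_all add: algebra_simps)
  then have 3: "A + B * r < 0" "A - B * r > 0" using zp by (simp_all add: mult_less_0_iff zero_less_mult_iff)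
  define P Q P' Q' where PQ: "P = a * r + b" "Q = c * r + d" "P' = a * r - b" "Q' = c * r - d"
  have "P * Q = A + B * r" "P' * Q' = A - B * r" unfolding PQ AB r(1)[symmetric] by algebra+
  with 3 have pq: "P * Q < 0" "P' * Q' > 0" by simp_all
  have det: "a * d - b * c > 0" using assms by (simp add: red_def det_2 abcd)
  \<comment> \<open>\<open>P * Q\<close> and \<open>P' * Q'\<close> are the values at the two ideal
    points. Their signs still allow the endpoints to be interchanged; the positive determinant rules
    this out.\<close>
  have "P * Q' - P' * Q = - 2 * (r * (a * d - b * c))" unfolding PQ by algebra
  moreover have "r * (a * d - b * c) > 0" using det r by simp
  ultimately have x: "P * Q' < P' * Q" by linarith
  have "Q * Q' > 0 \<and> P * P' < 0"
  proof (cases "Q > 0")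
    case True
    then have "P < 0" using pq by (simp add: mult_less_0_iff)
    moreover have "Q' > 0"
    proof (rule ccontr)
      assume "\<not> Q' > 0"
      then have n: "Q' < 0" "P' < 0" using pq(2) by (auto simp: zero_less_mult_iff)
      then have "P * Q' > 0" "P' * Q < 0" using True \<open>P < 0\<close> by (simp_all add: mult_neg_neg mult_neg_pos)
      then show False using x by simp
    qed
    moreover from this have "P' > 0" using pq(2) by (auto simp: zero_less_mult_iff)
    ultimately show ?thesis using True by (simp add: mult_neg_pos)
  next
    case False
    then have "P > 0" "Q < 0" using pq by (auto simp: mult_less_0_iff)
    moreover have "Q' < 0"
    proof (rule ccontr)
      assume "\<not> Q' < 0"
      then have n: "Q' > 0" "P' > 0" using pq(2) by (auto simp: zero_less_mult_iff)
      then have "P * Q' > 0" "P' * Q < 0" using \<open>P > 0\<close> \<open>Q < 0\<close> by (simp_all add: mult_pos_neg)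
      then show False using x by simp
    qed
    moreover from this have "P' < 0" using pq(2) by (auto simp: zero_less_mult_iff)
    ultimately show ?thesis by (simp add: mult_neg_neg mult_pos_neg)
  qed
  moreover have "Q * Q' = eta * c\<^sup>2 - d\<^sup>2" "P * P' = eta * a\<^sup>2 - b\<^sup>2" unfolding PQ r(1)[symmetric] by algebra+
  ultimately show "(M$2$2)\<^sup>2 < eta * (M$2$1)\<^sup>2" "eta * (M$1$1)\<^sup>2 < (M$1$2)\<^sup>2" by (simp_all add: abcd)
qed

text \<open>\<open>EE\<close> is the determinant divided by the height of the moved point, so the
  neighbour across the entry edge is lower. Up to \<open>eta\<close>, the difference is the product
  of two quantities that say that \<open>tau7\<close> and the second endpoint lie inside the circle
  |z|^2 = eta.\<close>

lemma red_height: assumes "red M" shows "EE M tau7 < EE (M ** g2) tau7"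
proof -
  have e: "EE (M ** g2) tau7 = (M$2$1)\<^sup>2 * (eta * s3 tau7) + (M$2$2)\<^sup>2 * (s1 tau7 / eta)"
  proof -
    have "EE (M ** g2) tau7 = EE M (moebius g2 tau7)" by (rule FRE_mult1) (simp_all add: det_g2)
    then show ?thesis unfolding EE_def[of M] by (simp add: g2_s tau7_s)
  qed
  have "(eta * s3 tau7 - s1 tau7) * (eta * (M$2$1)\<^sup>2 - (M$2$2)\<^sup>2) > 0"
    using red_ends(1)[OF assms] tau7_s(2) by simp
  moreover have "(EE (M ** g2) tau7 - EE M tau7) * eta = (eta * s3 tau7 - s1 tau7) * (eta * (M$2$1)\<^sup>2 - (M$2$2)\<^sup>2)"
    unfolding e EE_def[of M] tau7_s(1) by (simp add: field_simps)
  ultimately have "(EE (M ** g2) tau7 - EE M tau7) * eta > 0" by simp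
  then have "EE (M ** g2) tau7 - EE M tau7 > 0" by (rule zero_less_mult_pos2) simp
  then show ?thesis by simp
qed

lemma EE_g7_pow: "EE (M ** mat_pow g7 n) tau7 = EE M tau7"
  using FRE_mult1(3)[of tau7 "mat_pow g7 n" M] by (simp add: det_mat_pow det_g7)

definition leav :: "mat2 \<Rightarrow> nat \<Rightarrow> bool" where
  "leav M i \<longleftrightarrow> det M > 0 \<and> RR (M ** mat_pow g7 i) tau3 < 0 \<and> RR (M ** mat_pow g7 i) tau3' \<ge> 0"

text \<open>\<open>g2\<close> interchanges \<open>tau3\<close> and \<open>tau3'\<close>, so the
  signs at the exit edge of one tile, read from the next tile, are those of an entry edge.\<close>

lemma leav_red: assumes "leav M i" shows "red (M ** (mat_pow g7 i ** g2))"
  unfolding red_def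
proof (intro conjI)
  show "det (M ** (mat_pow g7 i ** g2)) > 0"
    using assms by (simp add: leav_def det_mul det_mat_pow det_g7 det_g2)
  show "RR (M ** (mat_pow g7 i ** g2)) tau3 \<ge> 0"
    using assms FRE_mult1(2)[of tau3 g2 "M ** mat_pow g7 i"]
    by (simp add: leav_def det_g2 tau3'_def[symmetric] matrix_mul_assoc)
  show "RR (M ** (mat_pow g7 i ** g2)) tau3' < 0"
    using assms FRE_mult1(2)[of tau3' g2 "M ** mat_pow g7 i"] tau3'_s(1)
    by (simp add: leav_def det_g2 tau3'_def g2_g2 matrix_mul_assoc)
qed

lemma leav_height: assumes "leav M i" shows "EE (M ** (mat_pow g7 i ** g2)) tau7 < EE M tau7"
proof -
  define N where "N = M ** (mat_pow g7 i ** g2)"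
  have "EE N tau7 < EE (N ** g2) tau7" unfolding N_def by (rule red_height[OF leav_red[OF assms]])
  also have "EE (N ** g2) tau7 = EE N (moebius g2 tau7)" by (rule FRE_mult1) (simp_all add: det_g2)
  also have "\<dots> = EE (M ** mat_pow g7 i) (moebius g2 (moebius g2 tau7))"
    unfolding N_def matrix_mul_assoc by (rule FRE_mult1) (simp_all add: det_g2 moebius_Im_pos)
  also have "\<dots> = EE M tau7" by (simp add: g2_g2 EE_g7_pow)
  finally show ?thesis unfolding N_def .
qed

section \<open>Rotations about the centre of the heptagon\<close>

lemma pi_7: "lam / 2 = cos (pi / 7)" "sqrt (4 - lam\<^sup>2) / 2 = sin (pi / 7)"
proof -
  have c: "cos (pi / 7) > 0" by (rule cos_gt_zero) (use pi_gt_zero in simp_all)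
  have "eta = 2 * (2 * (cos (pi / 7))\<^sup>2 - 1)"
    unfolding eta_def using cos_double_cos[of "pi / 7"] by simp
  then have e: "lam\<^sup>2 = (2 * cos (pi / 7))\<^sup>2" unfolding lam_sq by (simp add: power_mult_distrib)
  have "lam = 2 * cos (pi / 7)" by (rule power2_eq_imp_eq[OF e]) (use c lam_pos in simp_all)
  then show "lam / 2 = cos (pi / 7)" by simp
  have "4 - lam\<^sup>2 = (2 * sin (pi / 7))\<^sup>2" unfolding e by (simp add: power_mult_distrib sin_squared_eq)
  moreover have "sin (pi / 7) > 0" by (rule sin_gt_zero) (use pi_gt_zero in simp_all)
  ultimately have "sqrt (4 - lam\<^sup>2) = 2 * sin (pi / 7)" by (simp only: real_sqrt_abs)
  then show "sqrt (4 - lam\<^sup>2) / 2 = sin (pi / 7)" by simp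
qed

text \<open>The one-parameter group exp (x J) for \<open>J = JJ tau7\<close>, that is, the rotation
  by the angle 2 x about \<open>tau7\<close>.\<close>

definition rot7 :: "real \<Rightarrow> mat2" where
  "rot7 x = mat (cos x) + sin x *\<^sub>R JJ tau7"

lemma rot7_nth [simp]: "rot7 x $1$1 = cos x" "rot7 x $1$2 = - sin x * s1 tau7"
  "rot7 x $2$1 = sin x * s3 tau7" "rot7 x $2$2 = cos x"
  by (simp_all add: rot7_def JJ_def tau7_s)

lemma rot7_add: "rot7 x ** rot7 y = rot7 (x + y)"
proof -
  have "sin x * s1 tau7 * (sin y * s3 tau7) = sin x * sin y" "sin x * s3 tau7 * (sin y * s1 tau7) = sin x * sin y"
    using tau7_s(3) by algebra+
  then show ?thesis by (simp add: mat2_eq_iff cos_add sin_add algebra_simps)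
qed

lemma rot7_g7: "g7 = rot7 (pi / 7)"
proof -
  note p = tau7_props(3-5)[unfolded g7_trace(1)]
  define t where "t = sqrt (4 - lam\<^sup>2)"
  have t: "t > 0" unfolding t_def lam_sq using eta_bounds by simp
  show ?thesis
    using p g7_trace t unfolding t_def[symmetric]
    by (simp add: mat2_eq_iff pi_7[symmetric] t_def[symmetric] field_simps)
qed

lemma rot7_pow: "mat_pow g7 n = rot7 (real n * (pi / 7))"
proof (induction n)
  case 0 show ?case by (simp add: mat2_eq_iff)
next
  case (Suc n)
  have "mat_pow g7 (Suc n) = rot7 (pi / 7) ** rot7 (real n * (pi / 7))" using Suc rot7_g7 by simp
  also have "\<dots> = rot7 (pi / 7 + real n * (pi / 7))" by (rule rot7_add)
  also have "pi / 7 + real n * (pi / 7) = real (Suc n) * (pi / 7)" by (simp add: field_simps)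
  finally show ?case .
qed

lemma g7_7: "mat_pow g7 7 = - mat 1"
  unfolding rot7_pow by (simp add: mat2_eq_iff)

text \<open>The law of cosines in the isosceles triangle with apex \<open>tau7\<close>, apex angle 2
  x and legs of hyperbolic cosine \<open>C0\<close>.\<close>

lemma CC_rot7: "CC tau3 (moebius (rot7 x) tau3) = 1 + 2 * (sin x)\<^sup>2 * (C0\<^sup>2 - 1)"
proof -
  define p q where pq: "p = cos x" "q = sin x"
  have pq1: "p\<^sup>2 + q\<^sup>2 = 1" by (simp add: pq)
  define S1 S3 where S: "S1 = s1 tau7" "S3 = s3 tau7"
  have S1: "S1 * S3 = 1" using tau7_s by (simp add: S)
  define z1 z2 z3 where z: "z1 = s1 tau3" "z2 = s2 tau3" "z3 = s3 tau3"
  have z1: "z1 * z3 - z2\<^sup>2 = 1" using s_norm[of tau3] by (simp add: z)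
  have C: "2 * C0 = z1 * S3 + z3 * S1" by (simp add: C0_def CC_def z S tau7_s)
  have d: "det (rot7 x) = 1"
  proof -
    have "det (rot7 x) = p\<^sup>2 + q\<^sup>2 * (S1 * S3)" by (simp add: det_2 pq S power2_eq_square algebra_simps)
    then show ?thesis using S1 pq1 by simp
  qed
  have F: "FF (rot7 x) tau3 = p\<^sup>2 * z1 - 2 * p * q * S1 * z2 + q\<^sup>2 * S1\<^sup>2 * z3"
    "RR (rot7 x) tau3 = p * q * S3 * z1 + (p\<^sup>2 - q\<^sup>2 * S1 * S3) * z2 - p * q * S1 * z3"
    "EE (rot7 x) tau3 = q\<^sup>2 * S3\<^sup>2 * z1 + 2 * p * q * S3 * z2 + p\<^sup>2 * z3"
    by (simp_all add: FF_def RR_def EE_def pq S z power2_eq_square algebra_simps)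
  have "2 * CC tau3 (moebius (rot7 x) tau3) = z1 * EE (rot7 x) tau3 + z3 * FF (rot7 x) tau3 - 2 * z2 * RR (rot7 x) tau3"
    unfolding CC_def using moebius_s[of tau3 "rot7 x"] d by (simp add: z)
  also have "\<dots> = 2 * (1 + 2 * q\<^sup>2 * (C0\<^sup>2 - 1))"
  proof -
    have "z1 * EE (rot7 x) tau3 + z3 * FF (rot7 x) tau3 - 2 * z2 * RR (rot7 x) tau3
      = 2 * p\<^sup>2 * (z1 * z3 - z2\<^sup>2) + q\<^sup>2 * (S3\<^sup>2 * z1\<^sup>2 + S1\<^sup>2 * z3\<^sup>2 + 2 * (S1 * S3) * z2\<^sup>2)"
      unfolding F by algebra
    also have "\<dots> = 2 * (1 - q\<^sup>2) + q\<^sup>2 * (S3\<^sup>2 * z1\<^sup>2 + S1\<^sup>2 * z3\<^sup>2 + 2 * z2\<^sup>2)"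
      unfolding z1 S1 using pq1 by simp
    also have "S3\<^sup>2 * z1\<^sup>2 + S1\<^sup>2 * z3\<^sup>2 + 2 * z2\<^sup>2 = (2 * C0)\<^sup>2 - 2"
      unfolding C using z1 S1 by algebra
    finally show ?thesis by (simp add: power_mult_distrib algebra_simps)
  qed
  finally show ?thesis by (simp add: pq)
qed

text \<open>A matrix fixing \<open>tau7\<close> commutes with \<open>JJ tau7\<close> and is
  therefore some \<open>rot7 x\<close>. A small rotation in the group would move \<open>tau3\<close>
  so little that \<open>g3\<close> times its conjugate has trace close to -1 but different from
  it.\<close>

lemma stab_tau7:
  assumes X: "X \<in> Delta237" "moebius X tau7 = tau7"
  obtains k where "X = mat_pow g7 k \<or> X = - mat_pow g7 k"
proof -
  define S1 S3 where S: "S1 = s1 tau7" "S3 = s3 tau7"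
  have S1: "S1 * S3 = 1" and Sp: "S3 > 0" "S1 > 0" using tau7_s by (simp_all add: S)
  have dX: "det X = 1" by (rule Delta237_det[OF X(1)])
  have "X ** JJ tau7 ** adj2 X = JJ tau7" using JJ_moebius[OF _ dX, of tau7] X(2) by simp
  then have "X ** JJ tau7 ** (adj2 X ** X) = JJ tau7 ** X" by (metis matrix_mul_assoc)
  then have com: "X ** JJ tau7 = JJ tau7 ** X" by (simp add: adj2_mult[OF dX])
  have "(X ** JJ tau7)$1$1 = (JJ tau7 ** X)$1$1" "(X ** JJ tau7)$1$2 = (JJ tau7 ** X)$1$2"
    unfolding com by (rule refl)+
  then have "X$1$2 * S3 = - (S1 * X$2$1)" "X$1$1 * S1 = S1 * X$2$2"
    by (simp_all add: JJ_def tau7_s(1) S)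
  then have c1: "X$1$2 * S3 = - (S1 * X$2$1)" "X$1$1 = X$2$2" using Sp by simp_all
  define p q where pq: "p = X$1$1" "q = X$2$1 * S1"
  have q3: "q * S3 = X$2$1" "X$1$2 = - (q * S1)"
  proof -
    show "q * S3 = X$2$1" using S1 by (simp add: pq mult.assoc)
    have "X$1$2 = X$1$2 * S3 * S1" using S1 by (simp add: mult.assoc mult.commute[of S3])
    then show "X$1$2 = - (q * S1)" unfolding c1 by (simp add: pq)
  qed
  have "p\<^sup>2 + q\<^sup>2 = 1"
  proof -
    have "p\<^sup>2 + q\<^sup>2 * (S1 * S3) = det X" unfolding det_2 q3(1)[symmetric] q3(2) c1(2)[symmetric] pq(1)[symmetric] by algebra
    then show ?thesis using S1 dX by simp
  qed
  then obtain x where x: "0 \<le> x" "x < 2 * pi" "p = cos x" "q = sin x"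
    using sincos_total_2pi by blast
  have Xr: "X = rot7 x"
    using q3 c1 pq by (simp add: mat2_eq_iff x(3,4)[symmetric] S[symmetric])
  \<comment> \<open>Dividing by the nearest power of \<open>g7\<close> leaves an angle
    \<open>y\<close> of size at most pi / 14; then \<open>3 * (sin y)^2 * (C0^2 - 1)\<close> stays
    below 1/9.\<close>
  define k where "k = nat \<lfloor>7 * x / pi + 1/2\<rfloor>"
  define y where "y = x - real k * (pi / 7)"
  have "real k = of_int \<lfloor>7 * x / pi + 1/2\<rfloor>" unfolding k_def using x by simp
  then have "\<bar>7 * x / pi - real k\<bar> \<le> 1/2" by linarith
  moreover have "y = (7 * x / pi - real k) * (pi / 7)" by (simp add: y_def field_simps)
  ultimately have "\<bar>y\<bar> \<le> 1/2 * (pi / 7)" by (simp add: abs_mult del: times_divide_eq_left times_divide_eq_right)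
  moreover have "pi < 3.15" using pi_less_4 pi_approx by simp
  ultimately have yb: "\<bar>y\<bar> \<le> 0.225" by simp
  define Y where "Y = rot7 y"
  have XY: "X = mat_pow g7 k ** Y" unfolding Xr Y_def rot7_pow rot7_add by (simp add: y_def)
  have "Y = adj2 (mat_pow g7 k) ** X"
    unfolding XY matrix_mul_assoc by (simp add: adj2_mult det_mat_pow det_g7)
  then have YD: "Y \<in> Delta237" by (simp add: Delta237_mult Delta237_adj mat_pow_Delta237 g7_Delta X)
  define T where "T = g3 ** (Y ** g3 ** adj2 Y)"
  have TD: "T \<in> Delta237" unfolding T_def by (intro Delta237_mult Delta237_adj g3_Delta YD)
  have "T$1$1 + T$2$2 = 1/2 - 3/2 * CC tau3 (moebius Y tau3)"
    using elliptic_trace[OF det_g3 g3_elliptic det_g3 g3_elliptic Delta237_det[OF YD]]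
    by (simp add: g3_trace tau3_def[symmetric] T_def)
  then have T: "T$1$1 + T$2$2 = - 1 - 3 * ((sin y)\<^sup>2 * (C0\<^sup>2 - 1))"
    unfolding Y_def CC_rot7 by (simp add: algebra_simps)
  have "\<bar>sin y\<bar> \<le> 0.225" using abs_sin_x_le_abs_x[of y] yb by simp
  then have "(sin y)\<^sup>2 \<le> 0.225\<^sup>2" using abs_le_square_iff[of "sin y" "0.225"] by simp
  then have s: "(sin y)\<^sup>2 \<le> 0.051" by (simp add: power2_eq_square)
  have C: "C0\<^sup>2 - 1 > 0.4" "C0\<^sup>2 - 1 < 0.5"
    unfolding C0_sq using eta_bounds by (simp_all add: field_simps)
  have "(sin y)\<^sup>2 * (C0\<^sup>2 - 1) \<le> 0.051 * 0.5" using s C by (intro mult_mono) auto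
  moreover have "(sin y)\<^sup>2 * (C0\<^sup>2 - 1) \<ge> 0" using C by simp
  ultimately have "\<bar>T$1$1 + T$2$2 + 1\<bar> < 1/9" unfolding T by simp
  from Delta237_trace_gap1[OF TD this] have "(sin y)\<^sup>2 * (C0\<^sup>2 - 1) = 0" unfolding T by simp
  then have s0: "sin y = 0" using C by simp
  then have "cos y = 1 \<or> cos y = -1" using sin_cos_squared_add[of y] by (simp add: power2_eq_1_iff)
  then have "Y = mat 1 \<or> Y = - mat 1" using s0 by (auto simp: Y_def mat2_eq_iff)
  then have "X = mat_pow g7 k \<or> X = - mat_pow g7 k" unfolding XY by (auto simp: mat2_eq_iff)
  then show ?thesis using that by blast
qed

lemma RR_minus: "RR (- M) \<tau> = RR M \<tau>" by (simp add: RR_def)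
lemma det_minus2: "det (- (M::mat2)) = det M" by (simp add: det_2)
lemma mult_minus_right2: "(A::mat2) ** (- (B::mat2)) = - (A ** B)" by (simp add: mat2_eq_iff)
lemma mult_minus_left2: "(- A::mat2) ** (B::mat2) = - (A ** B)" by (simp add: mat2_eq_iff)

lemma red_stab:
  assumes "red M" "red (M ** X)" "X \<in> Delta237" "moebius X tau7 = tau7"
  shows "X = mat 1 \<or> X = - mat 1"
proof -
  obtain k where k: "X = mat_pow g7 k \<or> X = - mat_pow g7 k" using stab_tau7[OF assms(3,4)] by blast
  have pm: "mat_pow g7 (7 * n) = mat 1 \<or> mat_pow g7 (7 * n) = - mat 1" for n
  proof (induction n)
    case (Suc n)
    have "mat_pow g7 (7 * Suc n) = - mat_pow g7 (7 * n)"
      using mat_pow_add[of g7 7 "7 * n"] by (simp add: g7_7 mult_minus_left2)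
    then show ?case using Suc by auto
  qed simp
  have "mat_pow g7 k = mat_pow g7 (k mod 7) ** mat_pow g7 (7 * (k div 7))"
    unfolding mat_pow_add[symmetric] by simp
  then have "mat_pow g7 k = mat_pow g7 (k mod 7) \<or> mat_pow g7 k = - mat_pow g7 (k mod 7)"
    using pm[of "k div 7"] by (auto simp: mult_minus_right2)
  with k have k': "X = mat_pow g7 (k mod 7) \<or> X = - mat_pow g7 (k mod 7)" by auto
  then have "red (M ** mat_pow g7 (k mod 7))"
    using assms(2) by (auto simp: red_def RR_minus det_minus2 mult_minus_right2)
  from red_g7_pow[OF assms(1) this] have "k mod 7 = 0" by simp
  with k' show ?thesis by simp
qed

section \<open>Reduced translates of a geodesic\<close>

lemma FF_pos: assumes "Im \<tau> > 0" "det M \<noteq> 0" shows "FF M \<tau> > 0"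
proof -
  have "FF M \<tau> * EE M \<tau> = (RR M \<tau>)\<^sup>2 + (det M)\<^sup>2" using FF_EE_RR[OF assms(1), of M] by simp
  also have "\<dots> > 0" using assms(2) by (simp add: add_nonneg_pos)
  finally show ?thesis using EE_pos[OF assms] by (rule zero_less_mult_pos2)
qed

lemma moebius_adj2: assumes "Im \<tau> > 0" "det X = 1"
  shows "moebius (adj2 X) (moebius X \<tau>) = \<tau>" "moebius X (moebius (adj2 X) \<tau>) = \<tau>"
  using moebius_mult[of \<tau> "adj2 X" X] moebius_mult[of \<tau> X "adj2 X"] assms by (simp_all add: adj2_mult)

lemma CC_shift:
  assumes "Im p > 0" "Im q > 0" "det X = 1" "det Y = 1"
  shows "CC (moebius X p) (moebius Y q) = CC p (moebius (adj2 X ** Y) q)"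
proof -
  have "CC (moebius X p) (moebius Y q) = CC (moebius (adj2 X) (moebius X p)) (moebius (adj2 X) (moebius Y q))"
    by (rule CC_moebius[symmetric]) (simp_all add: assms moebius_Im_pos)
  also have "\<dots> = CC p (moebius (adj2 X ** Y) q)"
    using assms by (simp add: moebius_adj2 moebius_mult)
  finally show ?thesis .
qed

lemma centre_vertex2:
  assumes "X \<in> Delta237" "Y \<in> Delta237"
  shows "CC (moebius X tau3) (moebius Y tau7) \<ge> C0" "CC (moebius X tau3') (moebius Y tau7) \<ge> C0"
proof -
  have *: "CC (moebius Z tau3) (moebius Y tau7) \<ge> C0" if "Z \<in> Delta237" for Z
    using centre_vertex[of "adj2 Z ** Y"] that assms
    by (simp add: CC_shift Delta237_det Delta237_mult Delta237_adj)
  show "CC (moebius X tau3) (moebius Y tau7) \<ge> C0" by (rule *[OF assms(1)])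
  have "moebius X tau3' = moebius (X ** g2) tau3"
    unfolding tau3'_def by (simp add: moebius_mult Delta237_det[OF assms(1)] det_g2)
  then show "CC (moebius X tau3') (moebius Y tau7) \<ge> C0"
    using *[of "X ** g2"] assms g2_Delta by (simp add: Delta237_mult)
qed

lemma CC_tau:
  "CC tau3 tau7 = C0" "CC tau3' tau7 = C0" "CC tau3 (moebius g2 tau7) = C0" "CC tau3' (moebius g2 tau7) = C0"
proof -
  show 1: "CC tau3 tau7 = C0" by (simp add: C0_def)
  have "CC (moebius g7 tau3) (moebius g7 tau7) = C0" using 1 by (simp add: CC_moebius det_g7)
  then show 2: "CC tau3' tau7 = C0" unfolding tau3'_g7[symmetric] tau7_props(2) .
  have "CC (moebius g2 tau3') (moebius g2 tau7) = C0" using 2 tau3'_s(1) by (simp add: CC_moebius det_g2)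
  then show "CC tau3 (moebius g2 tau7) = C0" by (simp add: tau3'_def g2_g2)
  have "CC (moebius g2 tau3) (moebius g2 tau7) = C0" using 1 by (simp add: CC_moebius det_g2)
  then show "CC tau3' (moebius g2 tau7) = C0" by (simp add: tau3'_def)
qed

text \<open>Two circles of equal radius around the ends of the edge meet in only two points, on its
  perpendicular bisector.\<close>

lemma two_centres:
  assumes q: "Im q > 0" "CC tau3 q = C0" "CC tau3' q = C0"
  shows "q = tau7 \<or> q = moebius g2 tau7"
proof -
  have "CC tau3' q - CC tau3 q = 2 * s2 tau3 * s2 q" by (simp add: CC_def tau3'_s field_simps)
  then have s2: "s2 q = 0" using q tau3_s by simp
  have n: "s1 q * s3 q = 1" using s_norm[OF q(1)] s2 by simp
  have "CC tau3 q - CC tau3 tau7 = s3 tau3 * (eta * s3 q + s1 q - (eta * s3 tau7 + s1 tau7)) / 2"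
    unfolding CC_def s2 tau7_s(1) tau3_s(1) by (simp add: field_simps)
  then have "eta * s3 q + s1 q = eta * s3 tau7 + s1 tau7" using q tau3_s by (simp add: C0_def)
  \<comment> \<open>On the bisector \<open>s1\<close> and \<open>s3\<close> are reciprocal, so a
    prescribed value of \<open>eta * s3 + s1\<close> is a quadratic equation for \<open>s3\<close>,
    here in factored form.\<close>
  then have "(s3 q - s3 tau7) * (eta * s3 q - s1 tau7) = 0"
    using n tau7_s(3) by algebra
  then have "s3 q - s3 tau7 = 0 \<or> eta * s3 q - s1 tau7 = 0" by (simp only: mult_eq_0_iff)
  then consider "s3 q = s3 tau7" | "s3 q = s1 tau7 / eta" by (auto simp: field_simps)
  then show ?thesis
  proof cases
    case 1
    have "q = tau7" by (rule s_eqI) (use 1 s2 q tau7_s in auto)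
    then show ?thesis ..
  next
    case 2
    have "q = moebius g2 tau7" by (rule s_eqI) (use 2 s2 q in \<open>auto simp: g2_s tau7_s moebius_Im_pos det_g2\<close>)
    then show ?thesis ..
  qed
qed

lemma two_centres_moebius:
  assumes "det X = 1" "Im q > 0" "CC (moebius X tau3) q = C0" "CC (moebius X tau3') q = C0"
  shows "q = moebius X tau7 \<or> q = moebius X (moebius g2 tau7)"
proof -
  define p where "p = moebius (adj2 X) q"
  have p: "Im p > 0" "moebius X p = q" unfolding p_def using assms by (simp_all add: moebius_Im_pos moebius_adj2)
  have "CC tau3 p = C0" "CC tau3' p = C0"
    using assms(3,4) unfolding p(2)[symmetric] using p(1) assms(1) tau3'_s(1) by (simp_all add: CC_moebius)
  from two_centres[OF p(1) this] p(2) show ?thesis by auto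
qed

section \<open>The lower envelope of the distances along a geodesic\<close>

lemma CC_frame:
  "FF M p * EE M q + EE M p * FF M q - 2 * RR M p * RR M q = 2 * (det M)\<^sup>2 * CC p q"
proof -
  have "FF M p * EE M q + EE M p * FF M q - 2 * RR M p * RR M q
      = (det M)\<^sup>2 * (s1 p * s3 q + s3 p * s1 q - 2 * s2 p * s2 q)"
    unfolding FF_def EE_def RR_def det_2 by algebra
  then show ?thesis unfolding CC_def by simp
qed

text \<open>Where the geodesic with frame \<open>M\<close> crosses the segment between the vertices \<open>v0\<close> and \<open>v1\<close>,
  the distance to \<open>q\<close> is governed by the affine function \<open>F * EE M q + E * FF M q\<close>.\<close>
lemma envelope:
  assumes M: "det M > 0" and v: "Im v0 > 0" "Im v1 > 0" and opp: "RR M v0 * RR M v1 < 0"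
  obtains F E where "F > 0" "E > 0"
    "\<And>q q0. CC v0 q \<ge> C0 \<Longrightarrow> CC v1 q \<ge> C0 \<Longrightarrow> CC v0 q0 = C0 \<Longrightarrow> CC v1 q0 = C0 \<Longrightarrow>
       F * EE M q0 + E * FF M q0 \<le> F * EE M q + E * FF M q"
    "\<And>q q0. CC v0 q \<ge> C0 \<Longrightarrow> CC v1 q \<ge> C0 \<Longrightarrow> CC v0 q0 = C0 \<Longrightarrow> CC v1 q0 = C0 \<Longrightarrow>
       F * EE M q0 + E * FF M q0 = F * EE M q + E * FF M q \<Longrightarrow> CC v0 q = C0 \<and> CC v1 q = C0"
proof -
  \<comment> \<open>With these weights the \<open>RR\<close> terms cancel: the weighted sum of the
    vertices is, up to scaling, the point where the geodesic crosses the segment.\<close>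
  define l0 l1 where l: "l0 = \<bar>RR M v1\<bar>" "l1 = \<bar>RR M v0\<bar>"
  have lp: "l0 > 0" "l1 > 0" using opp by (auto simp: l)
  have lz: "l0 * RR M v0 + l1 * RR M v1 = 0"
    using opp by (auto simp: l abs_if mult_less_0_iff)
  define F E where FE: "F = l0 * FF M v0 + l1 * FF M v1" "E = l0 * EE M v0 + l1 * EE M v1"
  have d: "det M \<noteq> 0" using M by simp
  have p: "F > 0" "E > 0" unfolding FE using lp v d by (simp_all add: FF_pos EE_pos add_pos_pos)
  have val: "F * EE M q + E * FF M q = 2 * (det M)\<^sup>2 * (l0 * CC v0 q + l1 * CC v1 q)" for q
  proof -
    have "F * EE M q + E * FF M q = l0 * (FF M v0 * EE M q + EE M v0 * FF M q - 2 * RR M v0 * RR M q)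
       + l1 * (FF M v1 * EE M q + EE M v1 * FF M q - 2 * RR M v1 * RR M q)"
      unfolding FE using lz by algebra
    then show ?thesis unfolding CC_frame by (simp add: algebra_simps)
  qed
  define k where "k = 2 * (det M)\<^sup>2"
  have kp: "k > 0" using d by (simp add: k_def)
  show ?thesis
  proof (rule that[OF p])
    fix q q0 assume q: "CC v0 q \<ge> C0" "CC v1 q \<ge> C0" "CC v0 q0 = C0" "CC v1 q0 = C0"
    have le: "l0 * C0 \<le> l0 * CC v0 q" "l1 * C0 \<le> l1 * CC v1 q" using lp q by simp_all
    show "F * EE M q0 + E * FF M q0 \<le> F * EE M q + E * FF M q"
      unfolding val k_def[symmetric] q(3,4) using le kp by (intro mult_left_mono) simp_all
    assume "F * EE M q0 + E * FF M q0 = F * EE M q + E * FF M q"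
    then have "l0 * C0 + l1 * C0 = l0 * CC v0 q + l1 * CC v1 q"
      unfolding val k_def[symmetric] q(3,4) using kp by simp
    then have "l0 * C0 = l0 * CC v0 q" "l1 * C0 = l1 * CC v1 q" using le by linarith+
    then show "CC v0 q = C0 \<and> CC v1 q = C0" using lp by simp
  qed
qed

lemma RR_moebius: "Im \<tau> > 0 \<Longrightarrow> det X = 1 \<Longrightarrow> RR M (moebius X \<tau>) = RR (M ** X) \<tau>"
  "Im \<tau> > 0 \<Longrightarrow> det X = 1 \<Longrightarrow> EE M (moebius X \<tau>) = EE (M ** X) \<tau>"
  by (simp_all add: FRE_mult1)

text \<open>\<open>D\<close> and \<open>A\<close> are the centres on both sides of the exit edge. By
  \<open>envelope\<close> they are nearest to the exit crossing, while \<open>B\<close> is nearest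
  to the point where the geodesic enters its own tile. If \<open>EE\<close> of \<open>B\<close> lay
  strictly between, comparison with \<open>D\<close> and with \<open>A\<close> would bound the ratio
  of \<open>F'\<close> and \<open>E'\<close> by that of \<open>F\<close> and \<open>E\<close> from
  both sides. So both crossings would coincide, and \<open>B\<close> would be one of the only two
  nearest centres, \<open>A\<close> or \<open>D\<close>. For equal \<open>EE\<close>, the entry
  crossings of \<open>D\<close> and \<open>B\<close> give the two opposite inequalities for
  \<open>FF\<close>.\<close>

lemma fundamental_strict:
  assumes M: "det M > 0" and X: "X \<in> Delta237" and Y: "Y \<in> Delta237"
    and redM: "RR M tau3 > 0" "RR M tau3' < 0"
    and leavM: "RR M (moebius X tau3) < 0" "RR M (moebius X tau3') > 0" and X7: "moebius X tau7 = tau7"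
    and redY: "RR M (moebius Y tau3) > 0" "RR M (moebius Y tau3') < 0"
  defines "D \<equiv> tau7" and "A \<equiv> moebius X (moebius g2 tau7)" and "B \<equiv> moebius Y tau7"
  shows "\<not> (EE M A < EE M B \<and> EE M B < EE M D)"
    "EE M B = EE M D \<Longrightarrow> B = D \<or> B = moebius g2 tau7"
proof -
  have dX: "det X = 1" and dY: "det Y = 1" using X Y by (simp_all add: Delta237_det)
  have iX: "Im (moebius X tau3) > 0" "Im (moebius X tau3') > 0" "Im (moebius Y tau3) > 0" "Im (moebius Y tau3') > 0"
    using dX dY tau3'_s(1) by (simp_all add: moebius_Im_pos)
  have iB: "Im B > 0" unfolding B_def using dY by (simp add: moebius_Im_pos)
  have B1: "CC tau3 B \<ge> C0" "CC tau3' B \<ge> C0"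
    using centre_vertex2[OF Delta237_1 Y] unfolding B_def by simp_all
  have BX: "CC (moebius X tau3) B \<ge> C0" "CC (moebius X tau3') B \<ge> C0"
    unfolding B_def using centre_vertex2[OF X Y] .
  have DX: "CC (moebius X tau3) D = C0" "CC (moebius X tau3') D = C0"
  proof -
    have "CC (moebius X tau3) (moebius X tau7) = C0" "CC (moebius X tau3') (moebius X tau7) = C0"
      using dX tau3'_s(1) by (simp_all add: CC_moebius CC_tau)
    then show "CC (moebius X tau3) D = C0" "CC (moebius X tau3') D = C0" unfolding X7 D_def .
  qed
  have AX: "CC (moebius X tau3) A = C0" "CC (moebius X tau3') A = C0"
    unfolding A_def using dX tau3'_s(1) by (simp_all add: CC_moebius CC_tau moebius_Im_pos det_g2)
  have A_Delta: "A = moebius (X ** g2) tau7" unfolding A_def using dX by (simp add: moebius_mult det_g2)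
  have YD: "CC (moebius Y tau3) D \<ge> C0" "CC (moebius Y tau3') D \<ge> C0"
    using centre_vertex2[OF Y Delta237_1] unfolding D_def by simp_all
  have YA: "CC (moebius Y tau3) A \<ge> C0" "CC (moebius Y tau3') A \<ge> C0"
    unfolding A_Delta using centre_vertex2[OF Y Delta237_mult[OF X g2_Delta]] .
  have YB: "CC (moebius Y tau3) B = C0" "CC (moebius Y tau3') B = C0"
    unfolding B_def using dY tau3'_s(1) by (simp_all add: CC_moebius CC_tau)
  obtain F E where FE: "F > 0" "E > 0" and
    env: "\<And>q q0. CC (moebius X tau3) q \<ge> C0 \<Longrightarrow> CC (moebius X tau3') q \<ge> C0 \<Longrightarrow> CC (moebius X tau3) q0 = C0 \<Longrightarrow> CC (moebius X tau3') q0 = C0 \<Longrightarrow>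
       F * EE M q0 + E * FF M q0 \<le> F * EE M q + E * FF M q"
    "\<And>q q0. CC (moebius X tau3) q \<ge> C0 \<Longrightarrow> CC (moebius X tau3') q \<ge> C0 \<Longrightarrow> CC (moebius X tau3) q0 = C0 \<Longrightarrow> CC (moebius X tau3') q0 = C0 \<Longrightarrow>
       F * EE M q0 + E * FF M q0 = F * EE M q + E * FF M q \<Longrightarrow> CC (moebius X tau3) q = C0 \<and> CC (moebius X tau3') q = C0"
    using envelope[OF M iX(1,2)] mult_neg_pos[OF leavM] by metis
  obtain F' E' where FE': "F' > 0" "E' > 0" and
    env': "\<And>q q0. CC (moebius Y tau3) q \<ge> C0 \<Longrightarrow> CC (moebius Y tau3') q \<ge> C0 \<Longrightarrow> CC (moebius Y tau3) q0 = C0 \<Longrightarrow> CC (moebius Y tau3') q0 = C0 \<Longrightarrow>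
       F' * EE M q0 + E' * FF M q0 \<le> F' * EE M q + E' * FF M q"
    using envelope[OF M iX(3,4)] mult_pos_neg[OF redY] by metis
  obtain F1 E1 where FE1: "F1 > 0" "E1 > 0" and
    env1: "\<And>q q0. CC tau3 q \<ge> C0 \<Longrightarrow> CC tau3' q \<ge> C0 \<Longrightarrow> CC tau3 q0 = C0 \<Longrightarrow> CC tau3' q0 = C0 \<Longrightarrow>
       F1 * EE M q0 + E1 * FF M q0 \<le> F1 * EE M q + E1 * FF M q"
    "\<And>q q0. CC tau3 q \<ge> C0 \<Longrightarrow> CC tau3' q \<ge> C0 \<Longrightarrow> CC tau3 q0 = C0 \<Longrightarrow> CC tau3' q0 = C0 \<Longrightarrow>
       F1 * EE M q0 + E1 * FF M q0 = F1 * EE M q + E1 * FF M q \<Longrightarrow> CC tau3 q = C0 \<and> CC tau3' q = C0"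
    using envelope[OF M tau_Im(1) tau3'_s(1)] mult_pos_neg[OF redM] by metis
  define a b d a' b' d' where e: "a = EE M A" "b = EE M B" "d = EE M D" "a' = FF M A" "b' = FF M B" "d' = FF M D"
  have 1: "F * d + E * d' \<le> F * b + E * b'" unfolding e by (rule env(1)[OF BX DX])
  have 2: "F * a + E * a' \<le> F * b + E * b'" unfolding e by (rule env(1)[OF BX AX])
  have 3: "F' * b + E' * b' \<le> F' * d + E' * d'" unfolding e by (rule env'[OF YD YB])
  have 4: "F' * b + E' * b' \<le> F' * a + E' * a'" unfolding e by (rule env'[OF YA YB])
  show "\<not> (EE M A < EE M B \<and> EE M B < EE M D)"
  proof
    assume "EE M A < EE M B \<and> EE M B < EE M D"
    then have o: "a < b" "b < d" by (simp_all add: e)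
    have "E' * (F * (d - b)) \<le> E' * (E * (b' - d'))" using 1 FE' by (intro mult_left_mono) (simp_all add: algebra_simps)
    moreover have "E * (E' * (b' - d')) \<le> E * (F' * (d - b))" using 3 FE by (intro mult_left_mono) (simp_all add: algebra_simps)
    ultimately have "(E' * F) * (d - b) \<le> (E * F') * (d - b)" by (simp add: mult_ac)
    then have l1: "E' * F \<le> E * F'" using o by simp
    have "E * (F' * (b - a)) \<le> E * (E' * (a' - b'))" using 4 FE by (intro mult_left_mono) (simp_all add: algebra_simps)
    moreover have "E' * (E * (a' - b')) \<le> E' * (F * (b - a))" using 2 FE' by (intro mult_left_mono) (simp_all add: algebra_simps)
    ultimately have "(E * F') * (b - a) \<le> (E' * F) * (b - a)" by (simp add: mult_ac)
    then have l2: "E * F' \<le> E' * F" using o by simp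
    \<comment> \<open>Equal ratios: both crossings are the same point of the geodesic.\<close>
    have eq: "E' * F = E * F'" using l1 l2 by simp
    have "E' * (F * b + E * b') = E * (F' * b + E' * b')" using eq by algebra
    also have "\<dots> \<le> E * (F' * d + E' * d')" using 3 FE by (intro mult_left_mono) simp_all
    also have "\<dots> = E' * (F * d + E * d')" using eq by algebra
    finally have "F * b + E * b' \<le> F * d + E * d'" using FE' by simp
    with 1 have "F * d + E * d' = F * b + E * b'" by simp
    then have "CC (moebius X tau3) B = C0 \<and> CC (moebius X tau3') B = C0"
      unfolding e by (rule env(2)[OF BX DX])
    then have "B = moebius X tau7 \<or> B = A"
      unfolding A_def using two_centres_moebius[OF dX iB] by blast
    then have "b = d \<or> b = a" unfolding X7 by (auto simp: e D_def)
    then show False using o by simp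
  qed
  assume "EE M B = EE M D"
  then have bd: "b = d" by (simp add: e)
  have CD: "CC tau3 D = C0" "CC tau3' D = C0" unfolding D_def by (simp_all add: CC_tau)
  have "F1 * d + E1 * d' \<le> F1 * b + E1 * b'" unfolding e by (rule env1(1)[OF B1 CD])
  then have "d' \<le> b'" using bd FE1 by simp
  moreover have "b' \<le> d'" using 3 bd FE' by simp
  ultimately have "F1 * d + E1 * d' = F1 * b + E1 * b'" using bd by simp
  then have "CC tau3 B = C0 \<and> CC tau3' B = C0" unfolding e by (rule env1(2)[OF B1 CD])
  then show "B = D \<or> B = moebius g2 tau7" unfolding D_def using two_centres[OF iB] by blast
qed

text \<open>Pushing the geodesic slightly to the left while keeping its second endpoint makes all
  crossings with the edges transversal at interior points and does not change \<open>EE\<close>.\<close>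
lemma fundamental:
  assumes redM: "red M" and lv: "leav M i" and Y: "Y \<in> Delta237" and redY: "red (M ** Y)"
  shows "\<not> (EE (M ** (mat_pow g7 i ** g2)) tau7 < EE (M ** Y) tau7 \<and> EE (M ** Y) tau7 < EE M tau7)"
    "EE (M ** Y) tau7 = EE M tau7 \<Longrightarrow> Y = mat 1 \<or> Y = - mat 1"
proof -
  define X where "X = mat_pow g7 i"
  have XD: "X \<in> Delta237" unfolding X_def by (rule mat_pow_Delta237[OF g7_Delta])
  have d: "det X = 1" "det Y = 1" using XD Y by (simp_all add: Delta237_det)
  have M: "det M > 0" using redM by (simp add: red_def)
  have I: "Im tau3 > 0" "Im tau3' > 0" "Im tau7 > 0" using tau3'_s by simp_all
  define f where "f v = - RR M v / EE M v" for v
  \<comment> \<open>\<open>f v\<close> is the shift that would make a strictly negative sign vanish;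
    half of the least of the three keeps all of them negative.\<close>
  define \<mu> where "\<mu> = Min (f ` {tau3', moebius X tau3, moebius Y tau3'})"
  define \<epsilon> where "\<epsilon> = \<mu> / 2"
  have neg: "RR M v < 0 \<and> Im v > 0" if "v \<in> {tau3', moebius X tau3, moebius Y tau3'}" for v
    using that redM lv redY d I
    by (auto simp: red_def leav_def RR_moebius X_def[symmetric] moebius_Im_pos)
  have E: "EE M v > 0" if "Im v > 0" for v using EE_pos[OF that, of M] M by simp
  have fp: "f v > 0" if "v \<in> {tau3', moebius X tau3, moebius Y tau3'}" for v
    using neg[OF that] E[of v] by (simp add: f_def divide_neg_pos)
  then have mp: "\<mu> > 0"
    unfolding \<mu>_def by (subst Min_gr_iff) auto
  then have ep: "\<epsilon> > 0" by (simp add: \<epsilon>_def)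
  have ef: "\<epsilon> < f v" if "v \<in> {tau3', moebius X tau3, moebius Y tau3'}" for v
  proof -
    have "\<mu> \<le> f v" unfolding \<mu>_def using that by (intro Min_le) auto
    then show ?thesis using mp by (simp add: \<epsilon>_def)
  qed
  \<comment> \<open>Horizontal translation after \<open>M\<close>: the second row, hence
    \<open>EE\<close>, is unchanged, and \<open>RR\<close> grows by a positive multiple of
    \<open>EE\<close>, which makes the weak inequalities strict.\<close>
  define N where "N = mat22 1 \<epsilon> 0 1 ** M"
  have N: "det N = det M" "EE N v = EE M v" "RR N v = RR M v + \<epsilon> * EE M v" for v
    unfolding N_def by (simp_all add: det_mul) (simp_all add: EE_def RR_def algebra_simps power2_eq_square)
  have neg': "RR N v < 0" if "v \<in> {tau3', moebius X tau3, moebius Y tau3'}" for v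
    using ef[OF that] E[of v] neg[OF that] unfolding N f_def by (simp add: field_simps)
  have pos': "RR N v > 0" if "RR M v \<ge> 0" "Im v > 0" for v
    unfolding N using that E[of v] ep by (simp add: add_nonneg_pos)
  have p: "RR N tau3 > 0" "RR N (moebius X tau3') > 0" "RR N (moebius Y tau3) > 0"
  proof -
    have "RR M tau3 \<ge> 0" "RR M (moebius X tau3') \<ge> 0" "RR M (moebius Y tau3) \<ge> 0"
      using redM lv redY d I by (simp_all add: red_def leav_def RR_moebius X_def[symmetric])
    then show "RR N tau3 > 0" "RR N (moebius X tau3') > 0" "RR N (moebius Y tau3) > 0"
      using d I by (simp_all add: pos' moebius_Im_pos)
  qed
  note fs = fundamental_strict[OF _ XD Y p(1) neg' neg' p(2) _ p(3) neg', unfolded N, OF M]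
  have X7: "moebius X tau7 = tau7" by (simp add: X_def)
  have A: "EE M (moebius X (moebius g2 tau7)) = EE (M ** (mat_pow g7 i ** g2)) tau7"
    using d I by (simp add: RR_moebius moebius_Im_pos det_g2 X_def matrix_mul_assoc)
  have B: "EE M (moebius Y tau7) = EE (M ** Y) tau7" using d by (simp add: RR_moebius)
  show "\<not> (EE (M ** (mat_pow g7 i ** g2)) tau7 < EE (M ** Y) tau7 \<and> EE (M ** Y) tau7 < EE M tau7)"
    using fs(1) X7 unfolding A B by simp
  assume eq: "EE (M ** Y) tau7 = EE M tau7"
  then have "moebius Y tau7 = tau7 \<or> moebius Y tau7 = moebius g2 tau7"
    using fs(2) X7 unfolding B by simp
  moreover have "moebius Y tau7 \<noteq> moebius g2 tau7"
  proof
    assume "moebius Y tau7 = moebius g2 tau7"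
    then have "EE (M ** Y) tau7 = EE (M ** g2) tau7" using RR_moebius(2)[of tau7] d det_g2 I by metis
    then show False using eq red_height[OF redM] by simp
  qed
  ultimately show "Y = mat 1 \<or> Y = - mat 1" using red_stab[OF redM redY Y] by blast
qed

section \<open>Endpoints and points of geodesics\<close>

fun hv :: "rp1 \<Rightarrow> real \<times> real" where
  "hv (PReal a) = (a, 1)"
| "hv PInf = (1, 0)"

definition pt :: "real \<Rightarrow> real \<Rightarrow> rp1" where
  "pt x y = (if y = 0 then PInf else PReal (x / y))"

lemma hv_nz: "fst (hv p) \<noteq> 0 \<or> snd (hv p) \<noteq> 0" by (cases p) auto

lemma pt_scale: "k \<noteq> 0 \<Longrightarrow> pt (k * x) (k * y) = pt x y" by (simp add: pt_def)

lemma hv_pt: assumes "x \<noteq> 0 \<or> y \<noteq> 0"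
  obtains k where "k \<noteq> 0" "fst (hv (pt x y)) = k * x" "snd (hv (pt x y)) = k * y"
proof (cases "y = 0")
  case True then show ?thesis using assms that[of "1/x"] by (simp add: pt_def)
next
  case False then show ?thesis using that[of "1/y"] by (simp add: pt_def)
qed

lemma rp1_act_pt: "rp1_act M p = pt (M$1$1 * fst (hv p) + M$1$2 * snd (hv p)) (M$2$1 * fst (hv p) + M$2$2 * snd (hv p))"
  by (cases p) (auto simp: pt_def)

lemma rp1_act_1 [simp]: "rp1_act (mat 1) p = p" by (cases p) auto

lemma rp1_act_mult:
  assumes "det B \<noteq> 0"
  shows "rp1_act (A ** B) p = rp1_act A (rp1_act B p)"
proof -
  define x y where xy: "x = B$1$1 * fst (hv p) + B$1$2 * snd (hv p)" "y = B$2$1 * fst (hv p) + B$2$2 * snd (hv p)"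
  have nz: "x \<noteq> 0 \<or> y \<noteq> 0"
  proof (rule ccontr)
    assume "\<not> ?thesis"
    then have "x = 0" "y = 0" by auto
    moreover have "det B * fst (hv p) = B$2$2 * x - B$1$2 * y" "det B * snd (hv p) = B$1$1 * y - B$2$1 * x"
      unfolding xy det_2 by algebra+
    ultimately show False using assms hv_nz[of p] by simp
  qed
  then obtain k where k: "k \<noteq> 0" "fst (hv (pt x y)) = k * x" "snd (hv (pt x y)) = k * y" by (rule hv_pt)
  have "rp1_act A (rp1_act B p) = pt (k * (A$1$1 * x + A$1$2 * y)) (k * (A$2$1 * x + A$2$2 * y))"
    unfolding rp1_act_pt[of B] xy[symmetric] rp1_act_pt[of A] k(2,3) by (simp add: algebra_simps)
  also have "\<dots> = pt (A$1$1 * x + A$1$2 * y) (A$2$1 * x + A$2$2 * y)" by (rule pt_scale[OF k(1)])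
  also have "\<dots> = rp1_act (A ** B) p"
    unfolding rp1_act_pt[of "A ** B"] xy matrix_mult_nth2 by (simp add: algebra_simps)
  finally show ?thesis by simp
qed

lemma geo_act_mult: "det B \<noteq> 0 \<Longrightarrow> geo_act (A ** B) \<omega> = geo_act A (geo_act B \<omega>)"
  by (simp add: geo_act_def rp1_act_mult)

lemma geo_act_1 [simp]: "geo_act (mat 1) \<omega> = \<omega>" by (simp add: geo_act_def)

lemma geo_act_adj2: "det X = 1 \<Longrightarrow> geo_act (adj2 X) (geo_act X \<omega>) = \<omega>" "det X = 1 \<Longrightarrow> geo_act X (geo_act (adj2 X) \<omega>) = \<omega>"
  by (simp_all add: geo_act_mult[symmetric] adj2_mult)

text \<open>\<open>M\<close> carries the first endpoint to 0 and the second to infinity: its rows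
  are linear forms in homogeneous coordinates, each vanishing at one endpoint. So a frame is unique
  up to a factor for each row, and these factors have the same sign.\<close>

definition is_frame :: "mat2 \<Rightarrow> geodesic \<Rightarrow> bool" where
  "is_frame M \<omega> \<longleftrightarrow> det M > 0
     \<and> M$1$1 * fst (hv (fst \<omega>)) + M$1$2 * snd (hv (fst \<omega>)) = 0
     \<and> M$2$1 * fst (hv (snd \<omega>)) + M$2$2 * snd (hv (snd \<omega>)) = 0"

lemma is_frame_act:
  assumes "is_frame M (geo_act X \<omega>)" "det X = 1"
  shows "is_frame (M ** X) \<omega>"
proof -
  have hx: "\<exists>k. k \<noteq> 0 \<and> fst (hv (rp1_act X p)) = k * (X$1$1 * fst (hv p) + X$1$2 * snd (hv p))
     \<and> snd (hv (rp1_act X p)) = k * (X$2$1 * fst (hv p) + X$2$2 * snd (hv p))" for p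
  proof -
    define x y where xy: "x = X$1$1 * fst (hv p) + X$1$2 * snd (hv p)" "y = X$2$1 * fst (hv p) + X$2$2 * snd (hv p)"
    have nz: "x \<noteq> 0 \<or> y \<noteq> 0"
    proof (rule ccontr)
      assume "\<not> ?thesis"
      then have "x = 0" "y = 0" by auto
      moreover have "det X * fst (hv p) = X$2$2 * x - X$1$2 * y" "det X * snd (hv p) = X$1$1 * y - X$2$1 * x"
        unfolding xy det_2 by algebra+
      ultimately show False using assms hv_nz[of p] by simp
    qed
    obtain k where "k \<noteq> 0" "fst (hv (pt x y)) = k * x" "snd (hv (pt x y)) = k * y" by (rule hv_pt[OF nz])
    then show ?thesis unfolding rp1_act_pt[of X] xy by blast
  qed
  obtain k where k: "k \<noteq> 0" "fst (hv (rp1_act X (fst \<omega>))) = k * (X$1$1 * fst (hv (fst \<omega>)) + X$1$2 * snd (hv (fst \<omega>)))"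
     "snd (hv (rp1_act X (fst \<omega>))) = k * (X$2$1 * fst (hv (fst \<omega>)) + X$2$2 * snd (hv (fst \<omega>)))" using hx by blast
  obtain l where l: "l \<noteq> 0" "fst (hv (rp1_act X (snd \<omega>))) = l * (X$1$1 * fst (hv (snd \<omega>)) + X$1$2 * snd (hv (snd \<omega>)))"
     "snd (hv (rp1_act X (snd \<omega>))) = l * (X$2$1 * fst (hv (snd \<omega>)) + X$2$2 * snd (hv (snd \<omega>)))" using hx by blast
  have "k * ((M ** X)$1$1 * fst (hv (fst \<omega>)) + (M ** X)$1$2 * snd (hv (fst \<omega>))) = 0"
    using assms(1) unfolding is_frame_def geo_act_def fst_conv snd_conv k(2,3) matrix_mult_nth2 by (simp add: algebra_simps)
  moreover have "l * ((M ** X)$2$1 * fst (hv (snd \<omega>)) + (M ** X)$2$2 * snd (hv (snd \<omega>))) = 0"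
    using assms(1) unfolding is_frame_def geo_act_def fst_conv snd_conv l(2,3) matrix_mult_nth2 by (simp add: algebra_simps)
  moreover have "det (M ** X) > 0" using assms by (simp add: is_frame_def det_mul)
  ultimately show ?thesis using k(1) l(1) unfolding is_frame_def by simp
qed

lemma is_frame_exists: assumes "fst \<omega> \<noteq> snd \<omega>" obtains M where "is_frame M \<omega>"
proof -
  define b1 b2 a1 a2 where ab: "b1 = fst (hv (fst \<omega>))" "b2 = snd (hv (fst \<omega>))" "a1 = fst (hv (snd \<omega>))" "a2 = snd (hv (snd \<omega>))"
  have "a1 * b2 - b1 * a2 \<noteq> 0"
    using assms unfolding ab by (cases "fst \<omega>"; cases "snd \<omega>") auto
  then consider "a1 * b2 - b1 * a2 > 0" | "a1 * b2 - b1 * a2 < 0" by linarith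
  then show ?thesis
  proof cases
    case 1
    show ?thesis
      by (rule that[of "mat22 b2 (- b1) (- a2) a1"]) (use 1 in \<open>simp add: is_frame_def ab[symmetric] algebra_simps\<close>)
  next
    case 2
    show ?thesis
      by (rule that[of "mat22 (- b2) b1 (- a2) a1"]) (use 2 in \<open>simp add: is_frame_def ab[symmetric] algebra_simps\<close>)
  qed
qed

lemma is_frame_diag:
  assumes "is_frame M \<omega>" "is_frame N \<omega>"
  obtains k l where "k * l > 0" "N = mat22 k 0 0 l ** M"
proof -
  define b1 b2 a1 a2 where ab: "b1 = fst (hv (fst \<omega>))" "b2 = snd (hv (fst \<omega>))" "a1 = fst (hv (snd \<omega>))" "a2 = snd (hv (snd \<omega>))"
  have M: "M$1$1 * b1 + M$1$2 * b2 = 0" "M$2$1 * a1 + M$2$2 * a2 = 0" "det M > 0"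
    and N: "N$1$1 * b1 + N$1$2 * b2 = 0" "N$2$1 * a1 + N$2$2 * a2 = 0" "det N > 0"
    using assms by (simp_all add: is_frame_def ab)
  have par: "\<exists>k. n1 = k * m1 \<and> n2 = k * m2"
    if "m1 * c1 + m2 * c2 = 0" "n1 * c1 + n2 * c2 = 0" "c1 \<noteq> 0 \<or> c2 \<noteq> 0" "m1 \<noteq> 0 \<or> m2 \<noteq> 0" for m1 m2 n1 n2 c1 c2 :: real
  proof -
    have x: "n1 * m2 = n2 * m1" using that(1,2,3) by algebra
    show ?thesis
    proof (cases "m1 = 0")
      case True then show ?thesis using x that by (intro exI[of _ "n2 / m2"]) auto
    next
      case False then show ?thesis using x that by (intro exI[of _ "n1 / m1"]) (auto simp: field_simps)
    qed
  qed
  have "M$1$1 \<noteq> 0 \<or> M$1$2 \<noteq> 0" "M$2$1 \<noteq> 0 \<or> M$2$2 \<noteq> 0" using M(3) by (auto simp: det_2)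
  then obtain k l where kl: "N$1$1 = k * M$1$1" "N$1$2 = k * M$1$2" "N$2$1 = l * M$2$1" "N$2$2 = l * M$2$2"
    using par[OF M(1) N(1)] par[OF M(2) N(2)] hv_nz[of "fst \<omega>"] hv_nz[of "snd \<omega>"] unfolding ab by metis
  have NM: "N = mat22 k 0 0 l ** M" by (simp add: mat2_eq_iff kl)
  then have "det N = k * l * det M" by (simp add: det_mul)
  then have "k * l > 0" using N(3) M(3) by (simp add: zero_less_mult_iff)
  then show ?thesis using that NM by blast
qed

lemma RR_diag: "RR (mat22 k 0 0 l ** M) \<tau> = k * l * RR M \<tau>" "EE (mat22 k 0 0 l ** M) \<tau> = l\<^sup>2 * EE M \<tau>"
  by (simp_all add: RR_def EE_def power2_eq_square algebra_simps)

text \<open>Gives all shapes of geodesics one formula: in the hyperboloid model a geodesic is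
  spanned by two isotropic vectors belonging to its endpoints, with coefficients 1 / t and
  t.\<close>

lemma geo_point_s:
  assumes "\<beta> \<noteq> \<alpha>"
  obtains A1 A2 A3 B1 B2 B3 where
    "\<And>t. t > 0 \<Longrightarrow> Im (geo_point (\<beta>, \<alpha>) t) > 0"
    "\<And>t. t > 0 \<Longrightarrow> s1 (geo_point (\<beta>, \<alpha>) t) = A1 / t + B1 * t"
    "\<And>t. t > 0 \<Longrightarrow> s2 (geo_point (\<beta>, \<alpha>) t) = A2 / t + B2 * t"
    "\<And>t. t > 0 \<Longrightarrow> s3 (geo_point (\<beta>, \<alpha>) t) = A3 / t + B3 * t"
proof (cases \<beta>)
  case b: (PReal b)
  show ?thesis
  proof (cases \<alpha>)
    case a: (PReal a)
    define D where "D = \<bar>a - b\<bar>"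
    have D: "D > 0" using assms a b by (simp add: D_def)
    have D2: "D\<^sup>2 = (a - b)\<^sup>2" by (simp add: D_def)
    have gp: "geo_point (\<beta>, \<alpha>) t = Complex ((b + a * t\<^sup>2) / (1 + t\<^sup>2)) (D * t / (1 + t\<^sup>2))" for t
      by (simp add: a b D_def)
    have p: "1 + t\<^sup>2 > 0" for t :: real by (simp add: add_pos_nonneg)
    show ?thesis
    proof (rule that[of "b\<^sup>2 / D" "a\<^sup>2 / D" "b / D" "a / D" "1 / D" "1 / D"])
      fix t :: real assume t: "t > 0"
      define n where "n = 1 + t\<^sup>2"
      have n: "n > 0" unfolding n_def by (rule p)
      show "Im (geo_point (\<beta>, \<alpha>) t) > 0" unfolding gp using t D p by simp
      show "s2 (geo_point (\<beta>, \<alpha>) t) = b / D / t + a / D * t"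
        unfolding gp s2_def n_def[symmetric] using t D n by (simp add: field_simps power2_eq_square)
      show "s3 (geo_point (\<beta>, \<alpha>) t) = 1 / D / t + 1 / D * t"
        unfolding gp s3_def n_def[symmetric] using t D n by (simp add: field_simps) (simp add: n_def power2_eq_square algebra_simps)
      have "(b + a * t\<^sup>2)\<^sup>2 + (D * t)\<^sup>2 = (b\<^sup>2 + a\<^sup>2 * t\<^sup>2) * n"
        unfolding power_mult_distrib D2 n_def by algebra
      then have "((b + a * t\<^sup>2) / n)\<^sup>2 + (D * t / n)\<^sup>2 = (b\<^sup>2 + a\<^sup>2 * t\<^sup>2) / n"
        unfolding power_divide add_divide_distrib[symmetric] using n by (simp add: power2_eq_square)
      then have "s1 (geo_point (\<beta>, \<alpha>) t) = (b\<^sup>2 + a\<^sup>2 * t\<^sup>2) / n / (D * t / n)"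
        unfolding gp s1_def n_def[symmetric] by simp
      then have "s1 (geo_point (\<beta>, \<alpha>) t) = (b\<^sup>2 + a\<^sup>2 * t\<^sup>2) / (D * t)" using n by simp
      then show "s1 (geo_point (\<beta>, \<alpha>) t) = b\<^sup>2 / D / t + a\<^sup>2 / D * t"
        using t D by (simp add: field_simps power2_eq_square)
    qed
  next
    case a: PInf
    show ?thesis
      by (rule that[of "b\<^sup>2" 1 b 0 1 0])
         (simp_all add: a b s1_def s2_def s3_def field_simps power2_eq_square)
  qed
next
  case b: PInf
  then obtain a where a: "\<alpha> = PReal a" using assms by (cases \<alpha>) auto
  show ?thesis
    by (rule that[of 1 "a\<^sup>2" 0 a 0 1])
       (simp_all add: a b s1_def s2_def s3_def field_simps power2_eq_square)
qed

text \<open>In its frame the geodesic is the imaginary axis, traversed upwards; so the order of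
  parameters can be read off \<open>EE\<close>, which decreases.\<close>

lemma geo_point_frame:
  assumes "is_frame M \<omega>"
  obtains c where "c > 0" "\<And>t. t > 0 \<Longrightarrow> Im (geo_point \<omega> t) > 0"
    "\<And>t. t > 0 \<Longrightarrow> RR M (geo_point \<omega> t) = 0" "\<And>t. t > 0 \<Longrightarrow> EE M (geo_point \<omega> t) = c / t"
proof -
  obtain \<beta> \<alpha> where w: "\<omega> = (\<beta>, \<alpha>)" by (cases \<omega>)
  define a b c d where abcd: "a = M$1$1" "b = M$1$2" "c = M$2$1" "d = M$2$2"
  have det: "a * d - b * c > 0" using assms by (simp add: is_frame_def det_2 abcd)
  show ?thesis
  proof (cases \<beta>)
    case B: (PReal \<beta>')
    have b: "b = - a * \<beta>'" using assms by (simp add: is_frame_def w B abcd)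
    show ?thesis
    proof (cases \<alpha>)
      case A: (PReal \<alpha>')
      have d: "d = - c * \<alpha>'" using assms by (simp add: is_frame_def w A abcd)
      have det': "a * c * (\<beta>' - \<alpha>') > 0" using det unfolding b d by (simp add: algebra_simps)
      define D where "D = \<bar>\<alpha>' - \<beta>'\<bar>"
      have D: "D > 0" using det' by (auto simp: D_def)
      have D2: "D * D = (\<alpha>' - \<beta>') * (\<alpha>' - \<beta>')" by (simp add: D_def)
      have gp: "geo_point \<omega> t = Complex ((\<beta>' + \<alpha>' * t\<^sup>2) / (1 + t\<^sup>2)) (D * t / (1 + t\<^sup>2))" for t
        by (simp add: w A B D_def)
      have s: "Im (geo_point \<omega> t) > 0" "s1 (geo_point \<omega> t) = (\<beta>'\<^sup>2 + \<alpha>'\<^sup>2 * t\<^sup>2) / (D * t)"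
        "s2 (geo_point \<omega> t) = (\<beta>' + \<alpha>' * t\<^sup>2) / (D * t)" "s3 (geo_point \<omega> t) = (1 + t\<^sup>2) / (D * t)" if t: "t > 0" for t
      proof -
        define n where "n = 1 + t\<^sup>2"
        have n: "n > 0" unfolding n_def by (simp add: add_pos_nonneg)
        show "Im (geo_point \<omega> t) > 0" unfolding gp n_def[symmetric] using t D n by simp
        show "s2 (geo_point \<omega> t) = (\<beta>' + \<alpha>' * t\<^sup>2) / (D * t)" "s3 (geo_point \<omega> t) = (1 + t\<^sup>2) / (D * t)"
          unfolding gp s2_def s3_def n_def[symmetric] using t D n by simp_all
        have "(\<beta>' + \<alpha>' * t\<^sup>2)\<^sup>2 + (D * t)\<^sup>2 = (\<beta>'\<^sup>2 + \<alpha>'\<^sup>2 * t\<^sup>2) * n"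
          unfolding power_mult_distrib n_def power2_eq_square[of D] D2 by algebra
        then have "((\<beta>' + \<alpha>' * t\<^sup>2) / n)\<^sup>2 + (D * t / n)\<^sup>2 = (\<beta>'\<^sup>2 + \<alpha>'\<^sup>2 * t\<^sup>2) / n"
          unfolding power_divide add_divide_distrib[symmetric] using n by (simp add: power2_eq_square)
        then have "s1 (geo_point \<omega> t) = (\<beta>'\<^sup>2 + \<alpha>'\<^sup>2 * t\<^sup>2) / n / (D * t / n)"
          unfolding gp s1_def n_def[symmetric] by simp
        then show "s1 (geo_point \<omega> t) = (\<beta>'\<^sup>2 + \<alpha>'\<^sup>2 * t\<^sup>2) / (D * t)" using n by simp
      qed
      show ?thesis
      proof (rule that[of "c\<^sup>2 * D"])
        have "c \<noteq> 0" using det' by auto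
        then show "c\<^sup>2 * D > 0" using D by simp
        fix t :: real assume t: "t > 0"
        show "Im (geo_point \<omega> t) > 0" by (rule s(1)[OF t])
        have lin: "x * (u / (D * t)) + y * (v / (D * t)) + z * (w / (D * t)) = (x * u + y * v + z * w) / (D * t)" for x y z u v w
          by (simp add: add_divide_distrib)
        have "RR M (geo_point \<omega> t) = (a * c * (\<beta>'\<^sup>2 + \<alpha>'\<^sup>2 * t\<^sup>2) + (a * d + b * c) * (\<beta>' + \<alpha>' * t\<^sup>2) + b * d * (1 + t\<^sup>2)) / (D * t)"
          unfolding RR_def abcd[symmetric] s(2-4)[OF t] lin ..
        also have "a * c * (\<beta>'\<^sup>2 + \<alpha>'\<^sup>2 * t\<^sup>2) + (a * d + b * c) * (\<beta>' + \<alpha>' * t\<^sup>2) + b * d * (1 + t\<^sup>2) = 0"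
          unfolding b d by algebra
        finally show "RR M (geo_point \<omega> t) = 0" by simp
        have "EE M (geo_point \<omega> t) = (c\<^sup>2 * (\<beta>'\<^sup>2 + \<alpha>'\<^sup>2 * t\<^sup>2) + 2 * c * d * (\<beta>' + \<alpha>' * t\<^sup>2) + d\<^sup>2 * (1 + t\<^sup>2)) / (D * t)"
          unfolding EE_def abcd[symmetric] s(2-4)[OF t] lin ..
        also have "c\<^sup>2 * (\<beta>'\<^sup>2 + \<alpha>'\<^sup>2 * t\<^sup>2) + 2 * c * d * (\<beta>' + \<alpha>' * t\<^sup>2) + d\<^sup>2 * (1 + t\<^sup>2) = c\<^sup>2 * (D * D)"
          unfolding d D2 by algebra
        finally show "EE M (geo_point \<omega> t) = c\<^sup>2 * D / t" using D by simp
      qed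
    next
      case A: PInf
      have c: "c = 0" using assms by (simp add: is_frame_def w A abcd)
      show ?thesis
      proof (rule that[of "d\<^sup>2"])
        show "d\<^sup>2 > 0" using det c by auto
      qed (use c b in \<open>simp_all add: w A B RR_def EE_def abcd[symmetric] s1_def s2_def s3_def algebra_simps\<close>)
    qed
  next
    case B: PInf
    then obtain \<alpha>' where A: "\<alpha> = PReal \<alpha>'" using assms det
      by (cases \<alpha>) (auto simp: is_frame_def w abcd)
    have a: "a = 0" using assms by (simp add: is_frame_def w B abcd)
    have d: "d = - c * \<alpha>'" using assms by (simp add: is_frame_def w A abcd)
    show ?thesis
    proof (rule that[of "c\<^sup>2"])
      show "c\<^sup>2 > 0" using det a by auto
      fix t :: real assume t: "t > 0"
      show "Im (geo_point \<omega> t) > 0" "RR M (geo_point \<omega> t) = 0" "EE M (geo_point \<omega> t) = c\<^sup>2 / t"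
        using t a d by (simp_all add: w A B RR_def EE_def abcd[symmetric] s1_def s2_def s3_def field_simps power2_eq_square)
    qed
  qed
qed

lemma moebius_inj:
  assumes "Im p > 0" "Im q > 0" "det M > 0" "RR M p = RR M q" "EE M p = EE M q"
  shows "p = q"
proof -
  have "moebius M p = moebius M q"
    by (rule s_eqI) (use assms in \<open>simp_all add: moebius_s moebius_Im_pos\<close>)
  then have e: "moebius (adj2 M) (moebius M p) = moebius (adj2 M) (moebius M q)" by simp
  have "moebius (adj2 M) (moebius M z) = z" if "Im z > 0" for z
  proof -
    have "moebius (adj2 M) (moebius M z) = moebius (adj2 M ** M) z"
      by (rule moebius_mult[symmetric]) (use that assms in simp_all)
    also have "adj2 M ** M = mat (det M)" by (simp add: mat2_eq_iff det_2 algebra_simps)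
    also have "moebius (mat (det M)) z = z" using assms by (simp add: moebius_def)
    finally show ?thesis .
  qed
  then show ?thesis using e assms by simp
qed

lemma on_geodesic:
  assumes "is_frame M \<omega>" "Im \<tau> > 0" "RR M \<tau> = 0"
  obtains t where "t > 0" "\<tau> = geo_point \<omega> t"
proof -
  obtain c where c: "c > 0" and g: "\<And>t. t > 0 \<Longrightarrow> Im (geo_point \<omega> t) > 0"
    "\<And>t. t > 0 \<Longrightarrow> RR M (geo_point \<omega> t) = 0" "\<And>t. t > 0 \<Longrightarrow> EE M (geo_point \<omega> t) = c / t"
    using geo_point_frame[OF assms(1)] by metis
  have d: "det M > 0" using assms by (simp add: is_frame_def)
  define t where "t = c / EE M \<tau>"
  have t: "t > 0" unfolding t_def using c EE_pos[OF assms(2), of M] d by simp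
  have "EE M (geo_point \<omega> t) = EE M \<tau>" using g(3)[OF t] c t by (simp add: t_def)
  then have "\<tau> = geo_point \<omega> t"
    by (intro moebius_inj[OF assms(2) g(1)[OF t] d]) (use g(2)[OF t] assms in simp_all)
  then show ?thesis using that t by blast
qed

text \<open>In the hyperboloid model, the points of a segment are the nonnegative combinations of its ends.\<close>
definition comb :: "complex \<Rightarrow> real \<Rightarrow> complex \<Rightarrow> real \<Rightarrow> complex \<Rightarrow> bool" where
  "comb X l P m Q \<longleftrightarrow> s1 X = l * s1 P + m * s1 Q \<and> s2 X = l * s2 P + m * s2 Q \<and> s3 X = l * s3 P + m * s3 Q"

lemma comb_FRE:
  assumes "comb X l P m Q"
  shows "FF M X = l * FF M P + m * FF M Q" "RR M X = l * RR M P + m * RR M Q" "EE M X = l * EE M P + m * EE M Q"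
  using assms unfolding comb_def FF_def RR_def EE_def by (simp_all add: algebra_simps)

text \<open>Points of the hyperboloid all have norm 1, so a nonnegative multiple of one that lies on
  it again has factor 1.\<close>

lemma comb_single: assumes "comb X l P 0 Q" "Im X > 0" "Im P > 0" "l \<ge> 0" shows "X = P"
proof -
  have s: "s1 X = l * s1 P" "s2 X = l * s2 P" "s3 X = l * s3 P" using assms(1) by (simp_all add: comb_def)
  have "l\<^sup>2 * (s1 P * s3 P - (s2 P)\<^sup>2) = 1"
    using s_norm[OF assms(2)] unfolding s by (simp add: power2_eq_square algebra_simps)
  then have "l\<^sup>2 = 1\<^sup>2" using s_norm[OF assms(3)] by simp
  then have "l = 1" by (rule power2_eq_imp_eq) (use assms in simp_all)
  then show ?thesis by (intro s_eqI) (use s assms in simp_all)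
qed

lemma comb_commute: "comb X l P m Q \<Longrightarrow> comb X m Q l P" by (simp add: comb_def)

lemma geo_segment_comb:
  assumes "X \<in> geo_segment P Q"
  obtains l m where "l \<ge> 0" "m \<ge> 0" "comb X l P m Q" "Im X > 0"
proof -
  obtain \<beta> \<alpha> s t u where g: "\<beta> \<noteq> \<alpha>" "0 < s" "s \<le> t" "t \<le> u"
     "P = geo_point (\<beta>, \<alpha>) s" "X = geo_point (\<beta>, \<alpha>) t" "Q = geo_point (\<beta>, \<alpha>) u"
    using assms unfolding geo_segment_def by blast
  obtain A1 A2 A3 B1 B2 B3 where c:
    "\<And>t. t > 0 \<Longrightarrow> Im (geo_point (\<beta>, \<alpha>) t) > 0"
    "\<And>t. t > 0 \<Longrightarrow> s1 (geo_point (\<beta>, \<alpha>) t) = A1 / t + B1 * t"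
    "\<And>t. t > 0 \<Longrightarrow> s2 (geo_point (\<beta>, \<alpha>) t) = A2 / t + B2 * t"
    "\<And>t. t > 0 \<Longrightarrow> s3 (geo_point (\<beta>, \<alpha>) t) = A3 / t + B3 * t"
    using geo_point_s[OF g(1)] by metis
  have pos: "s > 0" "t > 0" "u > 0" using g by simp_all
  have "\<exists>l m. l \<ge> 0 \<and> m \<ge> 0 \<and> 1 / t = l * (1 / s) + m * (1 / u) \<and> t = l * s + m * u"
  proof (cases "s = u")
    case True
    then have "t = s" using g by simp
    then show ?thesis by (intro exI[of _ 1] exI[of _ 0]) simp
  next
    case False
    then have su: "s < u" using g by simp
    have q: "t * (u\<^sup>2 - s\<^sup>2) > 0" using su pos by (simp add: power_strict_mono)
    have uu: "u\<^sup>2 - s\<^sup>2 \<noteq> 0" using q by auto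
    \<comment> \<open>The solution of the two linear equations that express \<open>1 / t\<close> and
      \<open>t\<close> by the values at \<open>s\<close> and \<open>u\<close>.\<close>
    define l m where lm: "l = s * (u\<^sup>2 - t\<^sup>2) / (t * (u\<^sup>2 - s\<^sup>2))" "m = u * (t\<^sup>2 - s\<^sup>2) / (t * (u\<^sup>2 - s\<^sup>2))"
    have "l \<ge> 0" "m \<ge> 0" unfolding lm using q pos g by (auto intro!: divide_nonneg_pos mult_nonneg_nonneg power_mono)
    moreover have "l * (1 / s) + m * (1 / u) = ((u\<^sup>2 - t\<^sup>2) + (t\<^sup>2 - s\<^sup>2)) / (t * (u\<^sup>2 - s\<^sup>2))"
      unfolding lm add_divide_distrib using pos by simp
    then have "1 / t = l * (1 / s) + m * (1 / u)" using uu by simp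
    moreover have "l * s + m * u = (s * (u\<^sup>2 - t\<^sup>2) * s + u * (t\<^sup>2 - s\<^sup>2) * u) / (t * (u\<^sup>2 - s\<^sup>2))"
      unfolding lm add_divide_distrib by simp
    then have "l * s + m * u = (t * (t * (u\<^sup>2 - s\<^sup>2))) / (t * (u\<^sup>2 - s\<^sup>2))" 
      by (simp add: power2_eq_square algebra_simps)
    then have "t = l * s + m * u" using uu pos by simp
    ultimately show ?thesis by blast
  qed
  then obtain l m where lm: "l \<ge> 0" "m \<ge> 0" "1 / t = l * (1 / s) + m * (1 / u)" "t = l * s + m * u" by blast
  have lin: "A / t + B * t = l * (A / s + B * s) + m * (A / u + B * u)" for A B
  proof -
    have "A / t + B * t = A * (1 / t) + B * t" by simp
    also have "\<dots> = A * (l * (1 / s) + m * (1 / u)) + B * (l * s + m * u)" using lm(3,4) by simp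
    finally show ?thesis by (simp add: algebra_simps)
  qed
  have "comb X l P m Q" unfolding comb_def g(5-7) c(2-4)[OF pos(1)] c(2-4)[OF pos(2)] c(2-4)[OF pos(3)]
    using lin by blast
  then show ?thesis using that lm c(1)[OF pos(2)] g by blast
qed

lemma geodesic_through:
  assumes P: "Im P > 0" and Q: "Im Q > 0"
  obtains M \<omega> where "fst \<omega> \<noteq> snd \<omega>" "is_frame M \<omega>" "RR M P = 0" "RR M Q = 0" "EE M Q \<le> EE M P"
proof -
  have "\<exists>M. det M > 0 \<and> RR M P = 0 \<and> RR M Q = 0"
  proof (cases "Re P = Re Q")
    case True
    then show ?thesis by (intro exI[of _ "mat22 1 (- Re P) 0 1"]) (simp add: RR_def s2_def s3_def)
  next
    case False
    define c where "c = ((Re Q)\<^sup>2 + (Im Q)\<^sup>2 - (Re P)\<^sup>2 - (Im P)\<^sup>2) / (2 * (Re Q - Re P))"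
    define r where "r = sqrt ((Re P - c)\<^sup>2 + (Im P)\<^sup>2)"
    have r: "r > 0" "r\<^sup>2 = (Re P - c)\<^sup>2 + (Im P)\<^sup>2" unfolding r_def using P by (simp_all add: add_nonneg_pos)
    have "c * (2 * (Re Q - Re P)) = (Re Q)\<^sup>2 + (Im Q)\<^sup>2 - (Re P)\<^sup>2 - (Im P)\<^sup>2"
      unfolding c_def using False by simp
    then have r': "r\<^sup>2 = (Re Q - c)\<^sup>2 + (Im Q)\<^sup>2" unfolding r(2) by algebra
    \<comment> \<open>\<open>c\<close> and \<open>r\<close> are centre and radius of the half circle
      through both points; \<open>M\<close> sends \<open>c - r\<close> to 0 and \<open>c + r\<close>
      to infinity.\<close>
    define M where "M = mat22 1 (r - c) (-1) (c + r)"
    have RM: "RR M z * Im z = r\<^sup>2 - (Re z - c)\<^sup>2 - (Im z)\<^sup>2" if "Im z > 0" for z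
      using that by (simp add: RR_def M_def s1_def s2_def s3_def field_simps power2_eq_square)
    have "RR M P * Im P = 0" unfolding RM[OF P] r(2) by simp
    moreover have "RR M Q * Im Q = 0" unfolding RM[OF Q] r' by simp
    ultimately have "RR M P = 0" "RR M Q = 0" using P Q by simp_all
    moreover have "det M > 0" using r by (simp add: M_def)
    ultimately show ?thesis by blast
  qed
  then obtain M0 where M0: "det M0 > 0" "RR M0 P = 0" "RR M0 Q = 0" by blast
  have "\<exists>M. det M > 0 \<and> RR M P = 0 \<and> RR M Q = 0 \<and> EE M Q \<le> EE M P"
  proof (cases "EE M0 Q \<le> EE M0 P")
    case True then show ?thesis using M0 by blast
  next
    case False
    \<comment> \<open>Composition with z -> -1/z reverses the orientation of the geodesic,
      exchanging \<open>EE\<close> and \<open>FF\<close>.\<close>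
    define M where "M = mat22 0 (-1) 1 0 ** M0"
    have M: "det M = det M0" "RR M z = - RR M0 z" "EE M z = FF M0 z" for z
      unfolding M_def by (simp_all add: det_mul) (simp_all add: RR_def EE_def FF_def algebra_simps)
    have "FF M0 P * EE M0 P = FF M0 Q * EE M0 Q"
      using FF_EE_RR[OF P, of M0] FF_EE_RR[OF Q, of M0] M0 by simp
    moreover have "FF M0 P * EE M0 P \<le> FF M0 P * EE M0 Q"
      using False FF_pos[OF P, of M0] M0 by (intro mult_left_mono) auto
    ultimately have "FF M0 Q * EE M0 Q \<le> FF M0 P * EE M0 Q" by simp
    then have "FF M0 Q \<le> FF M0 P" using EE_pos[OF Q, of M0] M0 by simp
    then show ?thesis using M M0 by (intro exI[of _ M]) simp
  qed
  then obtain M where M: "det M > 0" "RR M P = 0" "RR M Q = 0" "EE M Q \<le> EE M P" by blast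
  define \<beta> \<alpha> where ba: "\<beta> = pt (- M$1$2) (M$1$1)" "\<alpha> = pt (- M$2$2) (M$2$1)"
  have nz: "- M$1$2 \<noteq> 0 \<or> M$1$1 \<noteq> 0" "- M$2$2 \<noteq> 0 \<or> M$2$1 \<noteq> 0" using M(1) by (auto simp: det_2)
  obtain k where k: "k \<noteq> 0" "fst (hv \<beta>) = k * (- M$1$2)" "snd (hv \<beta>) = k * M$1$1"
    unfolding ba by (rule hv_pt[OF nz(1)])
  obtain l where l: "l \<noteq> 0" "fst (hv \<alpha>) = l * (- M$2$2)" "snd (hv \<alpha>) = l * M$2$1"
    unfolding ba by (rule hv_pt[OF nz(2)])
  have fr: "is_frame M (\<beta>, \<alpha>)" unfolding is_frame_def fst_conv snd_conv k l using M by (simp add: algebra_simps)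
  have "\<beta> \<noteq> \<alpha>"
  proof
    assume e: "\<beta> = \<alpha>"
    have "M$2$1 * (k * (- M$1$2)) + M$2$2 * (k * M$1$1) = 0"
      using fr unfolding is_frame_def fst_conv snd_conv e[symmetric] k by simp
    then have "k * det M = 0" by (simp add: det_2 algebra_simps)
    then show False using k M by simp
  qed
  then show ?thesis using that[of "(\<beta>, \<alpha>)" M] fr M by simp
qed

text \<open>On the geodesic through \<open>P\<close> and \<open>Q\<close> the product
  \<open>FF * EE\<close> is constant. If \<open>X\<close> lay outside the segment, the value of
  \<open>EE\<close> would force \<open>l + m\<close> above or below 1, and \<open>FF\<close> would
  change in the same direction, spoiling the product.\<close>

lemma geo_segment_I:
  assumes I: "Im P > 0" "Im Q > 0" "Im X > 0" and c: "comb X l P m Q" "l \<ge> 0" "m \<ge> 0"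
  shows "X \<in> geo_segment P Q"
proof -
  obtain M \<omega> where M: "fst \<omega> \<noteq> snd \<omega>" "is_frame M \<omega>" "RR M P = 0" "RR M Q = 0" "EE M Q \<le> EE M P"
    by (rule geodesic_through[OF I(1,2)])
  have d: "det M > 0" using M by (simp add: is_frame_def)
  have X: "RR M X = 0" using comb_FRE(2)[OF c(1), of M] M by simp
  define D where "D = (det M)\<^sup>2"
  have FE: "FF M P * EE M P = D" "FF M Q * EE M Q = D" "FF M X * EE M X = D"
    using FF_EE_RR[OF I(1), of M] FF_EE_RR[OF I(2), of M] FF_EE_RR[OF I(3), of M] M X by (simp_all add: D_def)
  have pos: "EE M P > 0" "EE M Q > 0" "EE M X > 0" "FF M P > 0" "FF M Q > 0" "FF M X > 0"
    using I d by (simp_all add: EE_pos FF_pos)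
  have FPQ: "FF M P \<le> FF M Q"
  proof -
    have "FF M P * EE M Q \<le> FF M P * EE M P" using M pos by simp
    then have "FF M P * EE M Q \<le> FF M Q * EE M Q" using FE by simp
    then show ?thesis using pos by simp
  qed
  have EX: "EE M X = l * EE M P + m * EE M Q" and FX: "FF M X = l * FF M P + m * FF M Q"
    using comb_FRE[OF c(1), of M] by simp_all
  have up: "EE M X \<le> EE M P"
  proof (rule ccontr)
    assume "\<not> ?thesis"
    then have g: "EE M X > EE M P" by simp
    have "EE M X \<le> (l + m) * EE M P" unfolding EX using M(5) c by (simp add: distrib_right mult_left_mono)
    then have "1 * EE M P < (l + m) * EE M P" using g by simp
    then have "l + m > 1" using pos by (simp only: mult_less_cancel_right_pos)
    then have "1 * FF M P < (l + m) * FF M P" using pos by (simp only: mult_less_cancel_right_pos)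
    also have "\<dots> \<le> FF M X" unfolding FX using FPQ c by (simp add: distrib_right mult_left_mono)
    finally have "FF M P * EE M P < FF M X * EE M X" using g pos by (intro mult_strict_mono) auto
    then show False using FE by simp
  qed
  have dn: "EE M Q \<le> EE M X"
  proof (rule ccontr)
    assume "\<not> ?thesis"
    then have g: "EE M X < EE M Q" by simp
    have "(l + m) * EE M Q \<le> EE M X" unfolding EX using M(5) c by (simp add: distrib_right mult_left_mono)
    then have "(l + m) * EE M Q < 1 * EE M Q" using g by simp
    then have "l + m < 1" using pos by (simp only: mult_less_cancel_right_pos)
    then have lt: "(l + m) * FF M Q < 1 * FF M Q" using pos by (simp only: mult_less_cancel_right_pos)
    have "FF M X \<le> (l + m) * FF M Q" unfolding FX using FPQ c by (simp add: distrib_right mult_left_mono)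
    then have "FF M X < FF M Q" using lt by simp
    then have "FF M X * EE M X < FF M Q * EE M Q" using g pos by (intro mult_strict_mono) auto
    then show False using FE by simp
  qed
  obtain k where k: "k > 0" "\<And>t. t > 0 \<Longrightarrow> EE M (geo_point \<omega> t) = k / t"
    using geo_point_frame[OF M(2)] by metis
  obtain s where s: "s > 0" "P = geo_point \<omega> s" by (rule on_geodesic[OF M(2) I(1) M(3)])
  obtain u where u: "u > 0" "Q = geo_point \<omega> u" by (rule on_geodesic[OF M(2) I(2) M(4)])
  obtain t where t: "t > 0" "X = geo_point \<omega> t" by (rule on_geodesic[OF M(2) I(3) X])
  have "s \<le> t" "t \<le> u" using up dn k(2)[OF s(1)] k(2)[OF t(1)] k(2)[OF u(1)] k(1) s t u
    by (simp_all add: divide_le_cancel frac_le_eq field_simps)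
  moreover obtain \<beta> \<alpha> where w: "\<omega> = (\<beta>, \<alpha>)" by (cases \<omega>)
  moreover have "\<beta> \<noteq> \<alpha>" using M(1) w by simp
  ultimately show ?thesis unfolding geo_segment_def using s t u by blast
qed

text \<open>The quadratic form at the sum is \<open>l^2 + m^2 + 2 * l * m * CC P Q\<close>, which is
  positive; division by its root leads back to the hyperboloid.\<close>

lemma comb_exists:
  assumes I: "Im P > 0" "Im Q > 0" and lm: "l \<ge> 0" "m \<ge> 0" "l + m > 0"
  obtains X k where "Im X > 0" "k > 0" "comb X (k * l) P (k * m) Q"
proof -
  define v1 v2 v3 where v: "v1 = l * s1 P + m * s1 Q" "v2 = l * s2 P + m * s2 Q" "v3 = l * s3 P + m * s3 Q"
  have v3: "v3 > 0"
  proof (cases "l > 0")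
    case True then show ?thesis unfolding v using I lm by (simp add: s3_pos add_pos_nonneg less_imp_le)
  next
    case False
    then have "l = 0" "m > 0" using lm by simp_all
    then show ?thesis unfolding v using I by (simp add: s3_pos)
  qed
  have "v1 * v3 - v2\<^sup>2 = l\<^sup>2 * (s1 P * s3 P - (s2 P)\<^sup>2) + m\<^sup>2 * (s1 Q * s3 Q - (s2 Q)\<^sup>2) + 2 * l * m * CC P Q"
    unfolding v CC_def by (simp add: power2_eq_square field_simps)
  then have e: "v1 * v3 - v2\<^sup>2 = l\<^sup>2 + m\<^sup>2 + 2 * l * m * CC P Q" by (simp add: s_norm I)
  have "l\<^sup>2 + m\<^sup>2 > 0" using lm by (auto simp: sum_power2_gt_zero_iff)
  moreover have "2 * l * m * CC P Q \<ge> 0" using lm CC_ge_1[OF I] by simp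
  ultimately have dp: "v1 * v3 - v2\<^sup>2 > 0" unfolding e by simp
  define n where "n = sqrt (v1 * v3 - v2\<^sup>2)"
  have n: "n > 0" "n\<^sup>2 = v1 * v3 - v2\<^sup>2" using dp by (simp_all add: n_def)
  define X where "X = Complex (v2 / v3) (n / v3)"
  have IX: "Im X > 0" using n v3 by (simp add: X_def)
  have "s3 X = v3 / n" "s2 X = v2 / n" using n v3 by (simp_all add: X_def s3_def s2_def)
  moreover have "s1 X = v1 / n"
  proof -
    have "s1 X = (v2\<^sup>2 + n\<^sup>2) / (v3 * n)" using n v3 by (simp add: X_def s1_def field_simps power2_eq_square)
    also have "v2\<^sup>2 + n\<^sup>2 = v1 * v3" using n by simp
    finally show ?thesis using v3 by simp
  qed
  ultimately have "comb X (1 / n * l) P (1 / n * m) Q" unfolding comb_def v by (simp add: add_divide_distrib)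
  then show ?thesis using that[of X "1 / n"] IX n by simp
qed

section \<open>The first and last point of a geodesic in the heptagon\<close>

text \<open>Tells in the frame on which side of the circle |z|^2 = eta a point lies. On the geodesic
  \<open>RR M\<close> vanishes, and the coefficients of \<open>FF\<close> and \<open>EE\<close> have
  signs given by the sides of the two endpoints.\<close>

lemma circle_identity:
  "(eta * s3 \<tau> - s1 \<tau>) * (det M)\<^sup>2 = FF M \<tau> * (eta * (M$2$1)\<^sup>2 - (M$2$2)\<^sup>2)
     + EE M \<tau> * (eta * (M$1$1)\<^sup>2 - (M$1$2)\<^sup>2)
     - 2 * RR M \<tau> * (eta * M$1$1 * M$2$1 - M$1$2 * M$2$2)"
  unfolding FF_def EE_def RR_def det_2 by algebra

lemma edge_comb:
  assumes "P \<in> geo_segment tau3 tau3'"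
  obtains l m where "l \<ge> 0" "m \<ge> 0" "comb P l tau3 m tau3'" "Im P > 0"
    "P \<noteq> tau3' \<Longrightarrow> l > 0" "P \<noteq> tau3 \<Longrightarrow> m > 0"
proof -
  obtain l m where c: "l \<ge> 0" "m \<ge> 0" "comb P l tau3 m tau3'" "Im P > 0"
    by (rule geo_segment_comb[OF assms])
  have "l > 0" if "P \<noteq> tau3'"
  proof (rule ccontr)
    assume "\<not> l > 0"
    then have "l = 0" using c by simp
    then have "P = tau3'" using comb_single[OF comb_commute, of P tau3 m tau3'] c tau3'_s(1) by simp
    then show False using that by simp
  qed
  moreover have "m > 0" if "P \<noteq> tau3"
  proof (rule ccontr)
    assume "\<not> m > 0"
    then have "m = 0" using c by simp
    then have "P = tau3" using comb_single[of P l tau3 tau3'] c by simp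
    then show False using that by simp
  qed
  ultimately show ?thesis by (intro that[OF c])
qed

text \<open>The circle |z|^2 = eta carries the edge. The second endpoint is inside by definition,
  and the identity at the entry point forces the first one outside. The orientation then makes
  \<open>RR M\<close> larger at \<open>tau3\<close> than at \<open>tau3'\<close>, and its zero on
  the edge gives the signs.\<close>

lemma reduced_red:
  assumes fr: "is_frame M \<omega>" and rd: "reduced \<omega>"
  shows "red M"
proof -
  obtain \<alpha> where al: "snd \<omega> = PReal \<alpha>" "\<bar>\<alpha>\<bar> < sqrt eta" using rd unfolding reduced_def by blast
  obtain P Q where PQ: "meets_heptagon \<omega> P Q" "P \<in> edge 0"
    using rd unfolding reduced_def enters_from_def by blast
  obtain s where s: "s > 0" "P = geo_point \<omega> s" using PQ(1) unfolding meets_heptagon_def by blast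
  have Ps: "P \<in> geo_segment tau3 tau3'" "P \<noteq> tau3'" using PQ(2) unfolding edge_def by auto
  obtain l m where lm: "P \<noteq> tau3' \<Longrightarrow> l > 0" "m \<ge> 0" "comb P l tau3 m tau3'" "Im P > 0"
    by (rule edge_comb[OF Ps(1)]) blast
  note lm = lm(1)[OF Ps(2)] lm(2-)
  obtain k where g: "\<And>t. t > 0 \<Longrightarrow> RR M (geo_point \<omega> t) = 0" using geo_point_frame[OF fr] by metis
  have R0: "RR M P = 0" using g s by simp
  define a b c d where abcd: "a = M$1$1" "b = M$1$2" "c = M$2$1" "d = M$2$2"
  have det: "a * d - b * c > 0" using fr by (simp add: is_frame_def det_2 abcd)
  have dd: "d = - c * \<alpha>" using fr by (simp add: is_frame_def al abcd)
  have c0: "c \<noteq> 0" using det dd by auto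
  have "\<alpha>\<^sup>2 < eta"
  proof -
    have "\<bar>\<alpha>\<bar>\<^sup>2 < (sqrt eta)\<^sup>2" using al by (intro power_strict_mono) auto
    then show ?thesis by simp
  qed
  then have k1: "eta * c\<^sup>2 - d\<^sup>2 > 0" using c0 by (simp add: dd power_mult_distrib mult.commute)
  have "s1 P = eta * s3 P" using lm(3) by (simp add: comb_def tau3_s(1) tau3'_s algebra_simps)
  then have "FF M P * (eta * c\<^sup>2 - d\<^sup>2) + EE M P * (eta * a\<^sup>2 - b\<^sup>2) = 0"
    using circle_identity[of P M] R0 by (simp add: abcd)
  moreover have pos: "FF M P > 0" "EE M P > 0" using lm(4) fr by (simp_all add: FF_pos EE_pos is_frame_def)
  moreover have "FF M P * (eta * c\<^sup>2 - d\<^sup>2) > 0" using k1 pos by simp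
  ultimately have "EE M P * (eta * a\<^sup>2 - b\<^sup>2) < 0" by linarith
  then have k2: "eta * a\<^sup>2 - b\<^sup>2 < 0" using pos by (simp add: mult_less_0_iff)
  define r where "r = sqrt eta"
  have r: "r * r = eta" "r > 0" by (simp_all add: r_def)
  define x y x' y' where xy: "x = a * r + b" "y = c * r + d" "x' = a * r - b" "y' = c * r - d"
  define A B where AB: "A = a * c * eta + b * d" "B = a * d + b * c"
  have xx: "x * x' < 0" "y * y' > 0"
  proof -
    have "x * x' = eta * a\<^sup>2 - b\<^sup>2" "y * y' = eta * c\<^sup>2 - d\<^sup>2" unfolding xy r(1)[symmetric] by algebra+
    then show "x * x' < 0" "y * y' > 0" using k1 k2 by simp_all
  qed
  have "x * y' - x' * y = - 2 * (r * (a * d - b * c))" unfolding xy by algebra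
  moreover have "r * (a * d - b * c) > 0" using r det by simp
  ultimately have o: "x * y' < x' * y" by linarith
  have "x * y < 0 \<and> x' * y' > 0"
  proof (cases "y > 0")
    case True
    then have y': "y' > 0" using xx(2) by (simp add: zero_less_mult_iff)
    have "x < 0"
    proof (rule ccontr)
      assume "\<not> x < 0"
      then have "x > 0" "x' < 0" using xx(1) by (auto simp: mult_less_0_iff)
      then have "x * y' > 0" "x' * y < 0" using True y' by (simp_all add: mult_neg_pos)
      then show False using o by simp
    qed
    moreover from this have "x' > 0" using xx(1) by (simp add: mult_less_0_iff)
    ultimately show ?thesis using True y' by (simp add: mult_neg_pos)
  next
    case False
    then have y': "y < 0" "y' < 0" using xx(2) by (auto simp: zero_less_mult_iff)
    have "x > 0"
    proof (rule ccontr)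
      assume "\<not> x > 0"
      then have "x < 0" "x' > 0" using xx(1) by (auto simp: mult_less_0_iff)
      then have "x * y' > 0" "x' * y < 0" using y' by (simp_all add: mult_neg_neg mult_pos_neg)
      then show False using o by simp
    qed
    moreover from this have "x' < 0" using xx(1) by (simp add: mult_less_0_iff)
    ultimately show ?thesis using y' by (simp add: mult_neg_neg mult_pos_neg)
  qed
  moreover have "x * y = A + B * r" "x' * y' = A - B * r" unfolding xy AB r(1)[symmetric] by algebra+
  ultimately have "A + B * r < 0" "A - B * r > 0" by simp_all
  then have "B * r < 0" by linarith
  then have Bn: "B < 0" using r by (simp add: mult_less_0_iff)
  define z w where zw: "z = s3 tau3" "w = - s2 tau3"
  have zp: "z > 0" "w > 0" using tau3_s zw by simp_all
  have R3: "RR M tau3 = A * z - B * w"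
    unfolding RR_def tau3_s(1) by (simp add: abcd AB zw algebra_simps)
  have R3': "RR M tau3' = A * z + B * w"
    unfolding RR_def tau3'_s tau3_s(1) by (simp add: abcd AB zw algebra_simps)
  have lt: "RR M tau3' < RR M tau3" unfolding R3 R3' using Bn zp mult_neg_pos[of B w] by simp
  have sum: "l * RR M tau3 + m * RR M tau3' = 0" using R0 comb_FRE(2)[OF lm(3), of M] by simp
  have neg: "RR M tau3' < 0"
  proof (rule ccontr)
    assume "\<not> ?thesis"
    then have "m * RR M tau3' \<ge> 0" "l * RR M tau3 > 0" using lt lm by simp_all
    then show False using sum by simp
  qed
  have "m * RR M tau3' \<le> 0" using neg lm by (simp add: mult_nonneg_nonpos)
  then have "l * RR M tau3 \<ge> 0" using sum by linarith
  then have "RR M tau3 \<ge> 0" using lm by (simp add: zero_le_mult_iff)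
  then show ?thesis using neg fr by (simp add: red_def is_frame_def)
qed

lemma geo_convex_hull: "geo_convex (geo_convex hull S)"
proof (rule hull_in)
  fix T assume T: "Ball T geo_convex"
  show "geo_convex (\<Inter> T)"
    unfolding geo_convex_def
  proof (intro ballI Inter_greatest)
    fix P Q A assume PQ: "P \<in> \<Inter> T" "Q \<in> \<Inter> T" and A: "A \<in> T"
    have "P \<in> A" "Q \<in> A" by (rule InterD[OF PQ(1) A], rule InterD[OF PQ(2) A])
    moreover have "geo_convex A" using T A by (rule bspec)
    ultimately show "geo_segment P Q \<subseteq> A" unfolding geo_convex_def by blast
  qed
qed

lemma triangle_segment:
  "geo_segment P R \<subseteq> geo_triangle P Q R" "geo_segment R Q \<subseteq> geo_triangle P Q R"
proof -
  have i: "P \<in> geo_triangle P Q R" "Q \<in> geo_triangle P Q R" "R \<in> geo_triangle P Q R"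
    unfolding geo_triangle_def by (rule hull_inc, simp)+
  have "geo_convex (geo_triangle P Q R)" unfolding geo_triangle_def by (rule geo_convex_hull)
  then have sub: "geo_segment A B \<subseteq> geo_triangle P Q R" if "A \<in> geo_triangle P Q R" "B \<in> geo_triangle P Q R" for A B
    using that unfolding geo_convex_def by simp
  show "geo_segment P R \<subseteq> geo_triangle P Q R" "geo_segment R Q \<subseteq> geo_triangle P Q R"
    by (intro sub i)+
qed

text \<open>The convex hull is needed only from below: this spoke and, in the next lemma, the one to
  the vertex before \<open>tau3\<close> supply all the points of the heptagon that are
  required.\<close>

lemma heptagon_first:
  assumes "Im X > 0" "comb X l tau7 m tau3'" "l \<ge> 0" "m \<ge> 0"
  shows "X \<in> heptagon"
proof -
  have "X \<in> geo_segment tau7 tau3'"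
    by (rule geo_segment_I[OF _ _ _ assms(2)]) (use assms tau3'_s(1) in auto)
  then have "X \<in> geo_triangle tau3 tau3' tau7" by (rule subsetD[OF triangle_segment(2)])
  then have "moebius (mat_pow g7 0) X \<in> heptagon" unfolding heptagon_def by (intro UN_I[of 0] imageI) simp_all
  then show ?thesis by simp
qed

lemma heptagon_last:
  assumes "Im X > 0" "comb X l tau3 m tau7" "l \<ge> 0" "m \<ge> 0"
  shows "moebius (mat_pow g7 6) X \<in> heptagon"
proof -
  have "X \<in> geo_segment tau3 tau7"
    by (rule geo_segment_I[OF _ _ _ assms(2)]) (use assms in auto)
  then have "X \<in> geo_triangle tau3 tau3' tau7" by (rule subsetD[OF triangle_segment(1)])
  then show ?thesis unfolding heptagon_def by (intro UN_I[of 6] imageI) simp_all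
qed

text \<open>For determinant 1, \<open>FF\<close> and \<open>EE\<close> are \<open>s1\<close> and
  \<open>s3\<close> of the moved point; so the vertex before \<open>tau3\<close> lies strictly
  inside the circle |z|^2 = eta.\<close>

lemma V6_inside: "eta * EE (mat_pow g7 6) tau3 > FF (mat_pow g7 6) tau3"
proof -
  have "adj2 g7 ** (g7 ** mat_pow g7 6) = - adj2 g7"
    using g7_7 by (simp add: eval_nat_numeral mult_minus_right2)
  then have e: "mat_pow g7 6 = - adj2 g7" by (simp add: matrix_mul_assoc adj2_mult det_g7)
  define a b c z w where d: "a = g7$1$1" "b = - g7$1$2" "c = g7$2$1" "z = s3 tau3" "w = - s2 tau3"
  define t where "t = sqrt (4 - (g7$1$1 + g7$2$2)\<^sup>2)"
  have t: "t > 0" unfolding t_def using g7_elliptic by simp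
  note p = tau7_props(3-5)[folded t_def]
  have "2 * b / t > 0" using tau7_s(5) unfolding p by (simp add: d)
  then have b: "b > 0" using t by (simp add: zero_less_divide_iff)
  have "2 * b / t < eta * (2 * c / t)" using tau7_s(2) unfolding p by (simp add: d)
  then have "2 * b < eta * (2 * c)" using t by (simp add: field_simps)
  then have bc: "b < eta * c" by simp
  have a: "a > 0" using g7_trace lam_pos by (simp add: d)
  have c: "c > 0" using g7_elliptic by (simp add: d)
  have zw: "z > 0" "w > 0" using tau3_s by (simp_all add: d)
  have "eta * EE (mat_pow g7 6) tau3 - FF (mat_pow g7 6) tau3
     = ((eta * c)\<^sup>2 - b\<^sup>2) * z + 2 * eta * c * a * w + 2 * a * b * w"
    unfolding e EE_def FF_def using tau3_s(1) g7_trace(2)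
    by (simp add: d power2_eq_square algebra_simps)
  moreover have "b\<^sup>2 < (eta * c)\<^sup>2" using bc b by (intro power_strict_mono) auto
  moreover have "((eta * c)\<^sup>2 - b\<^sup>2) * z > 0" using calculation(2) zw by simp
  moreover have "2 * eta * c * a * w \<ge> 0" "2 * a * b * w \<ge> 0" using a b c zw by simp_all
  ultimately show ?thesis by linarith
qed

text \<open>A geodesic satisfying \<open>red\<close> has its first endpoint outside and its second
  inside the circle, so it crosses the circle once, inwards, and \<open>EE\<close> decreases on the
  way.\<close>

lemma inside_circle_later:
  assumes M: "red M" and P: "Im P > 0" "RR M P = 0" "eta * s3 P > s1 P"
    and Q: "Im Q > 0" "RR M Q = 0" "eta * s3 Q = s1 Q"
  shows "EE M P < EE M Q"
proof (rule ccontr)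
  assume "\<not> ?thesis"
  then have le: "EE M Q \<le> EE M P" by simp
  define k1 k2 where k: "k1 = eta * (M$2$1)\<^sup>2 - (M$2$2)\<^sup>2" "k2 = (M$1$2)\<^sup>2 - eta * (M$1$1)\<^sup>2"
  have kp: "k1 > 0" "k2 > 0" using red_ends[OF M] by (simp_all add: k)
  have d: "det M > 0" using M by (simp add: red_def)
  have "0 < (eta * s3 P - s1 P) * (det M)\<^sup>2" using P d by simp
  then have 1: "EE M P * k2 < FF M P * k1" unfolding circle_identity P(2) by (simp add: k algebra_simps)
  have "0 = (eta * s3 Q - s1 Q) * (det M)\<^sup>2" using Q by simp
  then have 2: "EE M Q * k2 = FF M Q * k1" unfolding circle_identity Q(2) by (simp add: k algebra_simps)
  have pos: "EE M P > 0" "EE M Q > 0" "FF M P > 0" "FF M Q > 0" using P Q d by (simp_all add: EE_pos FF_pos)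
  have fe: "FF M P * EE M P = FF M Q * EE M Q" using FF_EE_RR[OF P(1), of M] FF_EE_RR[OF Q(1), of M] P Q by simp
  have "FF M Q * k1 \<le> EE M P * k2" unfolding 2[symmetric] using le kp by simp
  then have "FF M Q * k1 < FF M P * k1" using 1 by linarith
  then have "FF M Q < FF M P" using kp by simp
  then have "FF M Q * EE M Q < FF M P * EE M P" using le pos by (intro mult_less_le_imp_less) auto
  then show False using fe by simp
qed

text \<open>In the exceptional configuration, where the geodesic enters at the vertex \<open>tau3\<close> and
  stays in the heptagon, the last point of the edge is not the last point in the heptagon.\<close>
lemma later_point:
  assumes M: "red M" and r0: "RR M tau3 = 0" and r6: "RR (M ** mat_pow g7 6) tau3 \<ge> 0"
    and Q: "Im Q > 0" "comb Q l tau3 m tau3'" "l \<ge> 0" "m > 0" "RR (M ** mat_pow g7 6) Q = 0"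
  obtains p where "p \<in> heptagon" "Im p > 0" "RR M p = 0" "EE M p < EE (M ** mat_pow g7 6) Q"
proof -
  define g where "g = mat_pow g7 6"
  have dg: "det g = 1" unfolding g_def by (simp add: det_mat_pow det_g7)
  define N where "N = M ** g"
  have dM: "det M > 0" using M by (simp add: red_def)
  have dN: "det N > 0" using dM dg by (simp add: N_def det_mul)
  have N_eq: "RR M (moebius g z) = RR N z" "EE M (moebius g z) = EE N z" "FF M (moebius g z) = FF N z" if "Im z > 0" for z
    unfolding N_def using FRE_mult1[OF that dg, of M] by simp_all
  \<comment> \<open>The last edge ends where the first begins: since \<open>g7\<close> to the power
    7 is -1, this value is the one at \<open>tau3\<close>.\<close>
  have N3': "RR N tau3' = 0"
  proof -
    have "RR N tau3' = RR (M ** mat_pow g7 (Suc 6)) tau3"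
      unfolding N_def g_def by (rule RR_g7_Suc[symmetric])
    then show ?thesis using r0 by (simp add: g7_7 mult_minus_right2 RR_minus del: mat_pow.simps)
  qed
  have g3': "moebius g tau3' = tau3"
  proof -
    have "moebius g tau3' = moebius (g ** g7) tau3"
      unfolding tau3'_g7 by (rule moebius_mult[symmetric]) (simp_all add: dg det_g7)
    also have "g ** g7 = mat_pow g7 7" using mat_pow_Suc_right[of g7 6] by (simp add: g_def del: mat_pow.simps)
    finally show ?thesis by (simp add: g7_7 moebius_minus del: mat_pow.simps)
  qed
  have E3': "EE N tau3' = EE M tau3" using N_eq(2)[OF tau3'_s(1)] g3' by simp
  have R3: "RR N tau3 \<ge> 0" using r6 by (simp add: N_def g_def)
  have lz: "l * RR N tau3 = 0" using comb_FRE(2)[OF Q(2), of N] Q(5) N3' by (simp add: N_def g_def)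
  have V6: "eta * s3 (moebius g tau3) > s1 (moebius g tau3)"
    using V6_inside moebius_s[of tau3 g] dg by (simp add: g_def)
  have c3: "eta * s3 tau3 = s1 tau3" using tau3_s by simp
  \<comment> \<open>Either the geodesic contains the whole last edge, and its initial vertex
    \<open>moebius g tau3\<close> lies beyond the point given by \<open>Q\<close>; or
    \<open>Q\<close> is \<open>tau3'\<close>, which \<open>g\<close> moves to the entry vertex
    \<open>tau3\<close>.\<close>
  show ?thesis
  proof (cases "RR N tau3 = 0")
    case True
    define p where "p = moebius g tau3"
    have p: "Im p > 0" "RR M p = 0" unfolding p_def using True N_eq dg by (simp_all add: moebius_Im_pos)
    have ph: "p \<in> heptagon" unfolding p_def g_def
      by (rule heptagon_last[of tau3 1 0]) (simp_all add: comb_def)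
    have lt: "EE M p < EE M tau3"
      by (rule inside_circle_later[OF M p _ _ r0 c3]) (use V6 in \<open>simp_all add: p_def\<close>)
    then have lt': "EE N tau3 < EE N tau3'" unfolding E3' p_def by (simp add: N_eq)
    have FE: "FF N tau3 * EE N tau3 = (det N)\<^sup>2" "FF N tau3' * EE N tau3' = (det N)\<^sup>2" "FF N Q * EE N Q = (det N)\<^sup>2"
      using FF_EE_RR[of tau3 N] FF_EE_RR[of tau3' N] FF_EE_RR[of Q N] True N3' Q tau3'_s by (simp_all add: N_def g_def)
    have pos: "EE N tau3 > 0" "EE N tau3' > 0" "EE N Q > 0" "FF N tau3 > 0" "FF N tau3' > 0" "FF N Q > 0"
      using dN Q tau3'_s by (simp_all add: EE_pos FF_pos)
    have F': "FF N tau3' < FF N tau3"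
    proof (rule ccontr)
      assume "\<not> ?thesis"
      then have "FF N tau3 * EE N tau3 < FF N tau3' * EE N tau3'" using lt' pos by (intro mult_le_less_imp_less) auto
      then show False using FE by simp
    qed
    have EQ: "EE N Q = l * EE N tau3 + m * EE N tau3'" "FF N Q = l * FF N tau3 + m * FF N tau3'"
      using comb_FRE[OF Q(2), of N] by simp_all
    have "EE N tau3 < EE N Q"
    proof (rule ccontr)
      assume "\<not> ?thesis"
      then have le: "EE N Q \<le> EE N tau3" by simp
      have "m * EE N tau3 < m * EE N tau3'" using lt' Q by simp
      then have "(l + m) * EE N tau3 < 1 * EE N tau3" using le unfolding EQ by (simp add: algebra_simps)
      then have "l + m < 1" using pos by (simp only: mult_less_cancel_right_pos)
      then have 1: "(l + m) * FF N tau3 < 1 * FF N tau3" using pos by (simp only: mult_less_cancel_right_pos)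
      have "m * FF N tau3' \<le> m * FF N tau3" using F' Q by simp
      then have "FF N Q \<le> (l + m) * FF N tau3" unfolding EQ by (simp add: algebra_simps)
      then have "FF N Q < FF N tau3" using 1 by simp
      then have "FF N Q * EE N Q < FF N tau3 * EE N tau3" using le pos by (intro mult_less_le_imp_less) auto
      then show False using FE by simp
    qed
    then have "EE M p < EE N Q" by (simp add: p_def N_eq)
    then show ?thesis using that[of p] ph p by (simp add: N_def g_def)
  next
    case False
    then have r3: "RR N tau3 > 0" "l = 0" using R3 lz by simp_all
    have "Q = tau3'" using comb_single[OF comb_commute, of Q tau3 m tau3'] Q r3 tau3'_s(1) by simp
    then have EQ: "EE N Q = EE M tau3" using E3' by simp
    \<comment> \<open>Depending on the side of \<open>tau7\<close>, the geodesic meets the spoke to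
      \<open>tau3'\<close> or the spoke to \<open>moebius g tau3\<close>. In both cases the meeting
      point is strictly inside the circle, hence later than \<open>tau3\<close>.\<close>
    have "\<exists>p. p \<in> heptagon \<and> Im p > 0 \<and> RR M p = 0 \<and> eta * s3 p > s1 p"
    proof (cases "RR M tau7 \<ge> 0")
      case True
      have neg: "RR M tau3' < 0" using M by (simp add: red_def)
      obtain p k where p: "Im p > 0" "k > 0" "comb p (k * (- RR M tau3')) tau7 (k * RR M tau7) tau3'"
        by (rule comb_exists[of tau7 tau3' "- RR M tau3'" "RR M tau7"]) (use tau3'_s neg True in auto)
      have "p \<in> heptagon"
        by (rule heptagon_first[OF p(1,3)]) (use p neg True in \<open>simp_all add: mult_nonneg_nonpos\<close>)
      moreover have "RR M p = 0" using comb_FRE(2)[OF p(3), of M] by (simp add: algebra_simps)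
      moreover have "eta * s3 p - s1 p = k * (- RR M tau3') * (eta * s3 tau7 - s1 tau7)"
      proof -
        have e: "s1 p = k * (- RR M tau3') * s1 tau7 + k * RR M tau7 * s1 tau3'"
          "s3 p = k * (- RR M tau3') * s3 tau7 + k * RR M tau7 * s3 tau3'"
          using p(3) unfolding comb_def by blast+
        show ?thesis unfolding e tau3'_s(2,4) tau3_s(1) by (simp add: algebra_simps)
      qed
      moreover have "k * (- RR M tau3') * (eta * s3 tau7 - s1 tau7) > 0"
        using p neg tau7_s(2) by (intro mult_pos_pos) auto
      ultimately show ?thesis using p(1) by (intro exI[of _ p]) simp
    next
      case False
      have N7: "RR N tau7 = RR M tau7" using N_eq(1)[of tau7] by (simp add: g_def del: mat_pow.simps)
      obtain q k where q: "Im q > 0" "k > 0" "comb q (k * (- RR M tau7)) tau3 (k * RR N tau3) tau7"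
        by (rule comb_exists[of tau3 tau7 "- RR M tau7" "RR N tau3"]) (use False R3 in auto)
      define p where "p = moebius g q"
      have "p \<in> heptagon" unfolding p_def g_def
        by (rule heptagon_last[OF q(1,3)]) (use q False R3 in \<open>simp_all add: mult_nonneg_nonpos\<close>)
      moreover have "RR M p = 0" unfolding p_def N_eq(1)[OF q(1)] using comb_FRE(2)[OF q(3), of N] N7 by (simp add: algebra_simps)
      moreover have "eta * s3 p > s1 p"
      proof -
        have dgp: "det g > 0" using dg by simp
        have e: "eta * s3 (moebius g z) - s1 (moebius g z) = eta * EE g z - FF g z" if "Im z > 0" for z
          using moebius_s[OF that dgp] dg by simp
        have e7: "eta * s3 tau7 - s1 tau7 = eta * EE g tau7 - FF g tau7"
          using e[of tau7] by (simp add: g_def del: mat_pow.simps)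
        have "eta * s3 p - s1 p = k * (- RR M tau7) * (eta * EE g tau3 - FF g tau3) + k * RR N tau3 * (eta * EE g tau7 - FF g tau7)"
          unfolding p_def e[OF q(1)] comb_FRE[OF q(3)] by (simp add: algebra_simps)
        also have "\<dots> > 0"
        proof (rule add_pos_nonneg)
          show "0 < k * (- RR M tau7) * (eta * EE g tau3 - FF g tau3)"
            using q False V6_inside by (intro mult_pos_pos) (auto simp: g_def simp del: mat_pow.simps)
          show "0 \<le> k * RR N tau3 * (eta * EE g tau7 - FF g tau7)"
            unfolding e7[symmetric] using q R3 tau7_s(2) by simp
        qed
        finally show ?thesis by simp
      qed
      moreover have "Im p > 0" unfolding p_def using q dg by (simp add: moebius_Im_pos)
      ultimately show ?thesis by blast
    qed
    then obtain p where p: "p \<in> heptagon" "Im p > 0" "RR M p = 0" "eta * s3 p > s1 p" by blast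
    have "EE M p < EE M tau3" by (rule inside_circle_later[OF M p(2-4) _ r0 c3]) simp
    then show ?thesis using that[of p] p EQ by (simp add: N_def g_def)
  qed
qed

text \<open>The exit point lies on edge \<open>i\<close>, so the signs at its ends either satisfy
  \<open>leav\<close> or descend weakly. A descent contradicts \<open>unique_descent\<close>, except
  for \<open>i = 6\<close> with \<open>tau3\<close> on the geodesic; there
  \<open>later_point\<close> provides a later point of the heptagon.\<close>

lemma leaves_leav:
  assumes fr: "is_frame M \<omega>" and M: "red M" and lv: "leaves_from \<omega> i" and i: "i \<in> {1..6}"
  shows "leav M i"
proof (rule ccontr)
  assume not: "\<not> leav M i"
  have dM: "det M > 0" using M by (simp add: red_def)
  define r where "r n = RR (M ** mat_pow g7 n) tau3" for n
  have rec: "r (n + 3) = (1 + eta) * (r (n + 2) - r (n + 1)) + r n" for n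
    unfolding r_def by (rule RR_recurrence)
  have r': "RR (M ** mat_pow g7 n) tau3' = r (n + 1)" for n
    using RR_g7_Suc[of M n] by (simp add: r_def del: mat_pow.simps)
  have r01: "r 0 \<ge> 0" "r 1 < 0" using M r'[of 0] by (simp_all add: red_def r_def)
  obtain P Q where PQ: "meets_heptagon \<omega> P Q" "Q \<in> edge' i" using lv unfolding leaves_from_def by blast
  obtain s u where su: "0 < s" "s \<le> u" "{t. 0 < t \<and> geo_point \<omega> t \<in> heptagon} = {s..u}" "Q = geo_point \<omega> u"
    using PQ(1) unfolding meets_heptagon_def by blast
  obtain Q' where Q': "Q' \<in> geo_segment tau3 tau3'" "Q' \<noteq> tau3" "Q = moebius (mat_pow g7 i) Q'"
    using PQ(2) unfolding edge'_def by blast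
  obtain l m where lm: "l \<ge> 0" "Q' \<noteq> tau3 \<Longrightarrow> m > 0" "comb Q' l tau3 m tau3'" "Im Q' > 0"
    by (rule edge_comb[OF Q'(1)]) blast
  note lm = lm(1) lm(2)[OF Q'(2)] lm(3-)
  obtain c where c: "c > 0" "\<And>t. t > 0 \<Longrightarrow> RR M (geo_point \<omega> t) = 0" "\<And>t. t > 0 \<Longrightarrow> EE M (geo_point \<omega> t) = c / t"
    using geo_point_frame[OF fr] by metis
  have u: "u > 0" using su by simp
  have dg: "det (mat_pow g7 n) = 1" for n by (simp add: det_mat_pow det_g7)
  have RQ: "RR (M ** mat_pow g7 i) Q' = 0" "EE (M ** mat_pow g7 i) Q' = c / u"
    using c(2,3)[OF u] FRE_mult1(2,3)[OF lm(4) dg, of M i] Q'(3) su(4) by simp_all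
  have sum: "l * r i + m * r (i + 1) = 0"
    using RQ(1) comb_FRE(2)[OF lm(3), of "M ** mat_pow g7 i"] r'[of i] by (simp add: r_def)
  have ri: "r i \<ge> 0"
  proof (rule ccontr)
    assume n: "\<not> r i \<ge> 0"
    then have "l * r i \<le> 0" using lm by (simp add: mult_nonneg_nonpos)
    then have "m * r (i + 1) \<ge> 0" using sum by linarith
    then have "r (i + 1) \<ge> 0" using lm by (simp add: zero_le_mult_iff)
    then show False using not n dM r'[of i] by (simp add: leav_def r_def)
  qed
  have "l * r i \<ge> 0" using ri lm by simp
  then have "m * r (i + 1) \<le> 0" using sum by linarith
  then have ri1: "r (i + 1) \<le> 0" using lm by (simp add: mult_le_0_iff)
  have i6: "i = 6"
  proof (rule ccontr)
    assume "i \<noteq> 6"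
    then have "i \<in> {1..5}" using i by auto
    from unique_descent[of r, OF rec r01 this ri ri1] show False .
  qed
  have "r 7 = r 0" using recurrence_period[of r, OF rec, of 0] by simp
  then have "r 0 = 0" using ri1 i6 r01 by simp
  then have r0: "RR M tau3 = 0" by (simp add: r_def)
  obtain p where p: "p \<in> heptagon" "Im p > 0" "RR M p = 0" "EE M p < EE (M ** mat_pow g7 6) Q'"
    by (rule later_point[OF M r0 _ lm(4,3,1,2)]) (use ri RQ(1) in \<open>simp_all add: i6 r_def del: mat_pow.simps\<close>)
  obtain t where t: "t > 0" "p = geo_point \<omega> t" by (rule on_geodesic[OF fr p(2,3)])
  have "t \<in> {s..u}" using t p(1) su(3) by blast
  then have "t \<le> u" by simp
  moreover have "c / t < c / u" using p(4) RQ(2) c(3)[OF t(1)] t(2) by (simp add: i6)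
  then have "u < t" using c(1) t u by (simp add: field_simps)
  ultimately show False by simp
qed

section \<open>The chain of tiles of an expansion\<close>

lemma det_gcf_A: "det (gcf_A i k) = 1"
  by (simp add: gcf_A_def det_mul det_mat_pow det_g7 det_g2)

lemma gcf_A_Delta: "gcf_A i k \<in> Delta237"
  unfolding gcf_A_def by (intro Delta237_mult mat_pow_Delta237 g7_Delta g2_Delta)

definition gB :: "(nat \<Rightarrow> nat) \<Rightarrow> nat \<Rightarrow> mat2" where "gB i k = gcf_B (mat 1) i k"

lemma gB_simps [simp]: "gB i 0 = mat 1" "gB i (Suc k) = gB i k ** gcf_A i (Suc k)"
  by (simp_all add: gB_def)

lemma gcf_B_eq: "gcf_B B0 i k = B0 ** gB i k"
  by (induction k) (simp_all add: matrix_mul_assoc)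

lemma gB_Delta: "gB i k \<in> Delta237"
  by (induction k) (simp_all add: Delta237_1 Delta237_mult gcf_A_Delta)

lemma det_gB: "det (gB i k) = 1" by (rule Delta237_det[OF gB_Delta])

lemma gcf_step_Suc: "gcf_step \<omega> i k = geo_act (gcf_A i (Suc k)) (gcf_step \<omega> i (Suc k))"
  by (simp add: matrix_inv_adj2 det_gcf_A geo_act_adj2)

lemma gcf_step_gB: "\<omega> = geo_act (gB i k) (gcf_step \<omega> i k)"
proof (induction k)
  case (Suc k)
  have "geo_act (gB i (Suc k)) (gcf_step \<omega> i (Suc k)) = geo_act (gB i k) (geo_act (gcf_A i (Suc k)) (gcf_step \<omega> i (Suc k)))"
    unfolding gB_simps by (rule geo_act_mult) (simp add: det_gcf_A)
  also have "geo_act (gcf_A i (Suc k)) (gcf_step \<omega> i (Suc k)) = gcf_step \<omega> i k" by (rule gcf_step_Suc[symmetric])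
  also have "geo_act (gB i k) (gcf_step \<omega> i k) = \<omega>" by (rule Suc.IH[symmetric])
  finally show ?case by (rule sym)
qed simp

text \<open>Only the initial geodesic is reduced by assumption; the sign condition
  \<open>red\<close> passes on by \<open>leav_red\<close>. With the frame \<open>M ** gB i k\<close>
  for the k-th geodesic, all tiles are compared in the single frame \<open>M\<close>.\<close>

lemma chain:
  assumes fr: "is_frame M \<omega>" and g: "is_gcf \<omega> i"
  shows "is_frame (M ** gB i k) (gcf_step \<omega> i k) \<and> red (M ** gB i k) \<and> leav (M ** gB i k) (i (Suc k))"
proof (induction k)
  case 0
  have "reduced \<omega>" using g unfolding is_gcf_def by (rule conjunct1)
  then have r: "red M" by (rule reduced_red[OF fr])
  have "i (Suc 0) \<in> {1..6} \<and> leaves_from (gcf_step \<omega> i 0) (i (Suc 0))"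
    using g unfolding is_gcf_def by (rule conjunct2[THEN spec])
  then have i: "i (Suc 0) \<in> {1..6}" "leaves_from \<omega> (i (Suc 0))" by (simp_all only: gcf_step.simps(1))
  have "leav M (i (Suc 0))" by (rule leaves_leav[OF fr r i(2,1)])
  with r fr show ?case by (simp only: gB_simps(1) gcf_step.simps(1) matrix_mul_rid)
next
  case (Suc k)
  have "is_frame (M ** gB i k) (gcf_step \<omega> i k)" using Suc by (rule conjunct1)
  then have "is_frame (M ** gB i k) (geo_act (gcf_A i (Suc k)) (gcf_step \<omega> i (Suc k)))"
    by (simp only: gcf_step_Suc[of \<omega> i k])
  from is_frame_act[OF this det_gcf_A]
  have f: "is_frame (M ** gB i (Suc k)) (gcf_step \<omega> i (Suc k))" by (simp only: gB_simps matrix_mul_assoc)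
  have r: "red (M ** gB i (Suc k))"
    using leav_red[of "M ** gB i k" "i (Suc k)"] Suc by (simp only: gB_simps matrix_mul_assoc gcf_A_def)
  have i: "i (Suc (Suc k)) \<in> {1..6} \<and> leaves_from (gcf_step \<omega> i (Suc k)) (i (Suc (Suc k)))"
    using g unfolding is_gcf_def by (rule conjunct2[THEN spec])
  have "leav (M ** gB i (Suc k)) (i (Suc (Suc k)))"
    by (rule leaves_leav[OF f r conjunct2[OF i] conjunct1[OF i]])
  with f r show ?case by (intro conjI)
qed

lemma chain_height:
  assumes "is_frame M \<omega>" "is_gcf \<omega> i" "k < l"
  shows "EE (M ** gB i l) tau7 < EE (M ** gB i k) tau7"
  using assms(3)
proof (induction l)
  case (Suc l)
  have "EE (M ** gB i (Suc l)) tau7 < EE (M ** gB i l) tau7"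
    using leav_height[of "M ** gB i l" "i (Suc l)"] chain[OF assms(1,2), of l]
    by (simp only: gB_simps matrix_mul_assoc gcf_A_def)
  then show ?case using Suc by (cases "k = l") auto
qed simp

text \<open>A downcrossing is unique among the edges of the heptagon, so the exit edge is determined.\<close>
lemma leav_unique:
  assumes M: "red M" and i: "leav M i" "i \<in> {1..6}" and j: "leav M j" "j \<in> {1..6}"
  shows "i = j"
proof (rule ccontr)
  assume "i \<noteq> j"
  define r where "r n = RR (M ** mat_pow g7 n) tau3" for n
  have rec: "r (n + 3) = (1 + eta) * (r (n + 2) - r (n + 1)) + r n" for n
    unfolding r_def by (rule RR_recurrence)
  have r': "RR (M ** mat_pow g7 n) tau3' = r (n + 1)" for n
    using RR_g7_Suc[of M n] by (simp add: r_def del: mat_pow.simps)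
  have r01: "r 0 \<ge> 0" "r 1 < 0" using M r'[of 0] by (simp_all add: red_def r_def)
  have lv: "r n < 0 \<and> r (n + 1) \<ge> 0" if "leav M n" for n using that r'[of n] by (simp add: leav_def r_def)
  have no: False if ab: "a < b" "b \<le> 6" "a \<ge> 1" "leav M a" "leav M b" for a b
  proof -
    \<comment> \<open>The last nonnegative value before \<open>b\<close>: right after it there is a
      descent besides the one at the entry edge.\<close>
    define n where "n = Max {k. a < k \<and> k < b \<and> r k \<ge> 0}"
    have "r (a + 1) \<ge> 0" "r b < 0" using lv ab by blast+
    then have "a + 1 \<noteq> b" by auto
    then have ne: "a + 1 \<in> {k. a < k \<and> k < b \<and> r k \<ge> 0}" using ab \<open>r (a + 1) \<ge> 0\<close> by simp
    have fin: "finite {k. a < k \<and> k < b \<and> r k \<ge> 0}" by (rule finite_subset[of _ "{..<b}"]) auto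
    have n: "a < n" "n < b" "r n \<ge> 0" using Max_in[OF fin] ne unfolding n_def by blast+
    have "r (n + 1) \<le> 0"
    proof (rule ccontr)
      assume p: "\<not> r (n + 1) \<le> 0"
      then have "n + 1 \<noteq> b" using \<open>r b < 0\<close> by auto
      then have "n + 1 \<in> {k. a < k \<and> k < b \<and> r k \<ge> 0}" using p n by simp
      then have "n + 1 \<le> n" unfolding n_def by (rule Max_ge[OF fin])
      then show False by simp
    qed
    then show False using unique_descent[of r, OF rec r01 _ n(3)] n ab by simp
  qed
  show False using no[of i j] no[of j i] i j \<open>i \<noteq> j\<close> by (cases "i < j") auto
qed

section \<open>Periodicity and finiteness\<close>

lemma is_frame_unique:
  assumes "is_frame M \<omega>" "is_frame M \<omega>'" shows "\<omega> = \<omega>'"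
proof -
  define a b c d where abcd: "a = M$1$1" "b = M$1$2" "c = M$2$1" "d = M$2$2"
  have det: "a * d - b * c > 0" using assms(1) by (simp add: is_frame_def det_2 abcd)
  have one: "p = q" if "u * fst (hv p) + v * snd (hv p) = 0" "u * fst (hv q) + v * snd (hv q) = 0" "u \<noteq> 0 \<or> v \<noteq> 0" for u v p q
    using that by (cases p; cases q) (auto simp: add_eq_0_iff)
  have "fst \<omega> = fst \<omega>'" by (rule one[of a _ b]) (use assms det in \<open>auto simp: is_frame_def abcd\<close>)
  moreover have "snd \<omega> = snd \<omega>'" by (rule one[of c _ d]) (use assms det in \<open>auto simp: is_frame_def abcd\<close>)
  ultimately show ?thesis by (rule prod_eqI)
qed

lemma is_frame_diagI:
  assumes "is_frame M \<omega>" "k * l > 0" shows "is_frame (mat22 k 0 0 l ** M) \<omega>"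
proof -
  have "det (mat22 k 0 0 l ** M) > 0" using assms by (simp add: det_mul is_frame_def)
  moreover have "k * (M$1$1 * fst (hv (fst \<omega>)) + M$1$2 * snd (hv (fst \<omega>))) = 0"
    "l * (M$2$1 * fst (hv (snd \<omega>)) + M$2$2 * snd (hv (snd \<omega>))) = 0" using assms(1) by (simp_all add: is_frame_def)
  ultimately show ?thesis unfolding is_frame_def by (simp add: algebra_simps)
qed

lemma red_frame: assumes "is_frame M \<omega>" "is_frame N \<omega>" "red M" shows "red N"
proof -
  obtain k l where kl: "k * l > 0" "N = mat22 k 0 0 l ** M" by (rule is_frame_diag[OF assms(1,2)])
  have "det N > 0" using assms(2) by (simp add: is_frame_def)
  then show ?thesis using assms(3) kl unfolding red_def kl(2) RR_diag by (simp add: mult_less_0_iff)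
qed

lemma leav_frame: assumes "is_frame M \<omega>" "is_frame N \<omega>" "leav M i" shows "leav N i"
proof -
  obtain k l where kl: "k * l > 0" "N = mat22 k 0 0 l ** M" by (rule is_frame_diag[OF assms(1,2)])
  have "det N > 0" using assms(2) by (simp add: is_frame_def)
  then show ?thesis using assms(3) kl unfolding leav_def kl(2) matrix_mul_assoc[symmetric] RR_diag by (simp add: mult_less_0_iff)
qed

lemma adj2_mult_distrib: "adj2 (A ** B) = adj2 B ** adj2 A"
  unfolding mat2_eq_iff by simp

lemma gcf_step_A: "gcf_step \<omega> i k = geo_act (mat_pow g7 (i (Suc k)) ** g2) (gcf_step \<omega> i (Suc k))"
  using gcf_step_Suc[of \<omega> i k] unfolding gcf_A_def .

text \<open>The entering edge of a geodesic determines the previous step of the expansion.\<close>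
lemma step_backward:
  assumes fr: "is_frame M \<omega>" and g: "is_gcf \<omega> i"
    and eq: "gcf_step \<omega> i (Suc k) = gcf_step \<omega> i (Suc l)"
  shows "gcf_step \<omega> i k = gcf_step \<omega> i l"
proof -
  define \<nu> where "\<nu> = gcf_step \<omega> i (Suc k)"
  define N where "N = M ** gB i (Suc k)"
  have N: "is_frame N \<nu>" unfolding N_def \<nu>_def using chain[OF fr g] by blast
  define A where "A n = mat_pow g7 n ** g2" for n
  have dA: "det (A n) = 1" for n unfolding A_def by (simp add: det_mul det_mat_pow det_g7 det_g2)
  have k: "gcf_step \<omega> i k = geo_act (A (i (Suc k))) \<nu>" unfolding \<nu>_def A_def by (rule gcf_step_A)
  have l: "gcf_step \<omega> i l = geo_act (A (i (Suc l))) \<nu>" unfolding \<nu>_def eq A_def by (rule gcf_step_A)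
  have rd: "red (N ** adj2 (A (i (Suc j))))" if "gcf_step \<omega> i j = geo_act (A (i (Suc j))) \<nu>" for j
  proof -
    have "geo_act (adj2 (A (i (Suc j)))) (gcf_step \<omega> i j) = \<nu>"
      unfolding that by (rule geo_act_adj2(1)[OF dA])
    then have "is_frame N (geo_act (adj2 (A (i (Suc j)))) (gcf_step \<omega> i j))" using N by simp
    from is_frame_act[OF this] dA have "is_frame (N ** adj2 (A (i (Suc j)))) (gcf_step \<omega> i j)" by simp
    moreover have "is_frame (M ** gB i j) (gcf_step \<omega> i j)" "red (M ** gB i j)" using chain[OF fr g] by blast+
    ultimately show ?thesis using red_frame by blast
  qed
  have idx: "i (Suc j) \<in> {1..6}" for j using g unfolding is_gcf_def by blast
  \<comment> \<open>Different indices would give two predecessors of the same geodesic that differ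
    by a rotation about the centre, both satisfying \<open>red\<close>.\<close>
  have no: False if ab: "a < b" "b \<le> 6" "red (N ** adj2 (A a))" "red (N ** adj2 (A b))" for a b
  proof -
    have "mat_pow g7 b = mat_pow g7 (b - a) ** mat_pow g7 a"
      using mat_pow_add[of g7 "b - a" a] ab(1) by simp
    then have "adj2 (A b) ** mat_pow g7 (b - a) = adj2 g2 ** adj2 (mat_pow g7 a) ** (adj2 (mat_pow g7 (b - a)) ** mat_pow g7 (b - a))"
      unfolding A_def by (simp add: adj2_mult_distrib matrix_mul_assoc)
    also have "\<dots> = adj2 (A a)" unfolding A_def by (simp add: adj2_mult det_mat_pow det_g7 adj2_mult_distrib)
    finally have "N ** adj2 (A a) = (N ** adj2 (A b)) ** mat_pow g7 (b - a)" by (simp add: matrix_mul_assoc[symmetric])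
    then have "red ((N ** adj2 (A b)) ** mat_pow g7 (b - a))" using ab(3) by (simp only:)
    moreover have "b - a \<le> 6" using ab(2) by linarith
    ultimately have "b - a = 0" by (rule red_g7_pow[OF ab(4)])
    then show False using ab(1) by simp
  qed
  have "i (Suc k) = i (Suc l)"
  proof (rule ccontr)
    assume "i (Suc k) \<noteq> i (Suc l)"
    then consider "i (Suc k) < i (Suc l)" | "i (Suc l) < i (Suc k)" by linarith
    then show False using no[OF _ _ rd[OF k] rd[OF l]] no[OF _ _ rd[OF l] rd[OF k]] idx by cases auto
  qed
  then show ?thesis unfolding k l by simp
qed

lemma step_backward_0:
  assumes "is_frame M \<omega>" "is_gcf \<omega> i" "gcf_step \<omega> i k = gcf_step \<omega> i (k + l)"
  shows "gcf_step \<omega> i 0 = gcf_step \<omega> i l"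
  using assms(3)
proof (induction k)
  case (Suc k)
  have "gcf_step \<omega> i (Suc k) = gcf_step \<omega> i (Suc (k + l))" using Suc.prems by (simp only: add_Suc)
  from step_backward[OF assms(1,2) this] show ?case by (rule Suc.IH)
qed (simp only: add_0)

lemma step_periodic:
  assumes fr: "is_frame M \<omega>" and g: "is_gcf \<omega> i" and l: "gcf_step \<omega> i l = gcf_step \<omega> i 0"
  shows "gcf_step \<omega> i (k + l) = gcf_step \<omega> i k \<and> i (Suc k + l) = i (Suc k)"
proof -
  have idx: "i (Suc j) \<in> {1..6}" for j using g unfolding is_gcf_def by blast
  have same: "i (Suc j) = i (Suc k)" if "gcf_step \<omega> i j = gcf_step \<omega> i k" for j k
  proof -
    note cj = chain[OF fr g, of j] and ck = chain[OF fr g, of k]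
    have fj: "is_frame (M ** gB i j) (gcf_step \<omega> i k)" using cj unfolding that by (rule conjunct1)
    have "leav (M ** gB i k) (i (Suc j))"
      by (rule leav_frame[OF fj conjunct1[OF ck] conjunct2[OF conjunct2[OF cj]]])
    then show ?thesis using leav_unique[OF _ _ idx _ idx] ck by blast
  qed
  have "gcf_step \<omega> i (k + l) = gcf_step \<omega> i k"
  proof (induction k)
    case (Suc k)
    have e: "i (Suc (k + l)) = i (Suc k)" by (rule same[OF Suc])
    have "gcf_step \<omega> i (Suc (k + l)) = gcf_step \<omega> i (Suc k)"
      unfolding gcf_step.simps(2) gcf_A_def e Suc ..
    then show ?case by (simp only: add_Suc)
  qed (simp only: add_0 l)
  then show ?thesis using same[of "k + l" k] by (simp only: add_Suc)
qed

lemma gcf_geodesic_eq: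
  assumes "B0 \<in> Delta237"
  shows "gcf_geodesic B0 i \<omega> k = gcf_step (geo_act (matrix_inv B0) \<omega>) i k"
proof -
  define \<omega>0 where "\<omega>0 = geo_act (matrix_inv B0) \<omega>"
  have d: "det B0 = 1" using assms by (rule Delta237_det)
  have "geo_act (adj2 (gB i k)) \<omega>0 = gcf_step \<omega>0 i k"
  proof -
    have "geo_act (adj2 (gB i k)) (geo_act (gB i k) (gcf_step \<omega>0 i k)) = gcf_step \<omega>0 i k"
      by (rule geo_act_adj2(1)[OF det_gB])
    then show ?thesis by (simp only: gcf_step_gB[symmetric])
  qed
  moreover have "gcf_geodesic B0 i \<omega> k = geo_act (adj2 (gB i k)) \<omega>0"
  proof -
    have "det (B0 ** gB i k) = 1" using d by (simp add: det_mul det_gB)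
    then show ?thesis unfolding gcf_geodesic_def gcf_B_eq \<omega>0_def
      by (simp add: matrix_inv_adj2 d adj2_mult_distrib geo_act_mult)
  qed
  ultimately show ?thesis unfolding \<omega>0_def by simp
qed

text \<open>In the frame an element stabilizing the geodesic is diagonal, so it multiplies
  \<open>EE\<close> by one positive constant, the square of a diagonal entry. Quantification over
  all \<open>Z\<close> makes these constants multiplicative.\<close>

definition stab_scale :: "mat2 \<Rightarrow> geodesic \<Rightarrow> mat2 \<Rightarrow> real \<Rightarrow> bool" where
  "stab_scale M \<omega> X c \<longleftrightarrow> X \<in> Delta237 \<and> geo_act X \<omega> = \<omega> \<and> c > 0 \<and> (\<forall>Z \<tau>. EE (M ** (X ** Z)) \<tau> = c * EE (M ** Z) \<tau>)"

lemma stab_scale_exists: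
  assumes "is_frame M \<omega>" "X \<in> Delta237" "geo_act X \<omega> = \<omega>"
  obtains c where "stab_scale M \<omega> X c"
proof -
  have "is_frame M (geo_act X \<omega>)" unfolding assms(3) by (rule assms(1))
  from is_frame_act[OF this Delta237_det[OF assms(2)]] have f: "is_frame (M ** X) \<omega>" .
  obtain k l where kl: "k * l > 0" "M ** X = mat22 k 0 0 l ** M" by (rule is_frame_diag[OF assms(1) f])
  have "EE (M ** (X ** Z)) \<tau> = l\<^sup>2 * EE (M ** Z) \<tau>" for Z \<tau>
    unfolding matrix_mul_assoc kl(2) unfolding matrix_mul_assoc[symmetric] by (rule RR_diag(2))
  moreover have "l\<^sup>2 > 0" using kl(1) by auto
  ultimately have "stab_scale M \<omega> X (l\<^sup>2)" using assms unfolding stab_scale_def by blast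
  then show ?thesis by (rule that)
qed

lemma stab_scale_mult:
  assumes "stab_scale M \<omega> X c" "stab_scale M \<omega> Y d" shows "stab_scale M \<omega> (X ** Y) (c * d)"
proof -
  have "det Y \<noteq> 0" using assms(2) Delta237_det[of Y] by (simp add: stab_scale_def)
  then have "geo_act (X ** Y) \<omega> = \<omega>" using assms by (simp add: stab_scale_def geo_act_mult)
  then show ?thesis using assms
    by (simp add: stab_scale_def Delta237_mult matrix_mul_assoc[symmetric])
qed

lemma stab_scale_1: "stab_scale M \<omega> (mat 1) 1"
  by (simp add: stab_scale_def Delta237_1)

lemma stab_scale_adj:
  assumes "stab_scale M \<omega> X c" shows "stab_scale M \<omega> (adj2 X) (inverse c)"
proof -
  have X: "X \<in> Delta237" "geo_act X \<omega> = \<omega>" "c > 0" and e: "\<And>Z \<tau>. EE (M ** (X ** Z)) \<tau> = c * EE (M ** Z) \<tau>"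
    using assms by (simp_all add: stab_scale_def)
  have d: "det X = 1" using X(1) by (rule Delta237_det)
  have "geo_act (adj2 X) \<omega> = \<omega>" using geo_act_adj2(1)[OF d, of \<omega>] X(2) by simp
  moreover have "EE (M ** (adj2 X ** Z)) \<tau> = inverse c * EE (M ** Z) \<tau>" for Z \<tau>
  proof -
    have "EE (M ** (X ** (adj2 X ** Z))) \<tau> = c * EE (M ** (adj2 X ** Z)) \<tau>" by (rule e)
    moreover have "X ** (adj2 X ** Z) = Z" by (simp add: matrix_mul_assoc adj2_mult[OF d])
    ultimately show ?thesis using X(3) by (simp add: field_simps)
  qed
  ultimately show ?thesis using X by (simp add: stab_scale_def Delta237_adj)
qed

lemma stab_scale_pow: "stab_scale M \<omega> X c \<Longrightarrow> stab_scale M \<omega> (mat_pow X n) (c ^ n)"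
  by (induction n) (simp_all add: stab_scale_1 stab_scale_mult)

lemma stab_scale_powi:
  assumes "stab_scale M \<omega> X c" shows "stab_scale M \<omega> (mat_powi X k) (c powi k)"
proof -
  have "det X = 1" using assms Delta237_det by (simp add: stab_scale_def)
  then show ?thesis using stab_scale_pow[OF assms] stab_scale_pow[OF stab_scale_adj[OF assms]]
    by (simp add: mat_powi_def power_int_def matrix_inv_adj2)
qed

text \<open>The exponent is the integer part of the logarithm of \<open>x\<close> to the base
  \<open>Q\<close>; multiplication by a power of the period thus reaches one period of
  heights.\<close>

lemma powi_interval:
  fixes x Q :: real assumes "x > 0" "0 < Q" "Q < 1"
  obtains m where "Q powi (m + 1) < x" "x \<le> Q powi m"
proof -
  define s where "s = ln x / ln Q"
  define m where "m = \<lfloor>s\<rfloor>"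
  have l: "ln Q < 0" using assms by simp
  have x: "x = Q powr s" using assms l by (simp add: s_def powr_def)
  have p: "Q powi n = Q powr (real_of_int n)" for n using assms by (simp add: powr_real_of_int')
  have "x \<le> Q powi m" unfolding p x using assms by (intro powr_mono') (auto simp: m_def)
  moreover have "Q powi (m + 1) < x" unfolding p x
    using assms powr_less_mono'[of Q s "real_of_int (m + 1)"] by (simp add: m_def)
  ultimately show ?thesis using that by blast
qed

lemma mat_neg_one_act: "rp1_act (- M) p = rp1_act M p"
proof -
  have "rp1_act (- M) p = pt ((-1) * (M$1$1 * fst (hv p) + M$1$2 * snd (hv p))) ((-1) * (M$2$1 * fst (hv p) + M$2$2 * snd (hv p)))"
    unfolding rp1_act_pt by (simp add: algebra_simps)
  also have "\<dots> = rp1_act M p" unfolding rp1_act_pt by (rule pt_scale) simp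
  finally show ?thesis .
qed

text \<open>Multiplying by a power of the period matrix, the height of a stabilizing matrix falls into
  one period of the chain, where the previous lemma leaves only the chain itself.\<close>
lemma stabilizer_generated:
  assumes fr: "is_frame M \<omega>" and g: "is_gcf \<omega> i" and l: "l \<ge> 1" "gcf_step \<omega> i l = gcf_step \<omega> i 0"
    and min: "\<And>k. 1 \<le> k \<Longrightarrow> k < l \<Longrightarrow> gcf_step \<omega> i k \<noteq> gcf_step \<omega> i 0"
    and X: "X \<in> Delta237" "geo_act X \<omega> = \<omega>"
  obtains m where "X = mat_powi (gB i l) m \<or> X = - mat_powi (gB i l) m"
proof -
  define \<gamma> where "\<gamma> = gB i l"
  have gs: "geo_act (gB i k) (gcf_step \<omega> i k) = \<omega>" for k by (rule gcf_step_gB[symmetric])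
  have "geo_act \<gamma> \<omega> = \<omega>" using gs[of l] l(2) by (simp add: \<gamma>_def)
  then obtain Q where Q: "stab_scale M \<omega> \<gamma> Q"
    using stab_scale_exists[OF fr gB_Delta[of i l, folded \<gamma>_def]] by blast
  obtain c where c: "stab_scale M \<omega> X c" using stab_scale_exists[OF fr X] by blast
  define e where "e Z = EE (M ** Z) tau7" for Z
  have e1: "e (mat 1) > 0" unfolding e_def using EE_pos[of tau7 M] fr by (simp add: is_frame_def)
  have eQ: "e \<gamma> = Q * e (mat 1)" using Q unfolding stab_scale_def e_def by (metis matrix_mul_rid)
  have dec: "e (gB i j) < e (gB i k)" if "k < j" for k j unfolding e_def by (rule chain_height[OF fr g that])
  have "e \<gamma> < e (mat 1)" using dec[of 0 l] l(1) by (simp add: \<gamma>_def)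
  then have Q1: "0 < Q" "Q < 1" using e1 Q unfolding eQ by (simp_all add: stab_scale_def)
  have cp: "c > 0" using c by (simp add: stab_scale_def)
  obtain m where m: "Q powi (m + 1) < c" "c \<le> Q powi m" by (rule powi_interval[OF cp Q1])
  define G where "G = mat_powi \<gamma> m"
  have G: "stab_scale M \<omega> G (Q powi m)" unfolding G_def by (rule stab_scale_powi[OF Q])
  have dG: "det G = 1" using G Delta237_det by (simp add: stab_scale_def)
  define Y where "Y = adj2 G ** X"
  define c' where "c' = inverse (Q powi m) * c"
  have Y: "stab_scale M \<omega> Y c'" unfolding Y_def c'_def by (rule stab_scale_mult[OF stab_scale_adj[OF G] c])
  have Qp: "Q powi m > 0" using Q1 by simp
  have "Q powi (m + 1) = Q powi m * Q" using Q1 by (simp add: power_int_add)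
  then have c': "Q < c'" "c' \<le> 1" unfolding c'_def using m Qp by (simp_all add: field_simps)
  have eY: "e Y = c' * e (mat 1)" using Y unfolding stab_scale_def e_def by (metis matrix_mul_rid)
  have up: "e Y \<le> e (gB i 0)" using c' e1 unfolding eY by simp
  have lo: "e (gB i l) < e Y" using c' e1 unfolding eY eQ[unfolded \<gamma>_def] by simp
  \<comment> \<open>Its maximum is the last tile of the period that is at most as high as the tile
    of \<open>Y\<close>; large \<open>EE\<close> means low.\<close>
  define K where "K = {k. k \<le> l \<and> e Y \<le> e (gB i k)}"
  have fin: "finite K" unfolding K_def by (rule finite_subset[of _ "{..l}"]) auto
  have "0 \<in> K" unfolding K_def using up by simp
  define k where "k = Max K"
  have "k \<in> K" unfolding k_def using Max_in[OF fin] \<open>0 \<in> K\<close> by blast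
  then have k: "k \<le> l" "e Y \<le> e (gB i k)" by (simp_all add: K_def)
  have kl: "k < l" using k lo by (cases "k = l") auto
  have k1: "e (gB i (Suc k)) < e Y"
  proof (rule ccontr)
    assume "\<not> ?thesis"
    then have "Suc k \<in> K" using kl by (simp add: K_def)
    then have "Suc k \<le> k" unfolding k_def by (rule Max_ge[OF fin])
    then show False by simp
  qed
  define N where "N = M ** gB i k"
  have N: "red N" "leav N (i (Suc k))" unfolding N_def using chain[OF fr g] by blast+
  define Z where "Z = adj2 (gB i k) ** Y"
  have YD: "Y \<in> Delta237" "geo_act Y \<omega> = \<omega>" using Y by (simp_all add: stab_scale_def)
  have ZD: "Z \<in> Delta237" unfolding Z_def by (intro Delta237_mult Delta237_adj gB_Delta YD)
  have gZ: "gB i k ** Z = Y" unfolding Z_def by (simp add: matrix_mul_assoc adj2_mult det_gB)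
  have NZ: "N ** Z = M ** Y" unfolding N_def gZ[symmetric] by (simp add: matrix_mul_assoc)
  have "is_frame M (geo_act Y \<omega>)" unfolding YD(2) by (rule fr)
  from is_frame_act[OF this Delta237_det[OF YD(1)]] have fY: "is_frame (M ** Y) \<omega>" .
  have "red M" using chain[OF fr g, of 0] by simp
  then have rY: "red (N ** Z)" unfolding NZ using red_frame[OF fr fY] by blast
  note F = fundamental[OF N ZD rY]
  have NA: "N ** (mat_pow g7 (i (Suc k)) ** g2) = M ** gB i (Suc k)"
    unfolding N_def gB_simps gcf_A_def by (simp only: matrix_mul_assoc)
  \<comment> \<open>No height strictly between two consecutive tiles is possible, so
    \<open>Y\<close> has the height of tile \<open>k\<close>; the equality case then identifies the
    two up to sign.\<close>
  have "EE (N ** Z) tau7 = EE N tau7"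
    using F(1) k(2) k1 unfolding NA NZ unfolding N_def e_def by linarith
  from F(2)[OF this] have "Z = mat 1 \<or> Z = - mat 1" .
  then have Yk: "Y = gB i k \<or> Y = - gB i k" using gZ by (auto simp: mult_minus_right2)
  have "geo_act (gB i k) \<omega> = \<omega>"
    using Yk YD(2) by (auto simp: geo_act_def mat_neg_one_act)
  then have "geo_act (adj2 (gB i k)) \<omega> = \<omega>" using geo_act_adj2(1)[OF det_gB, of i k \<omega>] by simp
  moreover have "geo_act (adj2 (gB i k)) \<omega> = gcf_step \<omega> i k"
    using geo_act_adj2(1)[OF det_gB, of i k "gcf_step \<omega> i k"] gs[of k] by simp
  ultimately have "gcf_step \<omega> i k = gcf_step \<omega> i 0" by simp
  then have "k = 0" using min[of k] kl by (cases "k = 0") auto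
  then have "Y = mat 1 \<or> Y = - mat 1" using Yk by simp
  moreover have "X = G ** Y" unfolding Y_def by (simp add: matrix_mul_assoc adj2_mult[OF dG])
  ultimately have "X = G \<or> X = - G" by (auto simp: mult_minus_right2)
  then show ?thesis using that unfolding G_def \<gamma>_def by blast
qed

text \<open>The fixed determinant fixes its conjugates. At the two negative roots the norm form is
  definite and bounds all coordinates; at \<open>eta\<close> the bounded entries do. Hence the
  coordinates have bounded conjugates.\<close>

lemma finite_order_bounded:
  assumes "\<Theta> \<in> order_O"
  shows "finite {T \<in> order_O. det T = det \<Theta> \<and> \<bar>T$1$1\<bar> \<le> K \<and> \<bar>T$1$2\<bar> \<le> K \<and> \<bar>T$2$1\<bar> \<le> K \<and> \<bar>T$2$2\<bar> \<le> K}"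
    (is "finite ?S")
proof -
  define nn where "nn a b c d x = (oqA x (a x) (c x) (d x))\<^sup>2 - x * (oqB x (b x) (c x) (d x))\<^sup>2 - x * (c x)\<^sup>2 + x\<^sup>2 * (d x)\<^sup>2"
    for a b c d and x :: real
  from assms obtain a0 b0 c0 d0 where 0: "\<Theta> = oq (a0 eta) (b0 eta) (c0 eta) (d0 eta)" "ip a0" "ip b0" "ip c0" "ip d0"
    unfolding order_O_eq Zr_def by blast
  define n0 where "n0 x = nn a0 b0 c0 d0 x" for x
  have n0: "4 * det \<Theta> = n0 eta" "ip n0"
    using oq_norm_conj[OF 0(2-5) root_eta, of n0] unfolding 0(1) by (simp_all add: n0_def nn_def)
  define m where "m = Min {1, - eta2, - eta3, eta2\<^sup>2, eta3\<^sup>2}"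
  have m: "m > 0" "m \<le> 1" "m \<le> - eta2" "m \<le> - eta3" "m \<le> eta2\<^sup>2" "m \<le> eta3\<^sup>2"
    unfolding m_def using eta23_neg by (auto simp: min_def)
  \<comment> \<open>The summand 1 gives \<open>H - 1 <= H^2\<close>, so a bound for squares becomes
    one for absolute values without taking roots; \<open>4 * \<bar>K\<bar>\<close> serves the place
    \<open>eta\<close>.\<close>
  define H where "H = 1 + (\<bar>n0 eta2\<bar> + \<bar>n0 eta3\<bar>) / m + 4 * \<bar>K\<bar>"
  define V where "V = {v. \<exists>f. ip f \<and> v = f eta \<and> \<bar>f eta\<bar> \<le> H \<and> \<bar>f eta2\<bar> \<le> H \<and> \<bar>f eta3\<bar> \<le> H}"
  have finV: "finite V" unfolding V_def by (rule finite_ip_bounded)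
  have "?S \<subseteq> (\<lambda>(A, B, C, D). qmat (A/2) (B/2) (C/2) (D/2)) ` (V \<times> V \<times> V \<times> V)"
  proof
    fix T assume T: "T \<in> ?S"
    then obtain a b c d where R: "T = oq (a eta) (b eta) (c eta) (d eta)" "ip a" "ip b" "ip c" "ip d"
      unfolding order_O_eq Zr_def by blast
    define n where "n x = nn a b c d x" for x
    have n: "4 * det T = n eta" "ip n"
      using oq_norm_conj[OF R(2-5) root_eta, of n] unfolding R(1) by (simp_all add: n_def nn_def)
    have nx: "n x = n0 x" if "is_root x" for x
      using ip_zero[OF ip_diff[OF n(2) n0(2)] _ that] n(1) n0(1) T by simp
    define A B where AB: "A x = oqA x (a x) (c x) (d x)" "B x = oqB x (b x) (c x) (d x)" for x
    have ipA: "ip A" and ipB: "ip B" unfolding AB oqA_def oqB_def using R(2-5) by (simp_all add: ip_add ip_mult ip_power)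
    have conj: "\<bar>A x\<bar> \<le> H \<and> \<bar>B x\<bar> \<le> H \<and> \<bar>c x\<bar> \<le> H \<and> \<bar>d x\<bar> \<le> H" if x: "x = eta2 \<or> x = eta3" for x
    proof -
      have rx: "is_root x" and xn: "x < 0" using x root_eta23 eta23_neg by auto
      have mx: "m \<le> - x" "m \<le> x\<^sup>2" using x m by auto
      have sum: "(A x)\<^sup>2 + (- x) * (B x)\<^sup>2 + (- x) * (c x)\<^sup>2 + x\<^sup>2 * (d x)\<^sup>2 = n0 x"
        using nx[OF rx] unfolding n_def nn_def AB by simp
      have nonneg: "(A x)\<^sup>2 \<ge> 0" "(- x) * (B x)\<^sup>2 \<ge> 0" "(- x) * (c x)\<^sup>2 \<ge> 0" "x\<^sup>2 * (d x)\<^sup>2 \<ge> 0"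
        using xn by (simp_all add: mult_nonpos_nonneg)
      have "m * (A x)\<^sup>2 \<le> 1 * (A x)\<^sup>2" "m * (B x)\<^sup>2 \<le> (- x) * (B x)\<^sup>2"
        "m * (c x)\<^sup>2 \<le> (- x) * (c x)\<^sup>2" "m * (d x)\<^sup>2 \<le> x\<^sup>2 * (d x)\<^sup>2"
        using mx m(2) by (intro mult_right_mono; simp)+
      then have le: "m * (A x)\<^sup>2 \<le> n0 x" "m * (B x)\<^sup>2 \<le> n0 x" "m * (c x)\<^sup>2 \<le> n0 x" "m * (d x)\<^sup>2 \<le> n0 x"
        using sum nonneg by linarith+
      have bnd: "\<bar>u\<bar> \<le> H" if u: "m * u\<^sup>2 \<le> n0 x" for u
      proof -
        have "\<bar>n0 x\<bar> \<le> \<bar>n0 eta2\<bar> + \<bar>n0 eta3\<bar>" using x by auto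
        then have "n0 x / m \<le> (\<bar>n0 eta2\<bar> + \<bar>n0 eta3\<bar>) / m" using m(1) by (intro divide_right_mono) auto
        then have H: "n0 x / m \<le> H - 1" unfolding H_def by simp
        have "u\<^sup>2 \<le> n0 x / m" using u m(1) by (simp add: field_simps)
        then have u2: "u\<^sup>2 \<le> H - 1" using H by simp
        then have H1: "H \<ge> 1" using zero_le_power2[of u] by linarith
        have "H * 1 \<le> H * H" using H1 by (intro mult_left_mono) auto
        then have "H - 1 \<le> H * H" by simp
        then have "u\<^sup>2 \<le> H\<^sup>2" using u2 by (simp add: power2_eq_square)
        then show ?thesis using abs_le_square_iff[of u H] H1 by simp
      qed
      show ?thesis using bnd[OF le(1)] bnd[OF le(2)] bnd[OF le(3)] bnd[OF le(4)] by blast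
    qed
    have Tn: "T$1$1 = (A eta + c eta * sqrt eta) / 2" "T$2$2 = (A eta - c eta * sqrt eta) / 2"
      "T$2$1 = (B eta + d eta * sqrt eta) / 2" "T$1$2 = eta * ((B eta - d eta * sqrt eta) / 2)"
      unfolding R(1) oq_def AB by (simp_all add: add_divide_distrib diff_divide_distrib)
    have K0: "\<bar>K\<bar> \<ge> 0" "K \<le> \<bar>K\<bar>" by simp_all
    have TK: "\<bar>T$1$1\<bar> \<le> \<bar>K\<bar>" "\<bar>T$1$2\<bar> \<le> \<bar>K\<bar>" "\<bar>T$2$1\<bar> \<le> \<bar>K\<bar>" "\<bar>T$2$2\<bar> \<le> \<bar>K\<bar>" using T by auto
    have HK: "4 * \<bar>K\<bar> \<le> H" unfolding H_def using m(1) by simp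
    have small: "\<bar>v\<bar> \<le> 4 * \<bar>K\<bar>" if "\<bar>v * sqrt eta\<bar> \<le> 4 * \<bar>K\<bar>" for v
    proof -
      have "\<bar>v\<bar> * 1 \<le> \<bar>v\<bar> * sqrt eta" using sqrt_eta_bounds eta_bounds by (intro mult_left_mono) auto
      also have "\<dots> = \<bar>v * sqrt eta\<bar>" by (simp add: abs_mult)
      finally show ?thesis using that by simp
    qed
    define w where "w = (B eta - d eta * sqrt eta) / 2"
    have "\<bar>w\<bar> * 1 \<le> \<bar>w\<bar> * eta" using eta_bounds by (intro mult_left_mono) auto
    then have wK: "\<bar>w\<bar> \<le> \<bar>K\<bar>" using TK(2) Tn(4) unfolding w_def[symmetric] by (simp add: abs_mult mult.commute)
    have "A eta = T$1$1 + T$2$2" "c eta * sqrt eta = T$1$1 - T$2$2" "B eta = T$2$1 + w" "d eta * sqrt eta = T$2$1 - w"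
      unfolding Tn w_def by (simp_all add: field_simps)
    then have e: "\<bar>A eta\<bar> \<le> 4 * \<bar>K\<bar>" "\<bar>c eta * sqrt eta\<bar> \<le> 4 * \<bar>K\<bar>" "\<bar>B eta\<bar> \<le> 4 * \<bar>K\<bar>" "\<bar>d eta * sqrt eta\<bar> \<le> 4 * \<bar>K\<bar>"
      using TK wK by linarith+
    have eH: "\<bar>A eta\<bar> \<le> H" "\<bar>B eta\<bar> \<le> H" "\<bar>c eta\<bar> \<le> H" "\<bar>d eta\<bar> \<le> H"
      using e(1,3) small[OF e(2)] small[OF e(4)] HK by linarith+
    have "A eta \<in> V" "B eta \<in> V" "c eta \<in> V" "d eta \<in> V"
      unfolding V_def using eH conj ipA ipB R(4,5) by blast+
    moreover have "T = qmat (A eta/2) (B eta/2) (c eta/2) (d eta/2)" unfolding R(1) oq_def AB ..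
    ultimately show "T \<in> (\<lambda>(A, B, C, D). qmat (A/2) (B/2) (C/2) (D/2)) ` (V \<times> V \<times> V \<times> V)"
      by (intro image_eqI[of _ _ "(A eta, B eta, c eta, d eta)"]) auto
  qed
  then show ?thesis by (rule finite_subset) (intro finite_imageI finite_cartesian_product finV)
qed

text \<open>A reduced geodesic meets a fixed compact segment, which bounds the matrices with given
  eigenvalues having its endpoints as fixed points.\<close>
lemma red_bounded:
  assumes N: "red N" and T: "N ** T = mat22 \<mu> 0 0 (- \<mu>) ** N"
  shows "\<bar>T$2$1\<bar> \<le> \<bar>\<mu>\<bar> * s3 tau3" "\<bar>T$1$2\<bar> \<le> \<bar>\<mu>\<bar> * s1 tau3" "(T$1$1)\<^sup>2 \<le> \<mu>\<^sup>2 + \<bar>\<mu>\<bar> * s1 tau3 * (\<bar>\<mu>\<bar> * s3 tau3)"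
    "T$2$2 = - T$1$1" "det T = - \<mu>\<^sup>2"
proof -
  define a b c d where abcd: "a = N$1$1" "b = N$1$2" "c = N$2$1" "d = N$2$2"
  define p q r t where pqrt: "p = T$1$1" "q = T$1$2" "r = T$2$1" "t = T$2$2"
  define \<Delta> where "\<Delta> = a * d - b * c"
  have D: "\<Delta> > 0" using N by (simp add: red_def det_2 abcd \<Delta>_def)
  have eq: "a * p + b * r = \<mu> * a" "a * q + b * t = \<mu> * b" "c * p + d * r = - \<mu> * c" "c * q + d * t = - \<mu> * d"
    using T unfolding mat2_eq_iff by (simp_all add: abcd pqrt)
  have e: "\<Delta> * p = \<mu> * (a * d + b * c)" "\<Delta> * q = 2 * \<mu> * b * d" "\<Delta> * r = - 2 * \<mu> * a * c" "\<Delta> * t = - (\<mu> * (a * d + b * c))"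
    unfolding \<Delta>_def using eq by algebra+
  have "\<Delta> * (t + p) = 0" using e by (simp add: algebra_simps)
  then have t: "t = - p" using D by simp
  have "\<Delta>\<^sup>2 * (p\<^sup>2 + q * r) = \<mu>\<^sup>2 * \<Delta>\<^sup>2"
  proof -
    have "\<Delta>\<^sup>2 * (p\<^sup>2 + q * r) = (\<Delta> * p)\<^sup>2 + (\<Delta> * q) * (\<Delta> * r)" by algebra
    also have "\<dots> = \<mu>\<^sup>2 * \<Delta>\<^sup>2" unfolding e unfolding \<Delta>_def by algebra
    finally show ?thesis .
  qed
  then have det: "p\<^sup>2 + q * r = \<mu>\<^sup>2" using D by simp
  have neg: "RR N tau3' < 0" "RR N tau3 \<ge> 0" using N by (simp_all add: red_def)
  \<comment> \<open>The point where the geodesic crosses the segment between \<open>tau3\<close> and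
    \<open>tau3'\<close>.\<close>
  obtain X k where X: "Im X > 0" "k > 0" "comb X (k * (- RR N tau3')) tau3 (k * RR N tau3) tau3'"
    by (rule comb_exists[of tau3 tau3' "- RR N tau3'" "RR N tau3"]) (use neg tau3'_s in auto)
  define l m where lm: "l = k * (- RR N tau3')" "m = k * RR N tau3"
  have lp: "l \<ge> 0" "m \<ge> 0" unfolding lm using X neg by (simp_all add: mult_nonneg_nonpos)
  note cX = X(3)[folded lm]
  have R0: "RR N X = 0" unfolding comb_FRE(2)[OF cX] lm by simp
  define x1 x2 x3 where x: "x1 = s1 X" "x2 = s2 X" "x3 = s3 X"
  have xn: "x1 * x3 - x2\<^sup>2 = 1" unfolding x by (rule s_norm[OF X(1)])
  have xs: "x1 = (l + m) * s1 tau3" "x2 = (l - m) * s2 tau3" "x3 = (l + m) * s3 tau3"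
    using cX unfolding comb_def x tau3'_s by (simp_all add: algebra_simps)
  have zn: "s1 tau3 * s3 tau3 - (s2 tau3)\<^sup>2 = 1" by (rule s_norm) simp
  \<comment> \<open>A point with \<open>l + m > 1\<close> would have norm above 1; so the
    coordinates \<open>s1\<close> and \<open>s3\<close> of \<open>X\<close> are at most those of
    \<open>tau3\<close>.\<close>
  have lm1: "l + m \<le> 1"
  proof (rule ccontr)
    assume "\<not> ?thesis"
    then have g: "(l + m)\<^sup>2 > 1" using one_less_power[of "l + m" 2] by simp
    have "1 = (l + m)\<^sup>2 * (s1 tau3 * s3 tau3) - (l - m)\<^sup>2 * (s2 tau3)\<^sup>2"
      using xn unfolding xs by algebra
    also have "\<dots> = (l + m)\<^sup>2 + 4 * (l * m) * (s2 tau3)\<^sup>2" using zn by algebra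
    finally have "1 = (l + m)\<^sup>2 + 4 * (l * m) * (s2 tau3)\<^sup>2" .
    moreover have "4 * (l * m) * (s2 tau3)\<^sup>2 \<ge> 0" using lp by simp
    ultimately show False using g by linarith
  qed
  have z: "s1 tau3 > 0" "s3 tau3 > 0" by (simp_all add: s1_pos s3_pos)
  have xb: "0 < x1" "0 < x3" "x1 \<le> s1 tau3" "x3 \<le> s3 tau3"
  proof -
    show "0 < x1" "0 < x3" unfolding x using X(1) by (simp_all add: s1_pos s3_pos)
    show "x1 \<le> s1 tau3" "x3 \<le> s3 tau3" unfolding xs
      using mult_right_mono[OF lm1, of "s1 tau3"] mult_right_mono[OF lm1, of "s3 tau3"] z by simp_all
  qed
  have "\<Delta> * (2 * p * x2 + q * x3 - r * x1) = 2 * \<mu> * RR N X"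
  proof -
    have "\<Delta> * (2 * p * x2 + q * x3 - r * x1) = 2 * (\<Delta> * p) * x2 + (\<Delta> * q) * x3 - (\<Delta> * r) * x1" by algebra
    then show ?thesis unfolding e RR_def abcd[symmetric] x[symmetric] by (simp add: algebra_simps)
  qed
  then have orth: "2 * p * x2 + q * x3 - r * x1 = 0" using R0 D by simp
  \<comment> \<open>A point of the axis bounds the matrix: completing squares, with
    \<open>orth\<close> and the norms of \<open>T\<close> and \<open>X\<close>, leaves sums of two
    squares, so the off-diagonal entries are at most the eigenvalue times \<open>x3\<close> or
    \<open>x1\<close>.\<close>
  have 1: "(p * x3 - r * x2)\<^sup>2 + r\<^sup>2 = (\<mu> * x3)\<^sup>2" using orth det xn by algebra
  have 2: "(p * x1 + q * x2)\<^sup>2 + q\<^sup>2 = (\<mu> * x1)\<^sup>2" using orth det xn by algebra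
  have "r\<^sup>2 \<le> (\<mu> * x3)\<^sup>2" unfolding 1[symmetric] by simp
  then have "\<bar>r\<bar> \<le> \<bar>\<mu>\<bar> * x3" using abs_le_square_iff[of r "\<mu> * x3"] xb by (simp add: abs_mult)
  also have "\<dots> \<le> \<bar>\<mu>\<bar> * s3 tau3" using xb by (intro mult_left_mono) auto
  finally have r: "\<bar>r\<bar> \<le> \<bar>\<mu>\<bar> * s3 tau3" .
  have "q\<^sup>2 \<le> (\<mu> * x1)\<^sup>2" unfolding 2[symmetric] by simp
  then have "\<bar>q\<bar> \<le> \<bar>\<mu>\<bar> * x1" using abs_le_square_iff[of q "\<mu> * x1"] xb by (simp add: abs_mult)
  also have "\<dots> \<le> \<bar>\<mu>\<bar> * s1 tau3" using xb by (intro mult_left_mono) auto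
  finally have q: "\<bar>q\<bar> \<le> \<bar>\<mu>\<bar> * s1 tau3" .
  have "- (q * r) \<le> \<bar>q\<bar> * \<bar>r\<bar>" using abs_ge_minus_self[of "q * r"] by (simp add: abs_mult)
  also have "\<dots> \<le> \<bar>\<mu>\<bar> * s1 tau3 * (\<bar>\<mu>\<bar> * s3 tau3)" using q r z by (intro mult_mono) auto
  finally have "p\<^sup>2 \<le> \<mu>\<^sup>2 + \<bar>\<mu>\<bar> * s1 tau3 * (\<bar>\<mu>\<bar> * s3 tau3)" using det by linarith
  then show "\<bar>T$2$1\<bar> \<le> \<bar>\<mu>\<bar> * s3 tau3" "\<bar>T$1$2\<bar> \<le> \<bar>\<mu>\<bar> * s1 tau3" "(T$1$1)\<^sup>2 \<le> \<mu>\<^sup>2 + \<bar>\<mu>\<bar> * s1 tau3 * (\<bar>\<mu>\<bar> * s3 tau3)"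
    "T$2$2 = - T$1$1" using q r t by (simp_all add: pqrt)
  have "p * t - q * r = - \<mu>\<^sup>2" unfolding t using det by algebra
  then show "det T = - \<mu>\<^sup>2" by (simp add: det_2 pqrt)
qed

text \<open>The rows of both matrices are left eigenvectors of \<open>T\<close> for the distinct
  eigenvalues \<mu> and - \<mu>, hence proportional row by row, and a frame determines its
  geodesic.\<close>

lemma eigen_frames:
  assumes "N ** T = mat22 \<mu> 0 0 (- \<mu>) ** N" "N' ** T = mat22 \<mu> 0 0 (- \<mu>) ** N'" "\<mu> \<noteq> 0"
    and fr: "is_frame N \<omega>" "is_frame N' \<omega>'"
  shows "\<omega> = \<omega>'"
proof -
  define a b c d where abcd: "a = N$1$1" "b = N$1$2" "c = N$2$1" "d = N$2$2"
  define a' b' c' d' where abcd': "a' = N'$1$1" "b' = N'$1$2" "c' = N'$2$1" "d' = N'$2$2"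
  define \<Delta> where "\<Delta> = a * d - b * c"
  have D: "\<Delta> > 0" using fr by (simp add: is_frame_def det_2 abcd \<Delta>_def)
  define p q r t where pqrt: "p = T$1$1" "q = T$1$2" "r = T$2$1" "t = T$2$2"
  have eq: "a * p + b * r = \<mu> * a" "a * q + b * t = \<mu> * b" "c * p + d * r = - \<mu> * c" "c * q + d * t = - \<mu> * d"
    using assms(1) unfolding mat2_eq_iff by (simp_all add: abcd pqrt)
  have eq': "a' * p + b' * r = \<mu> * a'" "a' * q + b' * t = \<mu> * b'" "c' * p + d' * r = - \<mu> * c'" "c' * q + d' * t = - \<mu> * d'"
    using assms(2) unfolding mat2_eq_iff by (simp_all add: abcd' pqrt)
  have "2 * \<mu> * (b' * a - a' * b) = 0" "2 * \<mu> * (c' * d - d' * c) = 0"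
  proof -
    have "(a' * p + b' * r) * d - (a' * q + b' * t) * c = \<mu> * (a' * d - b' * c)" using eq' by algebra
    have "\<Delta> * (2 * \<mu> * (b' * a - a' * b)) = 0" unfolding \<Delta>_def using eq eq' by algebra
    then show "2 * \<mu> * (b' * a - a' * b) = 0" using D by simp
    have "\<Delta> * (2 * \<mu> * (c' * d - d' * c)) = 0" unfolding \<Delta>_def using eq eq' by algebra
    then show "2 * \<mu> * (c' * d - d' * c) = 0" using D by simp
  qed
  then have x: "b' * a = a' * b" "c' * d = d' * c" using assms(3) by simp_all
  define k l where kl: "k = (a' * d - b' * c) / \<Delta>" "l = (a * d' - b * c') / \<Delta>"
  have "N' = mat22 k 0 0 l ** N"
  proof -
    have "\<Delta> * a' = (a' * d - b' * c) * a" "\<Delta> * b' = (a' * d - b' * c) * b"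
      "\<Delta> * c' = (a * d' - b * c') * c" "\<Delta> * d' = (a * d' - b * c') * d"
      unfolding \<Delta>_def using x by algebra+
    then have "a' = k * a" "b' = k * b" "c' = l * c" "d' = l * d" unfolding kl using D by (simp_all add: field_simps)
    then show ?thesis unfolding mat2_eq_iff by (simp add: abcd abcd')
  qed
  moreover from this have "det N' = k * l * det N" by (simp add: det_mul)
  then have "k * l > 0" using fr by (simp add: is_frame_def zero_less_mult_iff)
  ultimately have "is_frame N' \<omega>" using is_frame_diagI[OF fr(1)] by simp
  then show ?thesis by (rule is_frame_unique[OF _ fr(2)])
qed

lemma period_exists:
  assumes fr: "is_frame M \<omega>" and g: "is_gcf \<omega> i" and T: "T \<in> order_O" "M ** T = mat22 \<mu> 0 0 (- \<mu>) ** M" "\<mu> \<noteq> 0"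
  obtains l where "l \<ge> 1" "gcf_step \<omega> i l = gcf_step \<omega> i 0"
proof -
  define S where "S k = adj2 (gB i k) ** T ** gB i k" for k
  have SO: "S k \<in> order_O" for k unfolding S_def
    using gB_Delta[of i k] Delta237_adj[OF gB_Delta[of i k]] T(1) by (intro order_O_ring(3)) (simp_all add: Delta237_iff)
  have N: "(M ** gB i k) ** S k = mat22 \<mu> 0 0 (- \<mu>) ** (M ** gB i k)" for k
  proof -
    have "(M ** gB i k) ** S k = M ** (gB i k ** adj2 (gB i k)) ** T ** gB i k"
      unfolding S_def by (simp only: matrix_mul_assoc)
    also have "\<dots> = mat22 \<mu> 0 0 (- \<mu>) ** M ** gB i k" by (simp add: adj2_mult det_gB T(2))
    finally show ?thesis by (simp only: matrix_mul_assoc)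
  qed
  have c: "is_frame (M ** gB i k) (gcf_step \<omega> i k)" "red (M ** gB i k)" for k using chain[OF fr g] by blast+
  note b = red_bounded[OF c(2) N]
  define K where "K = 1 + \<bar>\<mu>\<bar> * s3 tau3 + \<bar>\<mu>\<bar> * s1 tau3 + \<mu>\<^sup>2 + \<bar>\<mu>\<bar> * s1 tau3 * (\<bar>\<mu>\<bar> * s3 tau3)"
  have z: "s1 tau3 > 0" "s3 tau3 > 0" by (simp_all add: s1_pos s3_pos)
  have nn: "\<bar>\<mu>\<bar> * s3 tau3 \<ge> 0" "\<bar>\<mu>\<bar> * s1 tau3 \<ge> 0" "\<mu>\<^sup>2 \<ge> 0" "\<bar>\<mu>\<bar> * s1 tau3 * (\<bar>\<mu>\<bar> * s3 tau3) \<ge> 0" using z by simp_all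
  have K1: "K \<ge> 1" unfolding K_def using nn by linarith
  have "S k \<in> {S' \<in> order_O. det S' = det T \<and> \<bar>S'$1$1\<bar> \<le> K \<and> \<bar>S'$1$2\<bar> \<le> K \<and> \<bar>S'$2$1\<bar> \<le> K \<and> \<bar>S'$2$2\<bar> \<le> K}" for k
  proof -
    have "(S k$1$1)\<^sup>2 \<le> K" using b(3)[of k] nn unfolding K_def by linarith
    also have "K \<le> K\<^sup>2" using K1 by (simp add: power2_eq_square)
    finally have 1: "\<bar>S k$1$1\<bar> \<le> K" using abs_le_square_iff[of "S k$1$1" K] K1 by simp
    have d: "det (S k) = det T" unfolding S_def by (simp add: det_mul det_gB)
    have "\<bar>S k$2$1\<bar> \<le> K" "\<bar>S k$1$2\<bar> \<le> K" using b(1,2)[of k] nn unfolding K_def by linarith+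
    then show ?thesis using 1 b(4)[of k] SO d by simp
  qed
  then have "range S \<subseteq> {S' \<in> order_O. det S' = det T \<and> \<bar>S'$1$1\<bar> \<le> K \<and> \<bar>S'$1$2\<bar> \<le> K \<and> \<bar>S'$2$1\<bar> \<le> K \<and> \<bar>S'$2$2\<bar> \<le> K}"
    by (rule image_subsetI)
  then have "finite (range S)" by (rule finite_subset[OF _ finite_order_bounded[OF T(1)]])
  then have "\<not> inj S" using range_inj_infinite by blast
  then obtain j k where jk: "j \<noteq> k" "S j = S k" unfolding inj_def by blast
  have "\<exists>k l. k < l \<and> S k = S l"
    using jk by (metis linorder_neqE_nat)
  then obtain k l where kl: "k < l" "S k = S l" by blast
  have "gcf_step \<omega> i k = gcf_step \<omega> i l"
    by (rule eigen_frames[OF N N[of l, folded kl(2)] T(3) c(1) c(1)])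
  then have "gcf_step \<omega> i k = gcf_step \<omega> i (k + (l - k))" using kl by simp
  from step_backward_0[OF fr g this] have "gcf_step \<omega> i (l - k) = gcf_step \<omega> i 0" by (rule sym)
  then show ?thesis using that[of "l - k"] kl by simp
qed

section \<open>The fields and the unit group\<close>

lemma real_subfield_hull: "real_subfield (real_subfield hull S)"
proof (rule hull_in)
  fix T assume T: "Ball T real_subfield"
  then show "real_subfield (\<Inter> T)" unfolding real_subfield_def real_subring_def by blast
qed

lemma real_subfieldI:
  assumes "0 \<in> S" "1 \<in> S" "\<And>x y. x \<in> S \<Longrightarrow> y \<in> S \<Longrightarrow> x + y \<in> S \<and> x - y \<in> S \<and> x * y \<in> S"
    "\<And>x. x \<in> S \<Longrightarrow> inverse x \<in> S"
  shows "real_subfield S"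
  unfolding real_subfield_def real_subring_def using assms by blast

lemma mat_subringI:
  assumes "mat 0 \<in> S" "mat 1 \<in> S" "\<And>M N. M \<in> S \<Longrightarrow> N \<in> S \<Longrightarrow> M + N \<in> S \<and> M - N \<in> S \<and> M ** N \<in> S"
  shows "mat_subring S"
  unfolding mat_subring_def using assms by blast

lemma field_adjoin_incl: "x \<in> field_adjoin K x" "K \<subseteq> field_adjoin K x"
  unfolding field_adjoin_def by (auto intro: hull_inc)

lemma field_adjoin_subfield: "real_subfield (field_adjoin K x)"
  unfolding field_adjoin_def by (rule real_subfield_hull)

lemma field_adjoin_least:
  assumes "real_subfield S" "\<And>y. y \<in> K \<Longrightarrow> y \<in> S" "x \<in> S" shows "field_adjoin K x \<subseteq> S"
  unfolding field_adjoin_def by (rule hull_minimal) (use assms in auto)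

lemma mat_adjoin_least:
  assumes "mat_subring S" "\<And>y. y \<in> K \<Longrightarrow> mat y \<in> S" "X \<in> S" shows "mat_adjoin K {X} \<subseteq> S"
  unfolding mat_adjoin_def by (rule hull_minimal) (use assms in auto)

lemma subfield_closed:
  assumes "real_subfield K"
  shows "0 \<in> K" "1 \<in> K" "x \<in> K \<Longrightarrow> y \<in> K \<Longrightarrow> x + y \<in> K" "x \<in> K \<Longrightarrow> y \<in> K \<Longrightarrow> x - y \<in> K"
    "x \<in> K \<Longrightarrow> y \<in> K \<Longrightarrow> x * y \<in> K" "x \<in> K \<Longrightarrow> inverse x \<in> K" "x \<in> K \<Longrightarrow> - x \<in> K"
    "x \<in> K \<Longrightarrow> y \<in> K \<Longrightarrow> x / y \<in> K" "x \<in> K \<Longrightarrow> x ^ n \<in> K" "of_nat m \<in> K" "numeral k \<in> K" "of_int j \<in> K"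
proof -
  note s = assms[unfolded real_subfield_def real_subring_def]
  show 0: "0 \<in> K" and 1: "1 \<in> K" using s by blast+
  show a: "x \<in> K \<Longrightarrow> y \<in> K \<Longrightarrow> x + y \<in> K" and d: "x \<in> K \<Longrightarrow> y \<in> K \<Longrightarrow> x - y \<in> K"
    and m: "x \<in> K \<Longrightarrow> y \<in> K \<Longrightarrow> x * y \<in> K" and i: "x \<in> K \<Longrightarrow> inverse x \<in> K" for x y using s by blast+
  show n: "x \<in> K \<Longrightarrow> - x \<in> K" for x using d[OF 0, of x] by simp
  show "x \<in> K \<Longrightarrow> y \<in> K \<Longrightarrow> x / y \<in> K" unfolding divide_inverse by (intro m i)
  show "x \<in> K \<Longrightarrow> x ^ n \<in> K" by (induction n) (simp_all add: 1 m)
  show nat: "of_nat m \<in> K" for m by (induction m) (simp_all add: 0 1 a)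
  show "numeral k \<in> K" using nat[of "numeral k"] by simp
  show "of_int j \<in> K" using nat[of "nat j"] n[OF nat[of "nat (- j)"]] by (cases "j \<ge> 0") simp_all
qed

lemma F_subfield: "real_subfield F_field" unfolding F_field_def by (rule field_adjoin_subfield)
lemma L_subfield: "real_subfield L_field" unfolding L_field_def by (rule field_adjoin_subfield)
lemmas F_closed = subfield_closed[OF F_subfield]
lemmas L_closed = subfield_closed[OF L_subfield]

lemma eta_F: "eta \<in> F_field" unfolding F_field_def by (rule field_adjoin_incl)
lemma sqrt_eta_L: "sqrt eta \<in> L_field" unfolding L_field_def by (rule field_adjoin_incl)
lemma F_sub_L: "x \<in> F_field \<Longrightarrow> x \<in> L_field" unfolding L_field_def using field_adjoin_incl(2) by blast

lemma Zr_F: "x \<in> Zr \<Longrightarrow> x \<in> F_field"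
proof -
  assume "x \<in> Zr"
  then obtain f where "ip f" "x = f eta" unfolding Zr_def by blast
  then obtain a b c :: int where "x = of_int a + of_int b * eta + of_int c * eta\<^sup>2"
    unfolding ip_def using root_eta by blast
  then show ?thesis by (simp only:) (intro F_closed eta_F)
qed

text \<open>These substitutions permute the roots, which is the Galois action. They make the other
  two conjugates available as elements of Z[eta], so that an inverse is their product over the
  integer norm.\<close>

lemma ip_conj: "ip f \<Longrightarrow> ip (\<lambda>x. f (x\<^sup>2 - 2))" "ip f \<Longrightarrow> ip (\<lambda>x. f (1 - x - x\<^sup>2))"
proof -
  assume "ip f"
  then obtain a b c :: int where f: "\<And>x. is_root x \<Longrightarrow> f x = of_int a + of_int b * x + of_int c * x\<^sup>2"
    unfolding ip_def by blast
  have ext: "ip g" if "\<And>x. is_root x \<Longrightarrow> g x = h x" "ip h" for g h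
    using that unfolding ip_def by metis
  have r: "is_root (x\<^sup>2 - 2)" "is_root (1 - x - x\<^sup>2)" if "is_root x" for x
    using that unfolding is_root_def by algebra+
  show "ip (\<lambda>x. f (x\<^sup>2 - 2))"
    by (rule ext[of _ "\<lambda>x. of_int a + of_int b * (x\<^sup>2 - 2) + of_int c * (x\<^sup>2 - 2)\<^sup>2"])
       (simp add: f r, intro ip_add ip_mult ip_diff ip_power ip_const ip_id ip_numeral)
  show "ip (\<lambda>x. f (1 - x - x\<^sup>2))"
    by (rule ext[of _ "\<lambda>x. of_int a + of_int b * (1 - x - x\<^sup>2) + of_int c * (1 - x - x\<^sup>2)\<^sup>2"])
       (simp add: f r, intro ip_add ip_mult ip_diff ip_power ip_const ip_id ip_numeral ip_1)
qed

definition Fq :: "real set" where "Fq = {f eta / real_of_int n | f n. ip f \<and> n \<noteq> 0}"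

lemma Fq_I: "ip f \<Longrightarrow> n \<noteq> 0 \<Longrightarrow> x = f eta / real_of_int n \<Longrightarrow> x \<in> Fq"
  unfolding Fq_def by blast

lemma Fq_subfield: "real_subfield Fq"
proof -
  have 0: "0 \<in> Fq" by (rule Fq_I[OF ip_0, of 1]) simp_all
  have 1: "1 \<in> Fq" by (rule Fq_I[OF ip_1, of 1]) simp_all
  have op: "x + y \<in> Fq \<and> x - y \<in> Fq \<and> x * y \<in> Fq" if xy: "x \<in> Fq" "y \<in> Fq" for x y
  proof -
    from xy obtain f n g m where f: "ip f" "n \<noteq> 0" "x = f eta / real_of_int n"
      and g: "ip g" "m \<noteq> 0" "y = g eta / real_of_int m" unfolding Fq_def by blast
    have nm: "n * m \<noteq> 0" using f g by simp
    have "x + y \<in> Fq"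
      by (rule Fq_I[OF ip_add[OF ip_mult[OF f(1) ip_const[of m]] ip_mult[OF g(1) ip_const[of n]]] nm])
         (unfold f(3) g(3), use f(2) g(2) in \<open>simp add: field_simps\<close>)
    moreover have "x - y \<in> Fq"
      by (rule Fq_I[OF ip_diff[OF ip_mult[OF f(1) ip_const[of m]] ip_mult[OF g(1) ip_const[of n]]] nm])
         (unfold f(3) g(3), use f(2) g(2) in \<open>simp add: field_simps\<close>)
    moreover have "x * y \<in> Fq" by (rule Fq_I[OF ip_mult[OF f(1) g(1)] nm]) (use f g in simp)
    ultimately show ?thesis by blast
  qed
  have inv: "inverse x \<in> Fq" if x: "x \<in> Fq" for x
  proof (cases "x = 0")
    case True then show ?thesis using 0 by simp
  next
    case False
    from x obtain f n where f: "ip f" "n \<noteq> 0" "x = f eta / real_of_int n" unfolding Fq_def by blast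
    obtain a b c where N: "f eta * f eta2 * f eta3 = of_int (norm3 a b c)" using ip_norm[OF f(1)] by blast
    have f0: "f eta \<noteq> 0" using False f by simp
    have "norm3 a b c \<noteq> 0"
    proof
      assume "norm3 a b c = 0"
      then have "f eta = 0" using ip_zero_all[OF f(1) _ root_eta] N by simp
      then show False using f0 by simp
    qed
    moreover from this have nz: "f eta2 \<noteq> 0" "f eta3 \<noteq> 0" using N by auto
    have "inverse x = (\<lambda>x. of_int n * (f (x\<^sup>2 - 2) * f (1 - x - x\<^sup>2))) eta / real_of_int (norm3 a b c)"
      unfolding N[symmetric] eta2_def[symmetric] eta3_def[symmetric] f(3) using f(2) f0 nz by simp
    ultimately show ?thesis
      by (intro Fq_I[OF ip_mult[OF ip_const[of n] ip_mult[OF ip_conj(1)[OF f(1)] ip_conj(2)[OF f(1)]]]])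
  qed
  show ?thesis by (rule real_subfieldI[OF 0 1 op inv])
qed

lemma F_field_eq: "F_field = Fq"
proof
  have "\<rat> \<subseteq> Fq"
  proof
    fix x :: real assume "x \<in> \<rat>"
    then obtain a b where "b > 0" "x = of_int a / of_int b" by (rule Rats_cases')
    then show "x \<in> Fq" by (intro Fq_I[OF ip_const[of a], of b]) simp_all
  qed
  moreover have "eta \<in> Fq" by (rule Fq_I[OF ip_id, of 1]) simp_all
  ultimately show "F_field \<subseteq> Fq" unfolding F_field_def field_adjoin_def
    by (intro hull_minimal Fq_subfield) simp
  show "Fq \<subseteq> F_field"
  proof
    fix x assume "x \<in> Fq"
    then obtain f n where "ip f" "x = f eta / real_of_int n" unfolding Fq_def by blast
    then show "x \<in> F_field" using F_closed(8)[OF Zr_F[OF Zr_I] F_closed(12)] by simp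
  qed
qed

text \<open>If \<open>eta\<close> were a square in the field, its conjugate \<open>eta2\<close>
  would be the square of a real number, but it is negative.\<close>

lemma sqrt_eta_irrational:
  assumes "x \<in> F_field" "y \<in> F_field" "x + y * sqrt eta = 0"
  shows "x = 0 \<and> y = 0"
proof (rule ccontr)
  assume "\<not> ?thesis"
  then have y: "y \<noteq> 0" using assms(3) by auto
  then have "sqrt eta = - x / y" using assms(3) by (simp add: field_simps)
  moreover have "- x / y \<in> F_field" by (intro F_closed assms)
  ultimately obtain f n where f: "ip f" "n \<noteq> 0" "sqrt eta = f eta / real_of_int n"
    unfolding F_field_eq Fq_def by auto
  have "(f eta)\<^sup>2 = (real_of_int n * sqrt eta)\<^sup>2" using f by (simp add: field_simps)
  then have "(f eta)\<^sup>2 - of_int (n\<^sup>2) * eta = 0" by (simp add: power_mult_distrib)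
  from ip_zero[OF ip_diff[OF ip_power[OF f(1)] ip_mult[OF ip_const ip_id]] this root_eta23(1)]
  have "(f eta2)\<^sup>2 = of_int (n\<^sup>2) * eta2" by simp
  moreover have "real_of_int (n\<^sup>2) * eta2 < 0" using f(2) eta23_neg by (intro mult_pos_neg) simp_all
  moreover have "(f eta2)\<^sup>2 \<ge> 0" by simp
  ultimately show False by linarith
qed

lemma L_field_eq: "L_field = {x + y * sqrt eta | x y. x \<in> F_field \<and> y \<in> F_field}" (is "_ = ?S")
proof
  have SI: "x + y * sqrt eta \<in> ?S" if "x \<in> F_field" "y \<in> F_field" for x y using that by blast
  have F: "x \<in> ?S" if "x \<in> F_field" for x using SI[OF that F_closed(1)] by simp
  have op: "u + v \<in> ?S \<and> u - v \<in> ?S \<and> u * v \<in> ?S" if uv: "u \<in> ?S" "v \<in> ?S" for u v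
  proof -
    from uv obtain x y x' y' where e: "u = x + y * sqrt eta" "v = x' + y' * sqrt eta"
      and F: "x \<in> F_field" "y \<in> F_field" "x' \<in> F_field" "y' \<in> F_field" by blast
    have 1: "u + v = (x + x') + (y + y') * sqrt eta" "u - v = (x - x') + (y - y') * sqrt eta"
      "u * v = (x * x' + y * y' * eta) + (x * y' + y * x') * sqrt eta" unfolding e by (simp_all add: algebra_simps)
    show ?thesis unfolding 1 by (intro conjI SI F_closed F eta_F)
  qed
  have inv: "inverse u \<in> ?S" if u: "u \<in> ?S" for u
  proof -
    from u obtain x y where e: "u = x + y * sqrt eta" and xy: "x \<in> F_field" "y \<in> F_field" by blast
    show ?thesis
    proof (cases "u = 0")
      case True then show ?thesis using F[OF F_closed(1)] by simp
    next
      case False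
      define n where "n = x * x - y * y * eta"
      have nF: "n \<in> F_field" unfolding n_def by (intro F_closed xy eta_F)
      have prod: "u * (x - y * sqrt eta) = n" unfolding e n_def by (simp add: algebra_simps)
      have "x - y * sqrt eta \<noteq> 0"
      proof
        assume z: "x - y * sqrt eta = 0"
        then have "x + (- y) * sqrt eta = 0" by simp
        from sqrt_eta_irrational[OF xy(1) F_closed(7)[OF xy(2)] this] have "u = 0" unfolding e by simp
        then show False using False by simp
      qed
      then have n: "n \<noteq> 0" unfolding prod[symmetric] using False by simp
      have "inverse u = x / n + (- y / n) * sqrt eta"
      proof -
        have "u * (x / n + (- y / n) * sqrt eta) = u * (x - y * sqrt eta) / n"
          by (simp add: algebra_simps diff_divide_distrib)
        also have "\<dots> = 1" unfolding prod using n by simp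
        finally show ?thesis by (rule inverse_unique)
      qed
      then show ?thesis by (simp only:) (intro SI F_closed xy nF)
    qed
  qed
  have sub: "real_subfield ?S" by (rule real_subfieldI[OF F[OF F_closed(1)] F[OF F_closed(2)] op inv])
  have "sqrt eta = 0 + 1 * sqrt eta" by simp
  then have se: "sqrt eta \<in> ?S" using F_closed(1,2) by blast
  show "L_field \<subseteq> ?S" unfolding L_field_def by (rule field_adjoin_least[OF sub F se])
  show "?S \<subseteq> L_field"
  proof
    fix u assume "u \<in> ?S"
    then obtain x y where "u = x + y * sqrt eta" "x \<in> F_field" "y \<in> F_field" by blast
    then show "u \<in> L_field" by (simp only:) (intro L_closed F_sub_L sqrt_eta_L)
  qed
qed

lemma conjL_eq:
  assumes "x \<in> F_field" "y \<in> F_field" shows "conjL (x + y * sqrt eta) = x - y * sqrt eta"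
  unfolding conjL_def
proof (rule the_equality)
  show "\<exists>x'\<in>F_field. \<exists>y'\<in>F_field. x + y * sqrt eta = x' + y' * sqrt eta \<and> x - y * sqrt eta = x' - y' * sqrt eta"
    using assms by blast
  fix v assume "\<exists>x'\<in>F_field. \<exists>y'\<in>F_field. x + y * sqrt eta = x' + y' * sqrt eta \<and> v = x' - y' * sqrt eta"
  then obtain x' y' where F: "x' \<in> F_field" "y' \<in> F_field" and e: "x + y * sqrt eta = x' + y' * sqrt eta" "v = x' - y' * sqrt eta" by blast
  have "(x - x') + (y - y') * sqrt eta = 0" using e(1) by (simp add: algebra_simps)
  from sqrt_eta_irrational[OF F_closed(4)[OF assms(1) F(1)] F_closed(4)[OF assms(2) F(2)] this]
  show "v = x - y * sqrt eta" using e(2) by simp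
qed

lemma theta_qmat:
  assumes "z \<in> L_field" "w \<in> L_field"
  obtains a b c d where "a \<in> F_field" "b \<in> F_field" "c \<in> F_field" "d \<in> F_field"
    "theta z w = qmat a b c d" "discr z w = (theta z w$2$2 - theta z w$1$1)\<^sup>2 + 4 * theta z w$1$2 * theta z w$2$1"
    "z = a + c * sqrt eta" "w = b + d * sqrt eta" "conjL z = a - c * sqrt eta" "conjL w = b - d * sqrt eta"
proof -
  obtain a c where z: "z = a + c * sqrt eta" "a \<in> F_field" "c \<in> F_field" using assms(1) unfolding L_field_eq by blast
  obtain b d where w: "w = b + d * sqrt eta" "b \<in> F_field" "d \<in> F_field" using assms(2) unfolding L_field_eq by blast
  have c: "conjL z = a - c * sqrt eta" "conjL w = b - d * sqrt eta"
    unfolding z(1) w(1) by (rule conjL_eq; fact)+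
  have "theta z w = qmat a b c d" unfolding theta_def c unfolding z(1) w(1) by (simp add: mat2_eq_iff)
  moreover have "discr z w = (theta z w$2$2 - theta z w$1$1)\<^sup>2 + 4 * theta z w$1$2 * theta z w$2$1"
    unfolding discr_def theta_def mat22_nth by (simp add: power2_eq_square algebra_simps)
  ultimately show ?thesis using that z w c by blast
qed

lemma qmat_theta:
  assumes "a \<in> F_field" "b \<in> F_field" "c \<in> F_field" "d \<in> F_field"
  defines "z \<equiv> a + c * sqrt eta" and "w \<equiv> b + d * sqrt eta"
  shows "qmat a b c d = theta z w" "z \<in> L_field" "w \<in> L_field"
proof -
  have "conjL z = a - c * sqrt eta" "conjL w = b - d * sqrt eta"
    unfolding z_def w_def by (rule conjL_eq; fact)+
  then show "qmat a b c d = theta z w" unfolding theta_def z_def w_def by (simp add: mat2_eq_iff)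
  show "z \<in> L_field" "w \<in> L_field" unfolding L_field_eq z_def w_def using assms by blast+
qed

lemma order_qmat:
  assumes "X \<in> order_O"
  obtains a b c d where "a \<in> F_field" "b \<in> F_field" "c \<in> F_field" "d \<in> F_field" "X = qmat a b c d"
proof -
  from assms obtain a b c d where X: "X = oq a b c d" "a \<in> Zr" "b \<in> Zr" "c \<in> Zr" "d \<in> Zr" unfolding order_O_eq by blast
  have F: "a \<in> F_field" "b \<in> F_field" "c \<in> F_field" "d \<in> F_field" using X by (simp_all add: Zr_F)
  show ?thesis
    by (rule that[OF _ _ _ _ X(1)[unfolded oq_def]]) (unfold oqA_def oqB_def, (intro F_closed eta_F F)+)
qed

section \<open>Fixed points as zeros of binary quadratic forms\<close>

definition fixq :: "mat2 \<Rightarrow> rp1 \<Rightarrow> bool" where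
  "fixq T p \<longleftrightarrow> T$2$1 * (fst (hv p))\<^sup>2 + (T$2$2 - T$1$1) * fst (hv p) * snd (hv p) - T$1$2 * (snd (hv p))\<^sup>2 = 0"

lemma fixq_act: assumes "det T \<noteq> 0" shows "rp1_act T p = p \<longleftrightarrow> fixq T p"
proof (cases p)
  case (PReal x)
  show ?thesis
  proof (cases "T$2$1 * x + T$2$2 = 0")
    case True
    have "\<not> fixq T p"
    proof
      assume "fixq T p"
      then have "x * (T$2$1 * x + T$2$2) - (T$1$1 * x + T$1$2) = 0"
        by (simp add: fixq_def PReal power2_eq_square algebra_simps)
      then have "T$1$1 * x + T$1$2 = 0" using True by simp
      then have "det T = 0" using True unfolding det_2 by algebra
      then show False using assms by simp
    qed
    then show ?thesis using True PReal by simp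
  next
    case False
    then show ?thesis by (auto simp: PReal fixq_def field_simps power2_eq_square)
  qed
next
  case PInf
  then show ?thesis by (simp add: fixq_def)
qed

text \<open>A binary quadratic form vanishing at both endpoints is a multiple of the product of the
  two linear forms given by the rows of the frame.\<close>

lemma fixq_frame:
  assumes fr: "is_frame M \<omega>" and fx: "fixq T (fst \<omega>)" "fixq T (snd \<omega>)"
  obtains k where "T$2$1 = k * (M$1$1 * M$2$1)" "T$2$2 - T$1$1 = k * (M$1$1 * M$2$2 + M$1$2 * M$2$1)"
    "T$1$2 = - (k * (M$1$2 * M$2$2))"
proof -
  define a b c d where abcd: "a = M$1$1" "b = M$1$2" "c = M$2$1" "d = M$2$2"
  define A B C where ABC: "A = T$2$1" "B = T$2$2 - T$1$1" "C = - T$1$2"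
  define \<Delta> where "\<Delta> = a * d - b * c"
  have D: "\<Delta> > 0" using fr by (simp add: is_frame_def det_2 abcd \<Delta>_def)
  define x y u v where xyuv: "x = fst (hv (fst \<omega>))" "y = snd (hv (fst \<omega>))" "u = fst (hv (snd \<omega>))" "v = snd (hv (snd \<omega>))"
  have e: "a * x + b * y = 0" "c * u + d * v = 0" using fr by (simp_all add: is_frame_def abcd xyuv)
  have q: "A * x\<^sup>2 + B * x * y + C * y\<^sup>2 = 0" "A * u\<^sup>2 + B * u * v + C * v\<^sup>2 = 0"
    using fx by (simp_all add: fixq_def ABC xyuv algebra_simps)
  have nz: "x \<noteq> 0 \<or> y \<noteq> 0" "u \<noteq> 0 \<or> v \<noteq> 0" unfolding xyuv by (rule hv_nz)+
  have Q1: "A * b\<^sup>2 - B * a * b + C * a\<^sup>2 = 0"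
  proof -
    have "x\<^sup>2 * (A * b\<^sup>2 - B * a * b + C * a\<^sup>2) = 0" "y\<^sup>2 * (A * b\<^sup>2 - B * a * b + C * a\<^sup>2) = 0"
      using e(1) q(1) by algebra+
    then show ?thesis using nz(1) by auto
  qed
  have Q2: "A * d\<^sup>2 - B * c * d + C * c\<^sup>2 = 0"
  proof -
    have "u\<^sup>2 * (A * d\<^sup>2 - B * c * d + C * c\<^sup>2) = 0" "v\<^sup>2 * (A * d\<^sup>2 - B * c * d + C * c\<^sup>2) = 0"
      using e(2) q(2) by algebra+
    then show ?thesis using nz(2) by auto
  qed
  define k where "k = (B * (a * d + b * c) - 2 * A * b * d - 2 * C * a * c) / \<Delta>\<^sup>2"
  have k: "k * \<Delta>\<^sup>2 = B * (a * d + b * c) - 2 * A * b * d - 2 * C * a * c" using D by (simp add: k_def)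
  have "A * \<Delta>\<^sup>2 = (a * c) * (k * \<Delta>\<^sup>2)" "B * \<Delta>\<^sup>2 = (a * d + b * c) * (k * \<Delta>\<^sup>2)" "C * \<Delta>\<^sup>2 = (b * d) * (k * \<Delta>\<^sup>2)"
    unfolding k unfolding \<Delta>_def using Q1 Q2 by algebra+
  then have "A = k * (a * c)" "B = k * (a * d + b * c)" "C = k * (b * d)" using D by (simp_all add: mult_ac)
  then show ?thesis using that[of k] by (simp add: ABC abcd)
qed

text \<open>\<open>S\<close> is \<open>n\<close> times twice the trace-free part of
  \<open>T\<close>; the frame diagonalizes it with opposite eigenvalues, the form in which
  \<open>period_exists\<close> takes its matrix.\<close>

lemma fixq_eigen:
  fixes T M S :: mat2 and k n :: real
  assumes "T$2$1 = k * (M$1$1 * M$2$1)" "T$2$2 - T$1$1 = k * (M$1$1 * M$2$2 + M$1$2 * M$2$1)"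
    "T$1$2 = - (k * (M$1$2 * M$2$2))" and S: "S$1$1 = (T$1$1 - T$2$2) * n" "S$2$2 = (T$2$2 - T$1$1) * n" "S$1$2 = 2 * T$1$2 * n" "S$2$1 = 2 * T$2$1 * n"
  shows "M ** S = mat22 (- (k * n * det M)) 0 0 (- (- (k * n * det M))) ** M"
proof -
  have t: "T$1$1 - T$2$2 = - (k * (M$1$1 * M$2$2 + M$1$2 * M$2$1))" using assms(2) by simp
  show ?thesis unfolding mat2_eq_iff matrix_mult_nth2 mat22_nth S t assms(1-3) det_2
    by (simp add: algebra_simps)
qed

lemma fixq_discr:
  fixes T M :: mat2 and k :: real
  assumes "T$2$1 = k * (M$1$1 * M$2$1)" "T$2$2 - T$1$1 = k * (M$1$1 * M$2$2 + M$1$2 * M$2$1)"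
    "T$1$2 = - (k * (M$1$2 * M$2$2))"
  shows "(T$2$2 - T$1$1)\<^sup>2 + 4 * T$1$2 * T$2$1 = (k * det M)\<^sup>2"
  unfolding assms det_2 by algebra

lemma quadratic_ends_fixq:
  assumes "quadratic_ends z w \<alpha> \<beta>" shows "fixq (theta z w) \<alpha>" "fixq (theta z w) \<beta>"
proof -
  have L: "z \<in> L_field" "w \<in> L_field" and D: "discr z w > 0" using assms by (simp_all add: quadratic_ends_def)
  have "fixq (theta z w) \<alpha> \<and> fixq (theta z w) \<beta>"
  proof (cases "w = 0")
    case True
    have "conjL 0 = 0" using conjL_eq[OF F_closed(1,1)] by simp
    then have "theta z w$1$2 = 0" "theta z w$2$1 = 0" using True by (simp_all add: theta_def)
    then show ?thesis using assms True by (auto simp: quadratic_ends_def fixq_def)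
  next
    case False
    define s where "s = sqrt (discr z w)"
    have s: "s * s = discr z w" using D by (simp add: s_def)
    have root: "fixq (theta z w) (PReal ((z - conjL z + \<sigma> * s) / (2 * w)))" if "\<sigma> = 1 \<or> \<sigma> = -1" for \<sigma>
    proof -
      define x where "x = (z - conjL z + \<sigma> * s) / (2 * w)"
      have "2 * w * x - (z - conjL z) = \<sigma> * s" using False by (simp add: x_def)
      then have "(2 * w * x - (z - conjL z))\<^sup>2 = s * s" using that by (auto simp: power2_eq_square)
      then have "4 * w * (w * x\<^sup>2 + (conjL z - z) * x - eta * conjL w) = 0" unfolding s discr_def by algebra
      then have "w * x\<^sup>2 + (conjL z - z) * x - eta * conjL w = 0" using False by simp
      then show ?thesis unfolding x_def[symmetric] by (simp add: fixq_def theta_def)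
    qed
    have "\<exists>\<sigma>\<in>{1, -1}. \<alpha> = PReal ((z - conjL z + \<sigma> * s) / (2 * w)) \<and> \<beta> = PReal ((z - conjL z - \<sigma> * s) / (2 * w))"
      using assms False unfolding quadratic_ends_def s_def by (simp only: if_False simp_thms)
    then obtain \<sigma> where sg: "\<sigma> = 1 \<or> \<sigma> = -1" and
      ab: "\<alpha> = PReal ((z - conjL z + \<sigma> * s) / (2 * w))" "\<beta> = PReal ((z - conjL z - \<sigma> * s) / (2 * w))"
      by blast
    have "\<beta> = PReal ((z - conjL z + (- \<sigma>) * s) / (2 * w))" unfolding ab(2) by simp
    then show ?thesis using root[of \<sigma>] root[of "- \<sigma>"] sg ab(1) by auto
  qed
  then show "fixq (theta z w) \<alpha>" "fixq (theta z w) \<beta>" by blast+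
qed

text \<open>By the Cayley-Hamilton identity, with trace and norm in the base field, the span of 1
  and \<open>theta z w\<close> is closed under multiplication.\<close>

lemma K_field_eq:
  assumes "z \<in> L_field" "w \<in> L_field"
  shows "K_field z w = {mat x + y *\<^sub>R theta z w | x y. x \<in> F_field \<and> y \<in> F_field}" (is "_ = ?S")
proof
  obtain a b c d where F: "a \<in> F_field" "b \<in> F_field" "c \<in> F_field" "d \<in> F_field" and th: "theta z w = qmat a b c d"
    by (rule theta_qmat[OF assms])
  define \<Theta> where "\<Theta> = theta z w"
  define n where "n = a\<^sup>2 - eta * b\<^sup>2 - eta * c\<^sup>2 + eta\<^sup>2 * d\<^sup>2"
  have nF: "n \<in> F_field" unfolding n_def by (intro F_closed F eta_F)
  have sq: "\<Theta> ** \<Theta> = (2 * a) *\<^sub>R \<Theta> - mat n"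
    unfolding \<Theta>_def th n_def mat2_eq_iff by (simp add: algebra_simps power2_eq_square)
  have SI: "mat x + y *\<^sub>R \<Theta> \<in> ?S" if "x \<in> F_field" "y \<in> F_field" for x y using that unfolding \<Theta>_def by blast
  have op: "U + V \<in> ?S \<and> U - V \<in> ?S \<and> U ** V \<in> ?S" if UV: "U \<in> ?S" "V \<in> ?S" for U V
  proof -
    from UV obtain x y x' y' where e: "U = mat x + y *\<^sub>R \<Theta>" "V = mat x' + y' *\<^sub>R \<Theta>"
      and X: "x \<in> F_field" "y \<in> F_field" "x' \<in> F_field" "y' \<in> F_field" unfolding \<Theta>_def by blast
    have 1: "U + V = mat (x + x') + (y + y') *\<^sub>R \<Theta>" "U - V = mat (x - x') + (y - y') *\<^sub>R \<Theta>"
      unfolding e mat2_eq_iff by (simp_all add: algebra_simps)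
    have "U ** V = mat (x * x') + (x * y' + y * x') *\<^sub>R \<Theta> + (y * y') *\<^sub>R (\<Theta> ** \<Theta>)"
      unfolding e mat2_eq_iff by (simp add: algebra_simps)
    also have "\<dots> = mat (x * x' - y * y' * n) + (x * y' + y * x' + y * y' * (2 * a)) *\<^sub>R \<Theta>"
      unfolding sq mat2_eq_iff by (simp add: algebra_simps)
    finally have 2: "U ** V = mat (x * x' - y * y' * n) + (x * y' + y * x' + y * y' * (2 * a)) *\<^sub>R \<Theta>" .
    show ?thesis unfolding 1 2 by (intro conjI SI F_closed X F nF)
  qed
  have mF: "mat x \<in> ?S" if "x \<in> F_field" for x
  proof -
    have "mat x + 0 *\<^sub>R \<Theta> \<in> ?S" by (rule SI[OF that F_closed(1)])
    moreover have "mat x + 0 *\<^sub>R \<Theta> = mat x" by simp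
    ultimately show ?thesis by (simp only:)
  qed
  have sub: "mat_subring ?S" by (rule mat_subringI[OF mF[OF F_closed(1)] mF[OF F_closed(2)] op])
  have th': "theta z w \<in> ?S"
  proof -
    have "mat 0 + 1 *\<^sub>R \<Theta> \<in> ?S" by (rule SI[OF F_closed(1,2)])
    moreover have "mat 0 + 1 *\<^sub>R \<Theta> = theta z w" unfolding \<Theta>_def mat2_eq_iff by simp
    ultimately show ?thesis by (simp only:)
  qed
  show "K_field z w \<subseteq> ?S" unfolding K_field_def by (rule mat_adjoin_least[OF sub mF th'])
  show "?S \<subseteq> K_field z w"
  proof
    fix U assume "U \<in> ?S"
    then obtain x y where e: "U = mat x + y *\<^sub>R \<Theta>" and X: "x \<in> F_field" "y \<in> F_field" unfolding \<Theta>_def by blast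
    have r: "mat_subring (K_field z w)" unfolding K_field_def mat_adjoin_def by (rule mat_subring_hull)
    have "mat x \<in> K_field z w" "mat y \<in> K_field z w" "\<Theta> \<in> K_field z w"
      unfolding K_field_def mat_adjoin_def \<Theta>_def using X by (auto intro!: hull_inc)
    then have "mat x + mat y ** \<Theta> \<in> K_field z w" using r unfolding mat_subring_def by blast
    moreover have "mat x + mat y ** \<Theta> = U" unfolding e mat2_eq_iff by simp
    ultimately show "U \<in> K_field z w" by simp
  qed
qed

text \<open>A matrix with the same two fixed points has a quadratic form proportional to that of
  \<open>theta z w\<close>, so it is \<open>mat x + y *\<^sub>R theta z w\<close> with real
  \<open>y\<close>. Comparing quaternion coordinates, which lie in the base field, shows that
  \<open>y\<close> lies there too.\<close>

lemma stabilizer_K_order1: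
  assumes Q: "quadratic_ends z w \<alpha> \<beta>" and ne: "\<alpha> \<noteq> \<beta>"
  shows "stabilizer (\<beta>, \<alpha>) = K_order1 z w"
proof
  have L: "z \<in> L_field" "w \<in> L_field" and D: "discr z w > 0" using Q by (simp_all add: quadratic_ends_def)
  define \<Theta> where "\<Theta> = theta z w"
  note fq = quadratic_ends_fixq[OF Q, folded \<Theta>_def]
  obtain a b c d where F: "a \<in> F_field" "b \<in> F_field" "c \<in> F_field" "d \<in> F_field" and th: "\<Theta> = qmat a b c d"
    and dis: "discr z w = (\<Theta>$2$2 - \<Theta>$1$1)\<^sup>2 + 4 * \<Theta>$1$2 * \<Theta>$2$1" unfolding \<Theta>_def
    by (rule theta_qmat[OF L])
  have ne': "fst (\<beta>, \<alpha>) \<noteq> snd (\<beta>, \<alpha>)" using ne by simp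
  obtain M where M: "is_frame M (\<beta>, \<alpha>)" by (rule is_frame_exists[OF ne'])
  have M0: "det M > 0" using M by (simp add: is_frame_def)
  obtain k where k: "\<Theta>$2$1 = k * (M$1$1 * M$2$1)" "\<Theta>$2$2 - \<Theta>$1$1 = k * (M$1$1 * M$2$2 + M$1$2 * M$2$1)"
    "\<Theta>$1$2 = - (k * (M$1$2 * M$2$2))"
    by (rule fixq_frame[OF M, of \<Theta>]) (use fq in auto)
  have "(k * det M)\<^sup>2 > 0" using D unfolding dis fixq_discr[OF k] .
  then have k0: "k \<noteq> 0" by auto
  show "stabilizer (\<beta>, \<alpha>) \<subseteq> K_order1 z w"
  proof
    fix X assume "X \<in> stabilizer (\<beta>, \<alpha>)"
    then have X: "X \<in> Delta237" "rp1_act X \<beta> = \<beta>" "rp1_act X \<alpha> = \<alpha>" by (simp_all add: stabilizer_def)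
    have dX: "det X = 1" by (rule Delta237_det[OF X(1)])
    have XO: "X \<in> order_O" using X(1) by (simp add: Delta237_iff)
    obtain a' b' c' d' where F': "a' \<in> F_field" "b' \<in> F_field" "c' \<in> F_field" "d' \<in> F_field" and Xq: "X = qmat a' b' c' d'"
      by (rule order_qmat[OF XO])
    have fX: "fixq X \<beta>" "fixq X \<alpha>" using X fixq_act[of X] dX by simp_all
    obtain l where l: "X$2$1 = l * (M$1$1 * M$2$1)" "X$2$2 - X$1$1 = l * (M$1$1 * M$2$2 + M$1$2 * M$2$1)"
      "X$1$2 = - (l * (M$1$2 * M$2$2))"
      by (rule fixq_frame[OF M, of X]) (use fX in auto)
    define y where "y = l / k"
    have "X$2$1 = y * \<Theta>$2$1" "X$2$2 - X$1$1 = y * (\<Theta>$2$2 - \<Theta>$1$1)" "X$1$2 = y * \<Theta>$1$2"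
      unfolding k l y_def using k0 by simp_all
    then have e: "b' + d' * sqrt eta = y * (b + d * sqrt eta)" "c' * sqrt eta = y * (c * sqrt eta)"
      "b' - d' * sqrt eta = y * (b - d * sqrt eta)"
      unfolding Xq th by simp_all
    have bcd: "b' = y * b" "c' = y * c" "d' = y * d"
    proof -
      show "b' = y * b" using e(1,3) by algebra
      have "d' * sqrt eta = (y * d) * sqrt eta" using e(1,3) by algebra
      then show "d' = y * d" by simp
      show "c' = y * c" using e(2) by simp
    qed
    \<comment> \<open>Otherwise \<open>theta z w\<close> would be scalar with discriminant 0; a
      nonzero coordinate is needed to divide by.\<close>
    have "b \<noteq> 0 \<or> c \<noteq> 0 \<or> d \<noteq> 0"
    proof (rule ccontr)
      assume "\<not> ?thesis"
      then have "discr z w = 0" unfolding dis th by simp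
      then show False using D by simp
    qed
    then have yF: "y \<in> F_field"
    proof (elim disjE)
      assume "b \<noteq> 0" then have "y = b' / b" using bcd by simp
      then show ?thesis by (simp only:) (intro F_closed F F')
    next
      assume "c \<noteq> 0" then have "y = c' / c" using bcd by simp
      then show ?thesis by (simp only:) (intro F_closed F F')
    next
      assume "d \<noteq> 0" then have "y = d' / d" using bcd by simp
      then show ?thesis by (simp only:) (intro F_closed F F')
    qed
    have XK: "X = mat (a' - y * a) + y *\<^sub>R \<Theta>"
      unfolding Xq th bcd mat2_eq_iff by (simp add: algebra_simps)
    have KI: "mat p + q *\<^sub>R \<Theta> \<in> K_field z w" if "p \<in> F_field" "q \<in> F_field" for p q
      unfolding K_field_eq[OF L] \<Theta>_def using that by blast
    have "X \<in> K_field z w" unfolding XK by (intro KI F_closed yF F F')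
    moreover have "adj2 X \<in> K_field z w"
    proof -
      have "adj2 X = mat (2 * a' - (a' - y * a)) + (- y) *\<^sub>R \<Theta>"
        unfolding Xq th bcd mat2_eq_iff by (simp add: algebra_simps)
      then show ?thesis by (simp only:) (intro KI F_closed yF F F')
    qed
    ultimately have "X \<in> K_order z w" "adj2 X \<in> K_order z w"
      using XO adj2_order_O[OF XO] by (simp_all add: K_order_def)
    then show "X \<in> K_order1 z w" unfolding K_order1_def mat_units_def using X(1) adj2_mult[OF dX] by blast
  qed
  show "K_order1 z w \<subseteq> stabilizer (\<beta>, \<alpha>)"
  proof
    fix X assume "X \<in> K_order1 z w"
    then have X: "X \<in> Delta237" "X \<in> K_field z w" unfolding K_order1_def mat_units_def K_order_def by blast+
    from X(2) obtain x y where e: "X = mat x + y *\<^sub>R \<Theta>" unfolding K_field_eq[OF L] \<Theta>_def by blast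
    have "fixq X p" if "fixq \<Theta> p" for p
    proof -
      have "X$2$1 * (fst (hv p))\<^sup>2 + (X$2$2 - X$1$1) * fst (hv p) * snd (hv p) - X$1$2 * (snd (hv p))\<^sup>2
        = y * (\<Theta>$2$1 * (fst (hv p))\<^sup>2 + (\<Theta>$2$2 - \<Theta>$1$1) * fst (hv p) * snd (hv p) - \<Theta>$1$2 * (snd (hv p))\<^sup>2)"
        unfolding e by (simp add: algebra_simps)
      then show ?thesis using that by (simp add: fixq_def)
    qed
    then have "rp1_act X \<beta> = \<beta>" "rp1_act X \<alpha> = \<alpha>" using fixq_act[of X] Delta237_det[OF X(1)] fq by simp_all
    then show "X \<in> stabilizer (\<beta>, \<alpha>)" using X(1) by (simp add: stabilizer_def)
  qed
qed

text \<open>\<open>rho\<close> is the eigenvalue on the line belonging to \<alpha>; applying the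
  right factor first, only this one has to fix \<alpha> for the product rule.\<close>

lemma rho_mult:
  assumes "rp1_act N \<alpha> = \<alpha>" "det N \<noteq> 0" shows "rho \<alpha> (M ** N) = rho \<alpha> M * rho \<alpha> N"
proof (cases \<alpha>)
  case (PReal a)
  have "fixq N \<alpha>" using assms fixq_act by blast
  then have "N$1$1 * a + N$1$2 = a * (N$2$1 * a + N$2$2)"
    by (simp add: fixq_def PReal power2_eq_square algebra_simps)
  then show ?thesis unfolding PReal rho.simps matrix_mult_nth2 by algebra
next
  case PInf
  have "fixq N \<alpha>" using assms fixq_act by blast
  then show ?thesis by (simp add: fixq_def PInf)
qed

lemma rho_1: "rho \<alpha> (mat 1) = 1" by (cases \<alpha>) simp_all
lemma rho_minus: "rho \<alpha> (- M) = - rho \<alpha> M" by (cases \<alpha>) simp_all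

lemma rho_pow:
  assumes "rp1_act N \<alpha> = \<alpha>" "det N = 1" shows "rho \<alpha> (mat_pow N n) = rho \<alpha> N ^ n"
proof (induction n)
  case 0 show ?case by (simp add: rho_1)
next
  case (Suc n)
  have "rho \<alpha> (mat_pow N n ** N) = rho \<alpha> (mat_pow N n) * rho \<alpha> N"
    by (rule rho_mult) (use assms in simp_all)
  then show ?case unfolding mat_pow_Suc_right using Suc by simp
qed

lemma rho_powi:
  assumes "rp1_act N \<alpha> = \<alpha>" "det N = 1" shows "rho \<alpha> (mat_powi N k) = rho \<alpha> N powi k"
proof -
  have a: "rp1_act (adj2 N) \<alpha> = \<alpha>"
    using rp1_act_mult[of N "adj2 N" \<alpha>] assms by (simp add: adj2_mult)
  have "rho \<alpha> (adj2 N ** N) = rho \<alpha> (adj2 N) * rho \<alpha> N" by (rule rho_mult) (use assms in simp_all)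
  then have "rho \<alpha> (adj2 N) * rho \<alpha> N = 1" using assms by (simp add: adj2_mult rho_1)
  then have "rho \<alpha> (adj2 N) = inverse (rho \<alpha> N)" by (metis inverse_unique mult.commute)
  then show ?thesis using rho_pow[OF assms] rho_pow[OF a] assms
    by (simp add: mat_powi_def power_int_def matrix_inv_adj2)
qed

text \<open>The eigenvalue of \<open>theta z w\<close> is half of its trace plus or minus the root
  of the discriminant, and the trace \<open>z + conjL z\<close> lies in the base field. For
  \<open>w = 0\<close> that root is the absolute value of \<open>z - conjL z\<close>, so
  \<open>z\<close> itself lies in the extension.\<close>

lemma rho_K_field:
  assumes Q: "quadratic_ends z w \<alpha> \<beta>" and X: "X \<in> K_field z w"
  shows "rho \<alpha> X \<in> field_adjoin F_field (sqrt (discr z w))"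
proof -
  have L: "z \<in> L_field" "w \<in> L_field" and D: "discr z w > 0" using Q by (simp_all add: quadratic_ends_def)
  define K where "K = field_adjoin F_field (sqrt (discr z w))"
  have K: "real_subfield K" unfolding K_def by (rule field_adjoin_subfield)
  note Kc = subfield_closed[OF K]
  have FK: "x \<in> K" if "x \<in> F_field" for x unfolding K_def using field_adjoin_incl(2) that by blast
  define s where "s = sqrt (discr z w)"
  have sK: "s \<in> K" unfolding K_def s_def by (rule field_adjoin_incl(1))
  obtain a b c d where F: "a \<in> F_field" "b \<in> F_field" "c \<in> F_field" "d \<in> F_field"
    and zc: "z = a + c * sqrt eta" "conjL z = a - c * sqrt eta"
    by (rule theta_qmat[OF L])
  have "z + conjL z = a + a" using zc by linarith
  then have sum: "z + conjL z \<in> K" using FK[OF F_closed(3)[OF F(1) F(1)]] by (simp only:)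
  have rt: "rho \<alpha> (theta z w) \<in> K"
  proof (cases "w = 0")
    case True
    then have "discr z w = (z - conjL z)\<^sup>2" by (simp add: discr_def)
    then have "s = \<bar>z - conjL z\<bar>" unfolding s_def by simp
    then have dK: "z - conjL z \<in> K" using sK Kc(7)[OF sK] by (cases "z - conjL z \<ge> 0") auto
    have "z = ((z + conjL z) + (z - conjL z)) / 2" "conjL z = ((z + conjL z) - (z - conjL z)) / 2" by simp_all
    then have zK: "z \<in> K" "conjL z \<in> K" using Kc(3)[OF sum dK] Kc(4)[OF sum dK] Kc(8)[OF _ Kc(11)] by metis+
    have "\<alpha> = PReal 0 \<or> \<alpha> = PInf" using Q True by (auto simp: quadratic_ends_def)
    then show ?thesis using zK by (auto simp: theta_def)
  next
    case False
    have "\<exists>\<sigma>\<in>{1, -1}. \<alpha> = PReal ((z - conjL z + \<sigma> * s) / (2 * w)) \<and> \<beta> = PReal ((z - conjL z - \<sigma> * s) / (2 * w))"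
      using Q False unfolding quadratic_ends_def s_def by (simp only: if_False simp_thms)
    then obtain \<sigma> where sg: "\<sigma> = 1 \<or> \<sigma> = -1" and al: "\<alpha> = PReal ((z - conjL z + \<sigma> * s) / (2 * w))"
      by blast
    have "rho \<alpha> (theta z w) = ((z + conjL z) + \<sigma> * s) / 2"
      unfolding al using False by (simp add: theta_def field_simps)
    also have "\<dots> \<in> K"
    proof -
      have "\<sigma> * s \<in> K" using sg sK Kc(7)[OF sK] by auto
      then show ?thesis by (intro Kc(8,3,11) sum)
    qed
    finally show ?thesis .
  qed
  from X obtain x y where e: "X = mat x + y *\<^sub>R theta z w" and xy: "x \<in> F_field" "y \<in> F_field"
    unfolding K_field_eq[OF L] by blast
  have "rho \<alpha> X = x + y * rho \<alpha> (theta z w)" unfolding e by (cases \<alpha>) (simp_all add: algebra_simps)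
  also have "\<dots> \<in> K" by (intro Kc FK xy rt)
  finally show ?thesis unfolding K_def .
qed

text \<open>A multiple of the traceless part of \<open>theta z w\<close> lies in the order.\<close>
lemma order_multiple:
  assumes "z \<in> L_field" "w \<in> L_field"
  obtains n T where "n \<noteq> 0" "T \<in> order_O" "T$1$1 = (theta z w$1$1 - theta z w$2$2) * n"
    "T$2$2 = (theta z w$2$2 - theta z w$1$1) * n" "T$1$2 = 2 * theta z w$1$2 * n" "T$2$1 = 2 * theta z w$2$1 * n"
proof -
  obtain a b c d where F: "b \<in> F_field" "c \<in> F_field" "d \<in> F_field" and th: "theta z w = qmat a b c d"
    by (rule theta_qmat[OF assms])
  from F obtain fb nb fc nc fd nd where f: "ip fb" "nb \<noteq> 0" "b = fb eta / real_of_int nb"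
    "ip fc" "nc \<noteq> 0" "c = fc eta / real_of_int nc" "ip fd" "nd \<noteq> 0" "d = fd eta / real_of_int nd"
    unfolding F_field_eq Fq_def by blast
  define n where "n = real_of_int (nb * nc * nd)"
  have n: "n \<noteq> 0" using f by (simp add: n_def)
  have "b * n = fb eta * of_int (nc * nd)" "c * n = fc eta * of_int (nb * nd)" "d * n = fd eta * of_int (nb * nc)"
    unfolding n_def f(3,6,9) using f(2,5,8) by simp_all
  then have Z: "b * n \<in> Zr" "c * n \<in> Zr" "d * n \<in> Zr" using f by (auto intro: Zr_closed(8) Zr_I Zr_closed(5))
  define B C D where BCD: "B = b * n" "C = c * n" "D = d * n"
  define T where "T = qmat 0 (2 * B) (2 * C) (2 * D)"
  have "T = oq (- ((eta\<^sup>2 + 1) * (2 * C + eta\<^sup>2 * (2 * D)))) (2 * B - (eta\<^sup>2 + 1) * (eta * (2 * C) + 2 * D)) (4 * C) (4 * D)"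
    unfolding T_def oq_def oqA_def oqB_def by (simp add: algebra_simps)
  moreover have "- ((eta\<^sup>2 + 1) * (2 * C + eta\<^sup>2 * (2 * D))) \<in> Zr" "2 * B - (eta\<^sup>2 + 1) * (eta * (2 * C) + 2 * D) \<in> Zr"
    "4 * C \<in> Zr" "4 * D \<in> Zr" by (intro Zr_closed Z[folded BCD])+
  ultimately have "T \<in> order_O" unfolding order_O_eq by blast
  then show ?thesis
    by (rule that[OF n]) (simp_all add: T_def th BCD algebra_simps)
qed

lemma geo_act_eq_iff: "geo_act X (\<beta>, \<alpha>) = (\<beta>, \<alpha>) \<longleftrightarrow> rp1_act X \<beta> = \<beta> \<and> rp1_act X \<alpha> = \<alpha>"
  by (simp add: geo_act_def)

lemma ends_of_fixed:
  assumes M: "is_frame M (\<beta>, \<alpha>)" and L: "z \<in> L_field" "w \<in> L_field"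
    and fx: "fixq (theta z w) \<beta>" "fixq (theta z w) \<alpha>"
    and ns: "theta z w$2$1 \<noteq> 0 \<or> theta z w$1$2 \<noteq> 0 \<or> theta z w$1$1 \<noteq> theta z w$2$2"
  shows "quadratic_ends z w \<alpha> \<beta>"
proof -
  define T where "T = theta z w"
  define a b c d where abcd: "a = M$1$1" "b = M$1$2" "c = M$2$1" "d = M$2$2"
  define \<Delta> where "\<Delta> = a * d - b * c"
  have D: "\<Delta> > 0" "det M = \<Delta>" using M by (simp_all add: is_frame_def det_2 abcd \<Delta>_def)
  obtain k where k: "T$2$1 = k * (M$1$1 * M$2$1)" "T$2$2 - T$1$1 = k * (M$1$1 * M$2$2 + M$1$2 * M$2$1)"
    "T$1$2 = - (k * (M$1$2 * M$2$2))" unfolding T_def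
    by (rule fixq_frame[OF M, of "theta z w"]) (use fx in auto)
  have k0: "k \<noteq> 0" using ns k unfolding T_def[symmetric] by auto
  have dis: "discr z w = (k * \<Delta>)\<^sup>2"
  proof -
    have "discr z w = (T$2$2 - T$1$1)\<^sup>2 + 4 * T$1$2 * T$2$1"
      unfolding T_def discr_def theta_def mat22_nth by (simp add: power2_eq_square algebra_simps)
    then show ?thesis unfolding fixq_discr[OF k] D .
  qed
  then have pos: "discr z w > 0" using k0 D by simp
  have w: "w = k * (a * c)" and zz: "z - conjL z = - (k * (a * d + b * c))" and wc: "eta * conjL w = - (k * (b * d))"
    using k unfolding T_def theta_def by (simp_all add: abcd)
  have e: "a * fst (hv \<beta>) + b * snd (hv \<beta>) = 0" "c * fst (hv \<alpha>) + d * snd (hv \<alpha>) = 0"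
    using M by (simp_all add: is_frame_def abcd)
  show ?thesis
  proof (cases "w = 0")
    case True
    have "conjL 0 = 0" using conjL_eq[OF F_closed(1,1)] by simp
    then have "b * d = 0" using wc True k0 by simp
    moreover have "a * c = 0" using w True k0 by simp
    ultimately have "(a = 0 \<and> d = 0) \<or> (b = 0 \<and> c = 0)" using D(1) unfolding \<Delta>_def by auto
    then have "(\<alpha> = PReal 0 \<and> \<beta> = PInf) \<or> (\<alpha> = PInf \<and> \<beta> = PReal 0)"
    proof
      assume z: "a = 0 \<and> d = 0"
      then have "b \<noteq> 0" "c \<noteq> 0" using D(1) by (auto simp: \<Delta>_def)
      then show ?thesis using e z by (cases \<alpha>; cases \<beta>) auto
    next
      assume z: "b = 0 \<and> c = 0"
      then have "a \<noteq> 0" "d \<noteq> 0" using D(1) by (auto simp: \<Delta>_def)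
      then show ?thesis using e z by (cases \<alpha>; cases \<beta>) auto
    qed
    then show ?thesis using L pos True by (simp add: quadratic_ends_def)
  next
    case False
    then have ac: "a \<noteq> 0" "c \<noteq> 0" using w by auto
    have al: "\<alpha> = PReal (- d / c)" "\<beta> = PReal (- b / a)"
      using e ac by (cases \<alpha>; cases \<beta>; simp add: field_simps add_eq_0_iff)+
    \<comment> \<open>The frame prescribes which root is \<alpha>; the sign of \<open>k\<close>
      tells which sign of the square root this corresponds to.\<close>
    define \<sigma> :: real where "\<sigma> = (if k > 0 then -1 else 1)"
    have s: "\<sigma> * sqrt (discr z w) = - (k * \<Delta>)"
      unfolding dis using D k0 by (simp add: \<sigma>_def abs_mult)
    have "- d / c = (z - conjL z + \<sigma> * sqrt (discr z w)) / (2 * w)"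
      unfolding s unfolding zz w \<Delta>_def using ac k0 by (simp add: field_simps)
    moreover have "- b / a = (z - conjL z - \<sigma> * sqrt (discr z w)) / (2 * w)"
      unfolding s unfolding zz w \<Delta>_def using ac k0 by (simp add: field_simps)
    moreover have "\<sigma> \<in> {1, -1}" by (simp add: \<sigma>_def)
    ultimately have "\<exists>\<sigma>\<in>{1, -1}. \<alpha> = PReal ((z - conjL z + \<sigma> * sqrt (discr z w)) / (2 * w)) \<and>
        \<beta> = PReal ((z - conjL z - \<sigma> * sqrt (discr z w)) / (2 * w))" unfolding al by metis
    then show ?thesis using L pos False unfolding quadratic_ends_def by (simp only: if_False simp_thms)
  qed
qed

lemma mat_powi_conj:
  assumes "det B = 1" "det X = 1"
  shows "mat_powi (B ** X ** adj2 B) k = B ** mat_powi X k ** adj2 B"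
proof -
  have n: "mat_pow (B ** Y ** adj2 B) n = B ** mat_pow Y n ** adj2 B" for Y n
  proof (induction n)
    case 0 show ?case using assms by (simp add: adj2_mult)
  next
    case (Suc n)
    have "mat_pow (B ** Y ** adj2 B) (Suc n) = B ** Y ** (adj2 B ** B) ** mat_pow Y n ** adj2 B"
      using Suc by (simp add: matrix_mul_assoc)
    then show ?case using assms by (simp add: adj2_mult matrix_mul_assoc)
  qed
  have "adj2 (B ** X ** adj2 B) = B ** adj2 X ** adj2 B"
  proof -
    have "adj2 (adj2 B) = B" by (simp add: mat2_eq_iff)
    then show ?thesis by (simp add: adj2_mult_distrib matrix_mul_assoc)
  qed
  moreover have "det (B ** X ** adj2 B) = 1" using assms by (simp add: det_mul)
  ultimately show ?thesis using assms by (simp add: mat_powi_def matrix_inv_adj2 n)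
qed

theorem theorem3p19:
  fixes \<alpha> \<beta> :: rp1 and B0 :: mat2 and i :: "nat \<Rightarrow> nat"
  assumes "\<alpha> \<noteq> \<beta>"
    and "B0 \<in> Delta237"
    and "is_gcf (geo_act (matrix_inv B0) (\<beta>, \<alpha>)) i"
  shows
    "((\<exists>z w. quadratic_ends z w \<alpha> \<beta>) \<longleftrightarrow>
        (\<exists>l0\<ge>1. gcf_geodesic B0 i (\<beta>, \<alpha>) l0 = gcf_geodesic B0 i (\<beta>, \<alpha>) 0)) \<and>
     (\<forall>l0\<ge>1. gcf_geodesic B0 i (\<beta>, \<alpha>) l0 = gcf_geodesic B0 i (\<beta>, \<alpha>) 0 \<longrightarrow>
        (\<forall>k\<ge>1. i (k + l0) = i k)) \<and>
     (\<forall>z w l0 \<gamma>0.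
        quadratic_ends z w \<alpha> \<beta> \<and>
        l0 \<ge> 1 \<and> gcf_geodesic B0 i (\<beta>, \<alpha>) l0 = gcf_geodesic B0 i (\<beta>, \<alpha>) 0 \<and>
        (\<forall>l. 1 \<le> l \<and> l < l0 \<longrightarrow>
           gcf_geodesic B0 i (\<beta>, \<alpha>) l \<noteq> gcf_geodesic B0 i (\<beta>, \<alpha>) 0) \<and>
        \<gamma>0 = gcf_B B0 i l0 ** matrix_inv B0 \<longrightarrow>
          \<gamma>0 \<in> stabilizer (\<beta>, \<alpha>) \<and>
          stabilizer (\<beta>, \<alpha>) = K_order1 z w \<and>
          mat_fundamental_unit \<gamma>0 (K_order1 z w) \<and>
          rho \<alpha> \<gamma>0 \<in> field_adjoin F_field (sqrt (discr z w)) \<and>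
          real_fundamental_unit (rho \<alpha> \<gamma>0) (U_group \<alpha> z w))"
proof -
  have dB: "det B0 = 1" by (rule Delta237_det[OF assms(2)])
  have dBa: "det (adj2 B0) = 1" using dB by simp
  define \<omega> where "\<omega> = geo_act (adj2 B0) (\<beta>, \<alpha>)"
  have om: "geo_act (matrix_inv B0) (\<beta>, \<alpha>) = \<omega>" by (simp add: \<omega>_def matrix_inv_adj2 dB)
  have B\<omega>: "geo_act B0 \<omega> = (\<beta>, \<alpha>)" unfolding \<omega>_def by (rule geo_act_adj2(2)[OF dB])
  have g: "is_gcf \<omega> i" using assms(3) unfolding om .
  have geo: "gcf_geodesic B0 i (\<beta>, \<alpha>) k = gcf_step \<omega> i k" for k
    unfolding gcf_geodesic_eq[OF assms(2)] om ..
  have ne: "fst (\<beta>, \<alpha>) \<noteq> snd (\<beta>, \<alpha>)" using assms(1) by simp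
  obtain M' where M': "is_frame M' (\<beta>, \<alpha>)" by (rule is_frame_exists[OF ne])
  \<comment> \<open>A frame for the translate of the geodesic by the inverse of \<open>B0\<close>,
    with which the expansion starts.\<close>
  define M where "M = M' ** B0"
  have M: "is_frame M \<omega>" unfolding M_def
    by (rule is_frame_act[OF _ dB]) (unfold B\<omega>, rule M')
  have dM': "det M' > 0" using M' by (simp add: is_frame_def)
  define \<gamma> where "\<gamma> l = B0 ** gB i l ** adj2 B0" for l
  have gam: "gcf_B B0 i l ** matrix_inv B0 = \<gamma> l" for l
    unfolding \<gamma>_def gcf_B_eq by (simp add: matrix_inv_adj2 dB)
  have gamD: "\<gamma> l \<in> Delta237" for l unfolding \<gamma>_def
    by (intro Delta237_mult Delta237_adj gB_Delta assms(2))
  have gamS: "\<gamma> l \<in> stabilizer (\<beta>, \<alpha>)" if "gcf_step \<omega> i l = gcf_step \<omega> i 0" for l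
  proof -
    have "geo_act (\<gamma> l) (\<beta>, \<alpha>) = geo_act B0 (geo_act (gB i l) \<omega>)"
      unfolding \<gamma>_def \<omega>_def by (simp add: geo_act_mult det_mul det_gB dB)
    also have "geo_act (gB i l) \<omega> = \<omega>" using gcf_step_gB[of \<omega> i l] that by simp
    finally have "geo_act (\<gamma> l) (\<beta>, \<alpha>) = (\<beta>, \<alpha>)" unfolding B\<omega> .
    then show ?thesis using gamD by (simp add: stabilizer_def geo_act_eq_iff)
  qed
  have per1: "\<exists>l0\<ge>1. gcf_step \<omega> i l0 = gcf_step \<omega> i 0" if Q: "quadratic_ends z w \<alpha> \<beta>" for z w
  proof -
    have L: "z \<in> L_field" "w \<in> L_field" and D: "discr z w > 0" using Q by (simp_all add: quadratic_ends_def)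
    define \<Theta> where "\<Theta> = theta z w"
    note fq = quadratic_ends_fixq[OF Q, folded \<Theta>_def]
    obtain k where k: "\<Theta>$2$1 = k * (M'$1$1 * M'$2$1)" "\<Theta>$2$2 - \<Theta>$1$1 = k * (M'$1$1 * M'$2$2 + M'$1$2 * M'$2$1)"
      "\<Theta>$1$2 = - (k * (M'$1$2 * M'$2$2))"
      by (rule fixq_frame[OF M', of \<Theta>]) (use fq in auto)
    have "discr z w = (\<Theta>$2$2 - \<Theta>$1$1)\<^sup>2 + 4 * \<Theta>$1$2 * \<Theta>$2$1"
      unfolding \<Theta>_def discr_def theta_def mat22_nth by (simp add: power2_eq_square algebra_simps)
    then have "(k * det M')\<^sup>2 > 0" using D unfolding fixq_discr[OF k] by simp
    then have k0: "k \<noteq> 0" by auto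
    obtain n T where n: "n \<noteq> 0" "T \<in> order_O" and T: "T$1$1 = (\<Theta>$1$1 - \<Theta>$2$2) * n"
      "T$2$2 = (\<Theta>$2$2 - \<Theta>$1$1) * n" "T$1$2 = 2 * \<Theta>$1$2 * n" "T$2$1 = 2 * \<Theta>$2$1 * n"
      unfolding \<Theta>_def by (rule order_multiple[OF L])
    define \<mu> where "\<mu> = - (k * n * det M')"
    have mu: "\<mu> \<noteq> 0" using k0 n(1) dM' by (simp add: \<mu>_def)
    have e: "M' ** T = mat22 \<mu> 0 0 (- \<mu>) ** M'" unfolding \<mu>_def by (rule fixq_eigen[OF k T])
    define T' where "T' = adj2 B0 ** T ** B0"
    have "T' \<in> order_O" unfolding T'_def
      using assms(2) Delta237_adj[OF assms(2)] n(2) by (intro order_O_ring(3)) (simp_all add: Delta237_iff)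
    moreover have "M ** T' = mat22 \<mu> 0 0 (- \<mu>) ** M"
    proof -
      have "M ** T' = M' ** (B0 ** adj2 B0) ** T ** B0" unfolding M_def T'_def by (simp only: matrix_mul_assoc)
      also have "\<dots> = mat22 \<mu> 0 0 (- \<mu>) ** M' ** B0" by (simp add: adj2_mult dB e)
      finally show ?thesis unfolding M_def by (simp only: matrix_mul_assoc)
    qed
    ultimately obtain l where "l \<ge> 1" "gcf_step \<omega> i l = gcf_step \<omega> i 0"
      using period_exists[OF M g _ _ mu] by blast
    then show ?thesis by blast
  qed
  \<comment> \<open>The conjugated period matrix fixes both endpoints and, written as
    \<open>theta z w\<close>, is itself the witness.\<close>
  have per2: "\<exists>z w. quadratic_ends z w \<alpha> \<beta>" if l: "l \<ge> 1" "gcf_step \<omega> i l = gcf_step \<omega> i 0" for l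
  proof -
    have S: "\<gamma> l \<in> stabilizer (\<beta>, \<alpha>)" by (rule gamS[OF l(2)])
    have "\<gamma> l \<in> order_O" using gamD by (simp add: Delta237_iff)
    then obtain a b c d where F: "a \<in> F_field" "b \<in> F_field" "c \<in> F_field" "d \<in> F_field" and q: "\<gamma> l = qmat a b c d"
      by (rule order_qmat)
    define z w where zw: "z = a + c * sqrt eta" "w = b + d * sqrt eta"
    have th: "\<gamma> l = theta z w" "z \<in> L_field" "w \<in> L_field"
      unfolding q zw by (rule qmat_theta[OF F])+
    have "det (\<gamma> l) \<noteq> 0" using Delta237_det[OF gamD] by simp
    then have fx: "fixq (theta z w) \<beta>" "fixq (theta z w) \<alpha>"
      using S fixq_act[of "\<gamma> l"] unfolding th(1)[symmetric] by (simp_all add: stabilizer_def)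
    \<comment> \<open>A scalar period matrix would leave \<open>EE\<close> unchanged, whereas
      \<open>EE\<close> strictly decreases along the chain.\<close>
    have "theta z w$2$1 \<noteq> 0 \<or> theta z w$1$2 \<noteq> 0 \<or> theta z w$1$1 \<noteq> theta z w$2$2"
    proof (rule ccontr)
      assume "\<not> ?thesis"
      then have sc: "\<gamma> l = mat (\<gamma> l$1$1)" unfolding th(1)[symmetric] mat2_eq_iff by simp
      define x where "x = \<gamma> l$1$1"
      have "gB i l = adj2 B0 ** \<gamma> l ** B0"
        unfolding \<gamma>_def by (simp add: matrix_mul_assoc adj2_mult dB) (simp add: matrix_mul_assoc[symmetric] adj2_mult dB)
      also have "\<dots> = adj2 B0 ** mat x ** B0" using sc by (simp add: x_def)
      also have "\<dots> = mat (x * det B0)" unfolding mat2_eq_iff det_2 by (simp add: algebra_simps)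
      finally have gx: "gB i l = mat x" using dB by simp
      have "x * x = 1" using det_gB[of i l] unfolding gx det_2 by simp
      moreover have "EE (M ** mat x) tau7 = x * x * EE M tau7" by (simp add: EE_def power2_eq_square algebra_simps)
      moreover have "EE (M ** gB i l) tau7 < EE (M ** gB i 0) tau7" using chain_height[OF M g, of 0 l] l(1) by simp
      ultimately show False unfolding gx by simp
    qed
    from ends_of_fixed[OF M' th(2,3) fx this] show ?thesis by blast
  qed
  have part1: "(\<exists>z w. quadratic_ends z w \<alpha> \<beta>) \<longleftrightarrow> (\<exists>l0\<ge>1. gcf_step \<omega> i l0 = gcf_step \<omega> i 0)"
    using per1 per2 by blast
  have part2: "i (k + l0) = i k" if "gcf_step \<omega> i l0 = gcf_step \<omega> i 0" "k \<ge> 1" for l0 k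
    using step_periodic[OF M g that(1), of "k - 1"] that(2) by simp
  have part3: "\<gamma> l0 \<in> stabilizer (\<beta>, \<alpha>) \<and> stabilizer (\<beta>, \<alpha>) = K_order1 z w \<and>
          mat_fundamental_unit (\<gamma> l0) (K_order1 z w) \<and>
          rho \<alpha> (\<gamma> l0) \<in> field_adjoin F_field (sqrt (discr z w)) \<and>
          real_fundamental_unit (rho \<alpha> (\<gamma> l0)) (U_group \<alpha> z w)"
    if Q: "quadratic_ends z w \<alpha> \<beta>" and l: "l0 \<ge> 1" "gcf_step \<omega> i l0 = gcf_step \<omega> i 0"
      and min: "\<And>l. 1 \<le> l \<Longrightarrow> l < l0 \<Longrightarrow> gcf_step \<omega> i l \<noteq> gcf_step \<omega> i 0" for z w l0
  proof -
    define \<epsilon> where "\<epsilon> = \<gamma> l0"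
    have S: "\<epsilon> \<in> stabilizer (\<beta>, \<alpha>)" unfolding \<epsilon>_def by (rule gamS[OF l(2)])
    have K: "stabilizer (\<beta>, \<alpha>) = K_order1 z w" by (rule stabilizer_K_order1[OF Q assms(1)])
    have \<epsilon>: "\<epsilon> \<in> Delta237" "rp1_act \<epsilon> \<beta> = \<beta>" "rp1_act \<epsilon> \<alpha> = \<alpha>" using S by (simp_all add: stabilizer_def)
    have d\<epsilon>: "det \<epsilon> = 1" by (rule Delta237_det[OF \<epsilon>(1)])
    have fr: "is_frame M' (geo_act \<epsilon> (\<beta>, \<alpha>))" using M' \<epsilon> by (simp add: geo_act_def)
    obtain c where c: "stab_scale M' (\<beta>, \<alpha>) \<epsilon> c"
      by (rule stab_scale_exists[OF M' \<epsilon>(1)]) (use \<epsilon> in \<open>simp add: geo_act_def\<close>)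
    \<comment> \<open>\<open>stab_scale\<close> includes membership in the group and invariance of
      the geodesic, and it is closed under integer powers.\<close>
    have pw: "mat_powi \<epsilon> k \<in> stabilizer (\<beta>, \<alpha>)" for k
      using stab_scale_powi[OF c, of k] by (simp add: stab_scale_def stabilizer_def geo_act_eq_iff)
    have pwm: "- mat_powi \<epsilon> k \<in> stabilizer (\<beta>, \<alpha>)" for k
      using pw[of k] by (simp add: stabilizer_def Delta237_minus mat_neg_one_act)
    have gen: "\<exists>k. X = mat_powi \<epsilon> k \<or> X = - mat_powi \<epsilon> k" if X: "X \<in> stabilizer (\<beta>, \<alpha>)" for X
    proof -
      \<comment> \<open>Conjugation by \<open>B0\<close> transports the stabilizer to the geodesic
        at which the expansion starts, where \<open>stabilizer_generated\<close> applies.\<close>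
      define Y where "Y = adj2 B0 ** X ** B0"
      have XD: "X \<in> Delta237" "geo_act X (\<beta>, \<alpha>) = (\<beta>, \<alpha>)" using X by (simp_all add: stabilizer_def geo_act_eq_iff)
      have YD: "Y \<in> Delta237" unfolding Y_def by (intro Delta237_mult Delta237_adj XD assms(2))
      have "geo_act Y \<omega> = geo_act (adj2 B0) (geo_act X (geo_act B0 \<omega>))"
        unfolding Y_def using Delta237_det[OF XD(1)] by (simp add: geo_act_mult det_mul dB)
      then have "geo_act Y \<omega> = \<omega>" unfolding B\<omega> XD(2) by (simp add: \<omega>_def)
      then obtain m where "Y = mat_powi (gB i l0) m \<or> Y = - mat_powi (gB i l0) m"
        using stabilizer_generated[OF M g l min YD] by blast
      moreover have "X = B0 ** Y ** adj2 B0"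
      proof -
        have "B0 ** Y ** adj2 B0 = (B0 ** adj2 B0) ** X ** (B0 ** adj2 B0)" unfolding Y_def by (simp only: matrix_mul_assoc)
        then show ?thesis by (simp add: adj2_mult dB)
      qed
      ultimately have "X = B0 ** mat_powi (gB i l0) m ** adj2 B0 \<or> X = - (B0 ** mat_powi (gB i l0) m ** adj2 B0)"
        by (auto simp: mult_minus_right2 mult_minus_left2)
      then show ?thesis unfolding mat_powi_conj[OF dB det_gB, symmetric] \<gamma>_def[symmetric] \<epsilon>_def[symmetric] by blast
    qed
    have fund: "K_order1 z w = {X. \<exists>k::int. X = mat_powi \<epsilon> k \<or> X = - mat_powi \<epsilon> k}"
      unfolding K[symmetric] using gen pw pwm by blast
    have mfu: "mat_fundamental_unit \<epsilon> (K_order1 z w)"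
      unfolding mat_fundamental_unit_def using S K fund by blast
    have "\<epsilon> \<in> K_field z w" using S unfolding K K_order1_def mat_units_def K_order_def by blast
    then have rK: "rho \<alpha> \<epsilon> \<in> field_adjoin F_field (sqrt (discr z w))" by (rule rho_K_field[OF Q])
    have rp: "rho \<alpha> (mat_powi \<epsilon> k) = rho \<alpha> \<epsilon> powi k" for k by (rule rho_powi[OF \<epsilon>(3) d\<epsilon>])
    have "U_group \<alpha> z w = {x. \<exists>k::int. x = rho \<alpha> \<epsilon> powi k \<or> x = - (rho \<alpha> \<epsilon> powi k)}"
    proof (intro equalityI subsetI)
      fix x assume "x \<in> U_group \<alpha> z w"
      then obtain X where "X \<in> K_order1 z w" "x = rho \<alpha> X" unfolding U_group_def by blast
      then obtain k where "x = rho \<alpha> (mat_powi \<epsilon> k) \<or> x = rho \<alpha> (- mat_powi \<epsilon> k)" unfolding fund by blast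
      then show "x \<in> {x. \<exists>k::int. x = rho \<alpha> \<epsilon> powi k \<or> x = - (rho \<alpha> \<epsilon> powi k)}"
        unfolding rho_minus rp by blast
    next
      fix x assume "x \<in> {x. \<exists>k::int. x = rho \<alpha> \<epsilon> powi k \<or> x = - (rho \<alpha> \<epsilon> powi k)}"
      then obtain k where "x = rho \<alpha> (mat_powi \<epsilon> k) \<or> x = rho \<alpha> (- mat_powi \<epsilon> k)" unfolding rho_minus rp by blast
      moreover have "mat_powi \<epsilon> k \<in> K_order1 z w" "- mat_powi \<epsilon> k \<in> K_order1 z w" unfolding fund by blast+
      ultimately show "x \<in> U_group \<alpha> z w" unfolding U_group_def by blast
    qed
    moreover have "rho \<alpha> \<epsilon> \<in> U_group \<alpha> z w" unfolding U_group_def using S K by blast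
    ultimately have "real_fundamental_unit (rho \<alpha> \<epsilon>) (U_group \<alpha> z w)" unfolding real_fundamental_unit_def by blast
    then show ?thesis using S K mfu rK unfolding \<epsilon>_def by blast
  qed
  show ?thesis unfolding geo gam
    using part1 part2 part3 by blast
qed

end
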